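(* Let $\bar\otimes$ denote the tensor product over $\mathbb{C}_q[S^2]$. The element (metric) $$g=q^2\,\mathrm{d}b_-\bar\otimes\mathrm{d}b_++\mathrm{d}b_+\bar\otimes\mathrm{d}b_--[2]_q\,\mathrm{d}b_0\bar\otimes\mathrm{d}b_0\in\Omega^1(\mathbb{C}_q[S^2])\bar\otimes\Omega^1(\mathbb{C}_q[S^2])$$ is invariant under the left coaction of $\mathbb{C}_q[SL_2]$ and is $q$-symmetric in the sense that $\wedge(g)=0$. Moreover, $g\in(\Omega^{1,0}\bar\otimes\Omega^{0,1})\oplus(\Omega^{0,1}\bar\otimes\Omega^{1,0})$.
   Context: $q\in\mathbb{C}$ is invertible and $[2]_q=q+q^{-1}$. $\mathbb{C}_q[SL_2]$ is the Hopf algebra generated by $a,b,c,d$ with $ba=qab$, $ca=qac$, $db=qbd$, $dc=qcd$, $bc=cb$, $ad=1+q^{-1}bc$, $da=1+qbc$ and matrix coproduct. It is $\mathbb{Z}$-graded by $\deg a=\deg c=1$, $\deg b=\deg d=-1$; $\mathbb{C}_q[SL_2]_n$ is the degree $n$ component. $\mathbb{C}_q[S^2]=\mathbb{C}_q[SL_2]_0$ is generated by $b_0=bc$, $b_+=cd$, $b_-=ab$. $\Omega^1(\mathbb{C}_q[SL_2])$ is the left-covariant bimodule calculus that is free as a left module on left-invariant forms $e^+,e^-,e^0$, with $e^\pm x=q^{\deg x}x\,e^\pm$ and $e^0x=q^{2\deg x}x\,e^0$ for homogeneous $x$, and $$\mathrm{d}a=ae^0+qbe^+,\quad \mathrm{d}b=ae^--q^{-2}be^0,\quad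 \mathrm{d}c=ce^0+qde^+,\quad \mathrm{d}d=ce^--q^{-2}de^0.$$ It extends to an exterior algebra with $(e^\pm)^2=(e^0)^2=0$, $q^2e^+\wedge e^-+e^-\wedge e^+=0$, $e^0\wedge e^\pm+q^{\pm4}e^\pm\wedge e^0=0$. $\Omega(\mathbb{C}_q[S^2])$ is the differential subalgebra generated by $\mathbb{C}_q[S^2]$ and $\mathrm{d}\mathbb{C}_q[S^2]$. One has $\Omega^1(\mathbb{C}_q[S^2])=\Omega^{1,0}\oplus\Omega^{0,1}$ with $\Omega^{1,0}=\mathbb{C}_q[SL_2]_{-2}e^+$ and $\Omega^{0,1}=\mathbb{C}_q[SL_2]_2e^-$. The left coaction on $\Omega^1(\mathbb{C}_q[S^2])$ is $\Delta_L(fe^\pm)=f_{(1)}\otimes f_{(2)}e^\pm$ (so that $\mathrm{d}$ intertwines it with the restriction of the coproduct to $\mathbb{C}_q[S^2]$), extended to $\Omega^1\bar\otimes\Omega^1$ as a tensor product coaction; invariant means $\Delta_Lg=1\otimes g$. *)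

theory Defs
  imports Complex_Main "HOL-Library.Poly_Mapping" "HOL-Algebra.QuotRing" "HOL-Algebra.Module"
begin

section \<open>Free complex vector spaces, quotients and tensor products\<close>

text \<open>\<^typ>\<open>'a \<Rightarrow>\<^sub>0 complex\<close> is the free complex vector space on \<^typ>\<open>'a\<close>.  Complex vector spaces
  with a carrier are rendered as records of type \<^typ>\<open>(complex, 'v) module\<close>; the multiplicative
  fields are junk unless the space is an algebra.\<close>

definition scale :: "complex \<Rightarrow> ('a \<Rightarrow>\<^sub>0 complex) \<Rightarrow> ('a \<Rightarrow>\<^sub>0 complex)" where
  "scale z p = Poly_Mapping.map ((*) z) p"

lemma lookup_scale: "Poly_Mapping.lookup (scale z p) k = z * Poly_Mapping.lookup p k"
  unfolding scale_def by (simp add: Poly_Mapping.map.rep_eq when_def)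

global_interpretation fvs: vector_space "scale :: complex \<Rightarrow> ('a \<Rightarrow>\<^sub>0 complex) \<Rightarrow> ('a \<Rightarrow>\<^sub>0 complex)"
  by standard
    (auto intro!: poly_mapping_eqI simp: lookup_scale Poly_Mapping.lookup_add algebra_simps)

definition free_mod :: "'a set \<Rightarrow> (complex, 'a \<Rightarrow>\<^sub>0 complex) module" where
  "free_mod S = \<lparr>carrier = {p. Poly_Mapping.keys p \<subseteq> S}, mult = undefined, one = undefined,
     zero = 0, add = (+), smult = scale\<rparr>"

definition quot_mod :: "(complex, 'v) module \<Rightarrow> 'v set \<Rightarrow> (complex, 'v set) module" where
  "quot_mod V U = \<lparr>carrier = a_rcosets\<^bsub>V\<^esub> U, mult = undefined, one = undefined,
     zero = U, add = set_add V, smult = (\<lambda>z X. \<Union>x\<in>X. U +>\<^bsub>V\<^esub> (z \<odot>\<^bsub>V\<^esub> x))\<rparr>"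

text \<open>If \<^term>\<open>T\<close> is a quotient of a free vector space by a subspace \<^term>\<open>U\<close>, the zero of \<^term>\<open>T\<close>
  is \<^term>\<open>U\<close> itself, and \<^term>\<open>cls T p\<close> is the class of \<^term>\<open>p\<close> in \<^term>\<open>T\<close>.\<close>

definition cls :: "(complex, ('a \<Rightarrow>\<^sub>0 complex) set) module \<Rightarrow> ('a \<Rightarrow>\<^sub>0 complex) \<Rightarrow> ('a \<Rightarrow>\<^sub>0 complex) set" where
  "cls T p = \<zero>\<^bsub>T\<^esub> +>\<^bsub>free_mod UNIV\<^esub> p"

text \<open>Maps out of a quotient are given by their value on representatives; as in
  \<^theory>\<open>HOL-Algebra.Coset\<close>, \<^const>\<open>the_elem\<close> picks the common value.\<close>

definition descend :: "('v \<Rightarrow> 'w) \<Rightarrow> 'v set \<Rightarrow> 'w" where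
  "descend f X = the_elem (f ` X)"

definition lin_ext :: "(complex, 'w) module \<Rightarrow> ('a \<Rightarrow> 'w) \<Rightarrow> ('a \<Rightarrow>\<^sub>0 complex) \<Rightarrow> 'w" where
  "lin_ext W f p =
     (\<Oplus>\<^bsub>W\<^esub>k\<in>Poly_Mapping.keys p. Poly_Mapping.lookup p k \<odot>\<^bsub>W\<^esub> f k)"

abbreviation pt :: "'a \<Rightarrow> ('a \<Rightarrow>\<^sub>0 complex)" where
  "pt k \<equiv> Poly_Mapping.single k 1"

definition free_map :: "('a \<Rightarrow> 'b) \<Rightarrow> ('a \<Rightarrow>\<^sub>0 complex) \<Rightarrow> ('b \<Rightarrow>\<^sub>0 complex)" where
  "free_map f p = (\<Sum>k\<in>Poly_Mapping.keys p. scale (Poly_Mapping.lookup p k) (pt (f k)))"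

text \<open>The tensor product of a right \<^term>\<open>R\<close>-module \<^term>\<open>M\<close> (action \<^term>\<open>ra\<close>) and a left
  \<^term>\<open>R\<close>-module \<^term>\<open>N\<close> (action \<^term>\<open>la\<close>), where \<^term>\<open>R\<close> is the underlying set of a complex algebra.\<close>

definition tensor_rels :: "(complex, 'm) module \<Rightarrow> (complex, 'n) module \<Rightarrow> 'r set
    \<Rightarrow> ('m \<Rightarrow> 'r \<Rightarrow> 'm) \<Rightarrow> ('r \<Rightarrow> 'n \<Rightarrow> 'n) \<Rightarrow> ('m \<times> 'n \<Rightarrow>\<^sub>0 complex) set" where
  "tensor_rels M N R ra la =
     {pt (m \<oplus>\<^bsub>M\<^esub> m', n) - pt (m, n) - pt (m', n) | m m' n.
        m \<in> carrier M \<and> m' \<in> carrier M \<and> n \<in> carrier N}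
   \<union> {pt (m, n \<oplus>\<^bsub>N\<^esub> n') - pt (m, n) - pt (m, n') | m n n'.
        m \<in> carrier M \<and> n \<in> carrier N \<and> n' \<in> carrier N}
   \<union> {pt (z \<odot>\<^bsub>M\<^esub> m, n) - scale z (pt (m, n)) | z m n. m \<in> carrier M \<and> n \<in> carrier N}
   \<union> {pt (m, z \<odot>\<^bsub>N\<^esub> n) - scale z (pt (m, n)) | z m n. m \<in> carrier M \<and> n \<in> carrier N}
   \<union> {pt (ra m r, n) - pt (m, la r n) | m r n. m \<in> carrier M \<and> r \<in> R \<and> n \<in> carrier N}"

definition tensor :: "(complex, 'm) module \<Rightarrow> (complex, 'n) module \<Rightarrow> 'r set
    \<Rightarrow> ('m \<Rightarrow> 'r \<Rightarrow> 'm) \<Rightarrow> ('r \<Rightarrow> 'n \<Rightarrow> 'n) \<Rightarrow> (complex, ('m \<times> 'n \<Rightarrow>\<^sub>0 complex) set) module" where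
  "tensor M N R ra la =
     quot_mod (free_mod (carrier M \<times> carrier N)) (fvs.span (tensor_rels M N R ra la))"

definition tensorC :: "(complex, 'm) module \<Rightarrow> (complex, 'n) module
    \<Rightarrow> (complex, ('m \<times> 'n \<Rightarrow>\<^sub>0 complex) set) module" where
  "tensorC M N = tensor M N UNIV (\<lambda>m z. z \<odot>\<^bsub>M\<^esub> m) (\<lambda>z n. z \<odot>\<^bsub>N\<^esub> n)"


section \<open>The algebra $\mathbb{C}_q[SL_2]$\<close>

datatype gen = Ga | Gb | Gc | Gd

datatype word = Word (letters: "gen list")

text \<open>Concatenation of words is written additively, so that the convolution product of
  \<^theory>\<open>HOL-Library.Poly_Mapping\<close> makes \<^typ>\<open>word \<Rightarrow>\<^sub>0 complex\<close> the free (noncommutative) algebra.\<close>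

instantiation word :: monoid_add
begin
definition zero_word :: word where "zero_word = Word []"
definition plus_word :: "word \<Rightarrow> word \<Rightarrow> word" where "plus_word u v = Word (letters u @ letters v)"
instance
  by standard (simp_all add: zero_word_def plus_word_def)
end

type_synonym nc = "word \<Rightarrow>\<^sub>0 complex"

definition nc_ring :: "nc ring" where
  "nc_ring = \<lparr>carrier = UNIV, mult = (*), one = 1, zero = 0, add = (+)\<rparr>"

definition ncX :: "gen \<Rightarrow> nc" where "ncX g = pt (Word [g])"

definition SL2_rels :: "complex \<Rightarrow> nc set" where
  "SL2_rels q =
     {ncX Gb * ncX Ga - scale q (ncX Ga * ncX Gb),
      ncX Gc * ncX Ga - scale q (ncX Ga * ncX Gc),
      ncX Gd * ncX Gb - scale q (ncX Gb * ncX Gd),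
      ncX Gd * ncX Gc - scale q (ncX Gc * ncX Gd),
      ncX Gb * ncX Gc - ncX Gc * ncX Gb,
      ncX Ga * ncX Gd - (1 + scale (inverse q) (ncX Gb * ncX Gc)),
      ncX Gd * ncX Ga - (1 + scale q (ncX Gb * ncX Gc))}"

definition SL2 :: "complex \<Rightarrow> (complex, nc set) module" where
  "SL2 q = (let A = nc_ring Quot (Idl\<^bsub>nc_ring\<^esub> (SL2_rels q)) in
     \<lparr>carrier = carrier A, mult = mult A, one = one A, zero = zero A, add = add A,
      smult = (\<lambda>z x. (Idl\<^bsub>nc_ring\<^esub> (SL2_rels q) +>\<^bsub>nc_ring\<^esub> scale z 1) \<otimes>\<^bsub>A\<^esub> x)\<rparr>)"

definition mat :: "complex \<Rightarrow> gen \<Rightarrow> nc set" where "mat q g = cls (SL2 q) (ncX g)"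

subsection \<open>Grading\<close>

fun deg_gen :: "gen \<Rightarrow> int" where
  "deg_gen Ga = 1" | "deg_gen Gc = 1" | "deg_gen Gb = -1" | "deg_gen Gd = -1"

definition deg :: "word \<Rightarrow> int" where "deg w = (\<Sum>g\<leftarrow>letters w. deg_gen g)"

definition SL2_deg :: "complex \<Rightarrow> int \<Rightarrow> nc set set" where
  "SL2_deg q n = cls (SL2 q) ` {x. \<forall>w\<in>Poly_Mapping.keys x. deg w = n}"

abbreviation S2 :: "complex \<Rightarrow> nc set set" where "S2 q \<equiv> SL2_deg q 0"

definition b0 :: "complex \<Rightarrow> nc set" where "b0 q = mat q Gb \<otimes>\<^bsub>SL2 q\<^esub> mat q Gc"
definition bp :: "complex \<Rightarrow> nc set" where "bp q = mat q Gc \<otimes>\<^bsub>SL2 q\<^esub> mat q Gd"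
definition bm :: "complex \<Rightarrow> nc set" where "bm q = mat q Ga \<otimes>\<^bsub>SL2 q\<^esub> mat q Gb"

text \<open>The algebra automorphism given by $x \mapsto q^{k \deg x} x$ on homogeneous $x$.\<close>

definition twist :: "complex \<Rightarrow> int \<Rightarrow> nc set \<Rightarrow> nc set" where
  "twist q k = descend (\<lambda>x. cls (SL2 q)
     (\<Sum>w\<in>Poly_Mapping.keys x. scale (q powi (k * deg w) * Poly_Mapping.lookup x w) (pt w)))"

subsection \<open>Coproduct\<close>

text \<open>\<^term>\<open>coprod_gen g\<close> lists the two terms of the matrix coproduct of a generator.  On a
  word, multiplicativity of the coproduct gives a sum of pairs of words.\<close>

fun coprod_gen :: "gen \<Rightarrow> (gen \<times> gen) list" where
  "coprod_gen Ga = [(Ga, Ga), (Gb, Gc)]"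
| "coprod_gen Gb = [(Ga, Gb), (Gb, Gd)]"
| "coprod_gen Gc = [(Gc, Ga), (Gd, Gc)]"
| "coprod_gen Gd = [(Gc, Gb), (Gd, Gd)]"

fun coprod_word :: "gen list \<Rightarrow> (gen list \<times> gen list) list" where
  "coprod_word [] = [([], [])]"
| "coprod_word (g # w) = [(g1 # u, g2 # v). (g1, g2) \<leftarrow> coprod_gen g, (u, v) \<leftarrow> coprod_word w]"

definition coprod :: "complex \<Rightarrow> nc set \<Rightarrow> (nc set \<times> nc set \<Rightarrow>\<^sub>0 complex) set" where
  "coprod q = descend (lin_ext (tensorC (SL2 q) (SL2 q)) (\<lambda>w.
     cls (tensorC (SL2 q) (SL2 q))
       (\<Sum>(u, v)\<leftarrow>coprod_word (letters w). pt (cls (SL2 q) (pt (Word u)), cls (SL2 q) (pt (Word v))))))"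


section \<open>Differential calculus\<close>

datatype form = Ep | Em | E0

text \<open>\<^term>\<open>\<omega> :: form \<Rightarrow> nc set\<close> stands for $\sum_i \omega_i e^i$.\<close>

definition Om_SL2 :: "complex \<Rightarrow> (complex, form \<Rightarrow> nc set) module" where
  "Om_SL2 q = \<lparr>carrier = {\<omega>. \<forall>i. \<omega> i \<in> carrier (SL2 q)}, mult = undefined, one = undefined,
     zero = (\<lambda>i. \<zero>\<^bsub>SL2 q\<^esub>), add = (\<lambda>\<omega> \<eta> i. \<omega> i \<oplus>\<^bsub>SL2 q\<^esub> \<eta> i),
     smult = (\<lambda>z \<omega> i. z \<odot>\<^bsub>SL2 q\<^esub> \<omega> i)\<rparr>"

text \<open>The commutation rule is $e^i x = q^{k_i \deg x} x e^i$ with $k_i$ = \<^term>\<open>wt i\<close>.\<close>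

fun wt :: "form \<Rightarrow> int" where
  "wt Ep = 1" | "wt Em = 1" | "wt E0 = 2"

definition lact :: "complex \<Rightarrow> nc set \<Rightarrow> (form \<Rightarrow> nc set) \<Rightarrow> (form \<Rightarrow> nc set)" where
  "lact q x \<omega> = (\<lambda>i. x \<otimes>\<^bsub>SL2 q\<^esub> \<omega> i)"

definition ract :: "complex \<Rightarrow> (form \<Rightarrow> nc set) \<Rightarrow> nc set \<Rightarrow> (form \<Rightarrow> nc set)" where
  "ract q \<omega> x = (\<lambda>i. \<omega> i \<otimes>\<^bsub>SL2 q\<^esub> twist q (wt i) x)"

definition bas :: "complex \<Rightarrow> form \<Rightarrow> (form \<Rightarrow> nc set)" where
  "bas q i = (\<lambda>j. if j = i then \<one>\<^bsub>SL2 q\<^esub> else \<zero>\<^bsub>SL2 q\<^esub>)"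

fun d_gen :: "complex \<Rightarrow> gen \<Rightarrow> (form \<Rightarrow> nc set)" where
  "d_gen q Ga = lact q (mat q Ga) (bas q E0) \<oplus>\<^bsub>Om_SL2 q\<^esub> q \<odot>\<^bsub>Om_SL2 q\<^esub> lact q (mat q Gb) (bas q Ep)"
| "d_gen q Gb = lact q (mat q Ga) (bas q Em)
     \<oplus>\<^bsub>Om_SL2 q\<^esub> (- (q powi -2)) \<odot>\<^bsub>Om_SL2 q\<^esub> lact q (mat q Gb) (bas q E0)"
| "d_gen q Gc = lact q (mat q Gc) (bas q E0) \<oplus>\<^bsub>Om_SL2 q\<^esub> q \<odot>\<^bsub>Om_SL2 q\<^esub> lact q (mat q Gd) (bas q Ep)"
| "d_gen q Gd = lact q (mat q Gc) (bas q Em)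
     \<oplus>\<^bsub>Om_SL2 q\<^esub> (- (q powi -2)) \<odot>\<^bsub>Om_SL2 q\<^esub> lact q (mat q Gd) (bas q E0)"

fun d_word :: "complex \<Rightarrow> gen list \<Rightarrow> (form \<Rightarrow> nc set)" where
  "d_word q [] = \<zero>\<^bsub>Om_SL2 q\<^esub>"
| "d_word q (g # w) = ract q (d_gen q g) (cls (SL2 q) (pt (Word w)))
     \<oplus>\<^bsub>Om_SL2 q\<^esub> lact q (mat q g) (d_word q w)"

definition dif :: "complex \<Rightarrow> nc set \<Rightarrow> (form \<Rightarrow> nc set)" where
  "dif q = descend (lin_ext (Om_SL2 q) (\<lambda>w. d_word q (letters w)))"

subsection \<open>Two-forms\<close>

text \<open>Degree 2 of the exterior algebra: the tensor square of the one-forms over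
  $\mathbb{C}_q[SL_2]$ modulo the sub-bimodule generated by the relations among the $e^i$.\<close>

definition ext_rels :: "complex \<Rightarrow> ((form \<Rightarrow> nc set) \<times> (form \<Rightarrow> nc set) \<Rightarrow>\<^sub>0 complex) set" where
  "ext_rels q = (\<Union>x\<in>carrier (SL2 q). \<Union>y\<in>carrier (SL2 q).
     let ee = (\<lambda>i j. pt (lact q x (bas q i), ract q (bas q j) y)) in
       {ee Ep Ep, ee Em Em, ee E0 E0,
        scale (q\<^sup>2) (ee Ep Em) + ee Em Ep,
        ee E0 Ep + scale (q powi 4) (ee Ep E0),
        ee E0 Em + scale (q powi -4) (ee Em E0)})"

definition Om2_SL2 ::
    "complex \<Rightarrow> (complex, ((form \<Rightarrow> nc set) \<times> (form \<Rightarrow> nc set) \<Rightarrow>\<^sub>0 complex) set) module" where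
  "Om2_SL2 q = quot_mod (free_mod (carrier (Om_SL2 q) \<times> carrier (Om_SL2 q)))
     (fvs.span (tensor_rels (Om_SL2 q) (Om_SL2 q) (carrier (SL2 q)) (ract q) (lact q) \<union> ext_rels q))"


section \<open>The calculus on $\mathbb{C}_q[S^2]$\<close>

text \<open>The elements of form degree 1 in the subalgebra generated by $\mathbb{C}_q[S^2]$ and
  $\mathrm{d}\mathbb{C}_q[S^2]$.\<close>

inductive_set Om_S2_set :: "complex \<Rightarrow> (form \<Rightarrow> nc set) set" for q where
  exact: "x \<in> S2 q \<Longrightarrow> dif q x \<in> Om_S2_set q"
| add: "\<omega> \<in> Om_S2_set q \<Longrightarrow> \<eta> \<in> Om_S2_set q \<Longrightarrow> \<omega> \<oplus>\<^bsub>Om_SL2 q\<^esub> \<eta> \<in> Om_S2_set q"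
| left: "x \<in> S2 q \<Longrightarrow> \<omega> \<in> Om_S2_set q \<Longrightarrow> lact q x \<omega> \<in> Om_S2_set q"
| right: "x \<in> S2 q \<Longrightarrow> \<omega> \<in> Om_S2_set q \<Longrightarrow> ract q \<omega> x \<in> Om_S2_set q"

definition Om_S2 :: "complex \<Rightarrow> (complex, form \<Rightarrow> nc set) module" where
  "Om_S2 q = (Om_SL2 q)\<lparr>carrier := Om_S2_set q\<rparr>"

definition Om10 :: "complex \<Rightarrow> (form \<Rightarrow> nc set) set" where
  "Om10 q = {lact q f (bas q Ep) | f. f \<in> SL2_deg q (-2)}"

definition Om01 :: "complex \<Rightarrow> (form \<Rightarrow> nc set) set" where
  "Om01 q = {lact q f (bas q Em) | f. f \<in> SL2_deg q 2}"

type_synonym ten = "((form \<Rightarrow> nc set) \<times> (form \<Rightarrow> nc set) \<Rightarrow>\<^sub>0 complex) set"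

definition Om_Om :: "complex \<Rightarrow> (complex, ten) module" where
  "Om_Om q = tensor (Om_S2 q) (Om_S2 q) (S2 q) (ract q) (lact q)"

abbreviation ot :: "complex \<Rightarrow> (form \<Rightarrow> nc set) \<Rightarrow> (form \<Rightarrow> nc set) \<Rightarrow> ten" where
  "ot q \<omega> \<eta> \<equiv> cls (Om_Om q) (pt (\<omega>, \<eta>))"

text \<open>The image of the tensor product of sub-bimodules \<^term>\<open>M\<close>, \<^term>\<open>N\<close> in \<^term>\<open>Om_Om q\<close>.  It
  is used for the direct summands \<open>Om10\<close> and \<open>Om01\<close> only, for which the tensor product
  embeds.\<close>

definition sub_tensor :: "complex \<Rightarrow> (form \<Rightarrow> nc set) set \<Rightarrow> (form \<Rightarrow> nc set) set \<Rightarrow> ten set" where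
  "sub_tensor q M N = cls (Om_Om q) ` carrier (free_mod (M \<times> N))"

definition wedge :: "complex \<Rightarrow> ten \<Rightarrow> ten" where
  "wedge q = descend (cls (Om2_SL2 q))"

subsection \<open>Left coaction\<close>

text \<open>$\Delta_L(f e^\pm) = f_{(1)} \otimes f_{(2)} e^\pm$, with values in
  $\mathbb{C}_q[SL_2] \otimes \Omega^1(\mathbb{C}_q[S^2])$.  The coproduct maps each homogeneous component
  $\mathbb{C}_q[SL_2]_n$ into $\mathbb{C}_q[SL_2] \otimes \mathbb{C}_q[SL_2]_n$, so representatives of $\Delta f$ are taken
  with all $f_{(2)}$ of degree $\mp 2$.\<close>

definition coaction :: "complex \<Rightarrow> (form \<Rightarrow> nc set) \<Rightarrow> (nc set \<times> (form \<Rightarrow> nc set) \<Rightarrow>\<^sub>0 complex) set" where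
  "coaction q \<omega> = the_elem
     {cls (tensorC (SL2 q) (Om_S2 q))
        (free_map (\<lambda>(x, f). (x, lact q f (bas q Ep))) s + free_map (\<lambda>(x, f). (x, lact q f (bas q Em))) t) | s t.
      s \<in> coprod q (\<omega> Ep) \<and> Poly_Mapping.keys s \<subseteq> carrier (SL2 q) \<times> SL2_deg q (-2) \<and>
      t \<in> coprod q (\<omega> Em) \<and> Poly_Mapping.keys t \<subseteq> carrier (SL2 q) \<times> SL2_deg q 2}"

text \<open>The tensor product coaction
  $\omega \otimes \eta \mapsto \omega_{(-1)} \eta_{(-1)} \otimes (\omega_{(0)} \otimes \eta_{(0)})$.\<close>

definition coaction_pair ::
    "complex \<Rightarrow> (form \<Rightarrow> nc set) \<times> (form \<Rightarrow> nc set) \<Rightarrow> (nc set \<times> ten \<Rightarrow>\<^sub>0 complex) set" where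
  "coaction_pair q = (\<lambda>(\<omega>, \<eta>). the_elem
     {cls (tensorC (SL2 q) (Om_Om q))
        (\<Sum>(x, \<mu>)\<in>Poly_Mapping.keys s. \<Sum>(y, \<nu>)\<in>Poly_Mapping.keys t.
           scale (Poly_Mapping.lookup s (x, \<mu>) * Poly_Mapping.lookup t (y, \<nu>))
             (pt (x \<otimes>\<^bsub>SL2 q\<^esub> y, ot q \<mu> \<nu>))) | s t.
      s \<in> coaction q \<omega> \<and> t \<in> coaction q \<eta>})"

definition coaction_ten :: "complex \<Rightarrow> ten \<Rightarrow> (nc set \<times> ten \<Rightarrow>\<^sub>0 complex) set" where
  "coaction_ten q = descend (lin_ext (tensorC (SL2 q) (Om_Om q)) (coaction_pair q))"

definition left_invariant :: "complex \<Rightarrow> ten \<Rightarrow> bool" where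
  "left_invariant q g \<longleftrightarrow>
     coaction_ten q g = cls (tensorC (SL2 q) (Om_Om q)) (pt (\<one>\<^bsub>SL2 q\<^esub>, g))"

subsection \<open>The metric\<close>

definition qint2 :: "complex \<Rightarrow> complex" where "qint2 q = q + inverse q"

definition metric :: "complex \<Rightarrow> ten" where
  "metric q =
     (q\<^sup>2 \<odot>\<^bsub>Om_Om q\<^esub> ot q (dif q (bm q)) (dif q (bp q)) \<oplus>\<^bsub>Om_Om q\<^esub> ot q (dif q (bp q)) (dif q (bm q)))
     \<ominus>\<^bsub>Om_Om q\<^esub> (qint2 q \<odot>\<^bsub>Om_Om q\<^esub> ot q (dif q (b0 q)) (dif q (b0 q)))"

end

theory Submission
  imports Defs
begin

text \<open>Equality in a quotient of a free vector space is tested by the linear functionals that vanish on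
  the relations.  On $\mathbb{C}_q[SL_2]$ these are the functions \<open>F\<close> of words that satisfy the seven
  defining relations in every context; on a tensor product they are the balanced bilinear functions.
  A map out of a quotient is well defined if the pullbacks of such functionals are such functionals,
  and every identity between elements becomes an identity of complex numbers, proved by rewriting
  words to normal form.

  One finds $\mathrm{d}b_- = b^2e^+ + a^2e^-$, $\mathrm{d}b_+ = d^2e^+ + c^2e^-$ and
  $\mathrm{d}b_0 = q(bd\,e^+ + ac\,e^-)$.  The coaction acts on these three forms by a $3 \times 3$ matrix,
  which turns invariance of $g$ into nine identities in $\mathbb{C}_q[SL_2]$.  The component of $g$ in
  $\Omega^{1,0} \bar\otimes \Omega^{1,0}$ vanishes because $xe^+ \bar\otimes ye^+$ depends only on $xy$, as
  one sees by inserting $1 = (ad - q^{-1}cb)^2$, suitably ordered, between $x$ and $y$; likewise for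
  $\Omega^{0,1} \bar\otimes \Omega^{0,1}$.\<close>

section \<open>Linear functionals on free spaces and their quotients\<close>

text \<open>No basis of C_q[SL_2] is constructed. Every claim, including the directness of the sum,
  is reduced to equalities of classes, and these are tested on all functionals at once. The
  identities for g are short; most of the work goes into maps that are defined through
  representatives. For \<open>coaction\<close> to have values in C_q[SL_2] tensor Omega^1 of the
  sphere, every f e^+ and f e^- with f of degree -2 and 2 must be a form generated by the sphere.
  The insertion of 1 yields this too, since it writes f as a sum of (f u) v with f u of degree 0.
  For \<open>coaction_ten\<close> to descend to the tensor product over the sphere algebra, the
  coproduct must be multiplicative and keep the degree of second legs, and elements of degree 0 must
  commute with e^+ and e^-. The weights q^2, 1, -[2]_q of g are tied to two facts: 1 + q^2 = q
  [2]_q, which governs the coaction matrix, and q^2 + q^4 = [2]_q q^3, which removes the unmixed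
  components.\<close>

definition ev :: "('a \<Rightarrow> complex) \<Rightarrow> ('a \<Rightarrow>\<^sub>0 complex) \<Rightarrow> complex" where
  "ev b p = (\<Sum>k\<in>Poly_Mapping.keys p. Poly_Mapping.lookup p k * b k)"

lemma ev_superset:
  assumes "finite A" "Poly_Mapping.keys p \<subseteq> A"
  shows "ev b p = (\<Sum>k\<in>A. Poly_Mapping.lookup p k * b k)"
  unfolding ev_def using assms by (intro sum.mono_neutral_left) (auto simp: in_keys_iff)

lemma ev_zero [simp]: "ev b 0 = 0"
  by (simp add: ev_def)

lemma ev_add [simp]: "ev b (p + p') = ev b p + ev b p'"
proof -
  let ?A = "Poly_Mapping.keys p \<union> Poly_Mapping.keys p'"
  have "ev b r = (\<Sum>k\<in>?A. Poly_Mapping.lookup r k * b k)" if "r \<in> {p, p', p + p'}" for r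
    using that keys_add[of p p'] by (intro ev_superset) auto
  then show ?thesis
    by (simp add: lookup_add distrib_right sum.distrib)
qed

lemma keys_scale: "Poly_Mapping.keys (scale z p) \<subseteq> Poly_Mapping.keys p"
  by (auto simp: in_keys_iff lookup_scale)

lemma ev_scale [simp]: "ev b (scale z p) = z * ev b p"
  using ev_superset[OF finite_keys keys_scale, of b z p]
  by (simp add: lookup_scale ev_def sum_distrib_left mult.assoc)

lemma ev_uminus [simp]: "ev b (- p) = - ev b p"
  using ev_add[of b p "- p"] by (simp del: ev_add add: eq_neg_iff_add_eq_0 add.commute)

lemma ev_diff [simp]: "ev b (p - p') = ev b p - ev b p'"
  using ev_add[of b p "- p'"] by simp

lemma ev_sum [simp]: "ev b (sum f A) = (\<Sum>i\<in>A. ev b (f i))"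
  by (induction A rule: infinite_finite_induct) auto

lemma ev_sum_list [simp]: "ev b (sum_list ps) = (\<Sum>p\<leftarrow>ps. ev b p)"
  by (induction ps) auto

lemma ev_single [simp]: "ev b (Poly_Mapping.single k z) = z * b k"
  by (simp add: ev_def)

lemma ev_cong: "(\<And>k. k \<in> Poly_Mapping.keys p \<Longrightarrow> b k = b' k) \<Longrightarrow> ev b p = ev b' p"
  by (simp add: ev_def)

lemma ev_add_fun: "ev (\<lambda>k. b k + b' k) p = ev b p + ev b' p"
  by (simp add: ev_def distrib_left sum.distrib)

lemma ev_diff_fun: "ev (\<lambda>k. b k - b' k) p = ev b p - ev b' p"
  by (simp add: ev_def right_diff_distrib sum_subtractf)

lemma ev_mult_fun: "ev (\<lambda>k. z * b k) p = z * ev b p"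
  by (simp add: ev_def sum_distrib_left mult.left_commute)

lemma ev_zero_fun [simp]: "ev (\<lambda>k. 0) p = 0"
  by (simp add: ev_def)

lemma ev_sum_list_fun: "ev (\<lambda>k. \<Sum>i\<leftarrow>xs. f i k) p = (\<Sum>i\<leftarrow>xs. ev (f i) p)"
  by (induction xs) (auto simp: ev_add_fun)

lemma ev_swap: "ev (\<lambda>k. ev (b k) p') p = ev (\<lambda>l. ev (\<lambda>k. b k l) p) p'"
  by (simp add: ev_def sum_distrib_left, subst sum.swap) (simp add: mult.left_commute)

lemma ev_ext:
  assumes "\<And>b. ev b p = ev b p'"
  shows "p = p'"
proof (rule poly_mapping_eqI)
  fix k
  have "ev (\<lambda>j. 1 when j = k) r = Poly_Mapping.lookup r k" for r :: "'a \<Rightarrow>\<^sub>0 complex"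
    by (simp add: ev_def when_def in_keys_iff if_distrib[of "(*) _"] sum.delta cong: if_cong)
  then show "Poly_Mapping.lookup p k = Poly_Mapping.lookup p' k"
    using assms by metis
qed

text \<open>For p outside the span, a maximal independent subset B of S stays independent when p is
  added, so a linear functional can be prescribed as 1 at p and 0 on B. On a free space every linear
  functional is an \<open>ev\<close>, given by its values on the basis \<open>pt k\<close>.\<close>

lemma span_iff_ev: "p \<in> fvs.span S \<longleftrightarrow> (\<forall>b. (\<forall>s\<in>S. ev b s = 0) \<longrightarrow> ev b p = 0)"
proof (intro iffI allI impI)
  fix b assume "p \<in> fvs.span S" and b: "\<forall>s\<in>S. ev b s = 0"
  then show "ev b p = 0"
    by (induction rule: fvs.span_induct_alt) (use b in auto)
next
  assume R: "\<forall>b. (\<forall>s\<in>S. ev b s = 0) \<longrightarrow> ev b p = 0"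
  show "p \<in> fvs.span S"
  proof (rule ccontr)
    interpret C: vector_space "(*) :: complex \<Rightarrow> complex \<Rightarrow> complex"
      by standard (auto simp: algebra_simps)
    interpret P: vector_space_pair "scale :: complex \<Rightarrow> ('a \<Rightarrow>\<^sub>0 complex) \<Rightarrow> _"
      "(*) :: complex \<Rightarrow> complex \<Rightarrow> complex" ..
    assume np: "p \<notin> fvs.span S"
    obtain B where B: "B \<subseteq> S" "fvs.independent B" "S \<subseteq> fvs.span B"
      using fvs.maximal_independent_subset by blast
    have pB: "p \<notin> fvs.span B"
      using np B(1) fvs.span_mono by blast
    then have "fvs.independent (insert p B)"
      using B(2) by (simp add: fvs.independent_insertI)
    then obtain g where g: "Vector_Spaces.linear scale (*) g"
      "\<forall>x\<in>insert p B. g x = (if x = p then 1 else 0 :: complex)"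
      using P.linear_independent_extend[of "insert p B" "\<lambda>x. if x = p then 1 else 0"] by blast
    interpret g: Vector_Spaces.linear "scale :: complex \<Rightarrow> ('a \<Rightarrow>\<^sub>0 complex) \<Rightarrow> _" "(*)" g
      by (rule g(1))
    have gev: "g x = ev (\<lambda>k. g (pt k)) x" for x
    proof -
      have "x = (\<Sum>k\<in>Poly_Mapping.keys x. scale (Poly_Mapping.lookup x k) (pt k))"
        by (rule ev_ext) (simp, simp add: ev_def)
      then have "g x = g (\<Sum>k\<in>Poly_Mapping.keys x. scale (Poly_Mapping.lookup x k) (pt k))"
        by simp
      also have "\<dots> = ev (\<lambda>k. g (pt k)) x"
        by (simp add: g.sum g.scale ev_def)
      finally show ?thesis .
    qed
    have "g s = 0" if "s \<in> S" for s
    proof -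
      have "s \<in> fvs.span B" using B(3) that by blast
      then show ?thesis
      proof (induction rule: fvs.span_induct_alt)
        case base
        show ?case by (rule g.zero)
      next
        case (step c x y)
        then have "x \<noteq> p" using pB fvs.span_base by blast
        with step g(2) show ?case by (simp add: g.add g.scale)
      qed
    qed
    then have "\<forall>s\<in>S. ev (\<lambda>k. g (pt k)) s = 0"
      by (simp only: gev[symmetric]) simp
    then have "g p = 0"
      using R by (simp only: gev[of p])
    then show False using g(2) by simp
  qed
qed

text \<open>The counterpart of \<open>lin_ext\<close> on representatives: its values are formal
  sums, to which functionals apply (\<open>ev_lext\<close>), whereas \<open>lin_ext\<close> sums
  inside a quotient.\<close>

definition lext :: "('a \<Rightarrow> ('b \<Rightarrow>\<^sub>0 complex)) \<Rightarrow> ('a \<Rightarrow>\<^sub>0 complex) \<Rightarrow> ('b \<Rightarrow>\<^sub>0 complex)" where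
  "lext F p = (\<Sum>k\<in>Poly_Mapping.keys p. scale (Poly_Mapping.lookup p k) (F k))"

lemma ev_lext [simp]: "ev b (lext F p) = ev (\<lambda>k. ev b (F k)) p"
  by (simp add: lext_def) (simp add: ev_def)

lemma lext_add: "lext F (p + p') = lext F p + lext F p'"
  by (rule ev_ext) simp

lemma lext_scale: "lext F (scale z p) = scale z (lext F p)"
  by (rule ev_ext) simp

lemma free_map_lext: "free_map f = lext (\<lambda>k. pt (f k))"
  by (simp add: free_map_def lext_def fun_eq_iff)

lemma keys_subset_add:
  "Poly_Mapping.keys p \<subseteq> A \<Longrightarrow> Poly_Mapping.keys p' \<subseteq> A \<Longrightarrow> Poly_Mapping.keys (p + p') \<subseteq> A"
  by (rule order_trans[OF keys_add]) blast

lemma keys_subset_diff: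
  fixes p p' :: "'a \<Rightarrow>\<^sub>0 complex"
  shows "Poly_Mapping.keys p \<subseteq> A \<Longrightarrow> Poly_Mapping.keys p' \<subseteq> A \<Longrightarrow> Poly_Mapping.keys (p - p') \<subseteq> A"
  using keys_subset_add[of p A "- p'"] by simp

lemma keys_subset_scale: "Poly_Mapping.keys p \<subseteq> A \<Longrightarrow> Poly_Mapping.keys (scale z p) \<subseteq> A"
  by (rule order_trans[OF keys_scale])

lemma keys_subset_sum:
  "(\<And>i. i \<in> I \<Longrightarrow> Poly_Mapping.keys (f i) \<subseteq> A) \<Longrightarrow> Poly_Mapping.keys (sum f I) \<subseteq> A"
  by (rule order_trans[OF keys_sum UN_least])

lemma keys_subset_lext:
  "(\<And>k. k \<in> Poly_Mapping.keys p \<Longrightarrow> Poly_Mapping.keys (F k) \<subseteq> A) \<Longrightarrow> Poly_Mapping.keys (lext F p) \<subseteq> A"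
  unfolding lext_def by (intro keys_subset_sum keys_subset_scale)

lemma keys_subset_sum_list:
  "(\<And>p. p \<in> set ps \<Longrightarrow> Poly_Mapping.keys p \<subseteq> A) \<Longrightarrow> Poly_Mapping.keys (sum_list ps) \<subseteq> A"
proof (induction ps)
  case (Cons p ps)
  then have "Poly_Mapping.keys p \<subseteq> A" "Poly_Mapping.keys (sum_list ps) \<subseteq> A" by auto
  then show ?case by (simp add: keys_subset_add)
qed simp

lemma keys_subset_span:
  assumes "\<And>s. s \<in> S \<Longrightarrow> Poly_Mapping.keys s \<subseteq> A" "p \<in> fvs.span S"
  shows "Poly_Mapping.keys p \<subseteq> A"
  using assms(2)
proof (induction rule: fvs.span_induct_alt)
  case (step c x y)
  then show ?case by (rule keys_subset_add[OF keys_subset_scale[OF assms(1)]])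
qed simp

section \<open>Cosets, and maps out of a quotient by a span\<close>

lemma cls_conv: "cls T p = (\<lambda>u. u + p) ` \<zero>\<^bsub>T\<^esub>"
  by (auto simp: cls_def a_r_coset_def' free_mod_def)

lemma cls_span_eq_iff:
  assumes "\<zero>\<^bsub>T\<^esub> = fvs.span S"
  shows "cls T p = cls T p' \<longleftrightarrow> p - p' \<in> fvs.span S"
proof
  assume "cls T p = cls T p'"
  moreover have "p \<in> cls T p"
    unfolding cls_conv assms using fvs.span_zero by (auto simp: image_iff)
  ultimately show "p - p' \<in> fvs.span S"
    unfolding cls_conv assms by auto
next
  assume d: "p - p' \<in> fvs.span S"
  have "u + p \<in> (\<lambda>u. u + p') ` fvs.span S" if "u \<in> fvs.span S" for u
    using fvs.span_add[OF that d] by (intro image_eqI[of _ _ "u + (p - p')"]) simp_all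
  moreover have "u + p' \<in> (\<lambda>u. u + p) ` fvs.span S" if "u \<in> fvs.span S" for u
    using fvs.span_diff[OF that d] by (intro image_eqI[of _ _ "u - (p - p')"]) simp_all
  ultimately show "cls T p = cls T p'"
    unfolding cls_conv assms by blast
qed

lemma mem_cls_span_iff:
  assumes "\<zero>\<^bsub>T\<^esub> = fvs.span S"
  shows "r \<in> cls T p \<longleftrightarrow> r - p \<in> fvs.span S"
  unfolding cls_conv assms by (force intro: image_eqI[of _ _ "r - p"])

text \<open>Only representatives of the one class are compared. This matters for maps such as the
  coaction, whose formula is controlled only on representatives supported in the carrier.\<close>

lemma descend_cls:
  assumes T: "\<zero>\<^bsub>T\<^esub> = fvs.span S"
    and f: "\<And>r. r - p \<in> fvs.span S \<Longrightarrow> f r = f p"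
  shows "descend f (cls T p) = f p"
proof -
  have "f ` cls T p = {f p}"
  proof
    show "f ` cls T p \<subseteq> {f p}"
      using f by (simp add: image_subset_iff mem_cls_span_iff[OF T])
    show "{f p} \<subseteq> f ` cls T p"
      by (simp add: mem_cls_span_iff[OF T] fvs.span_zero)
  qed
  then show ?thesis by (simp add: descend_def)
qed

text \<open>The span is taken in the whole free space, while the carrier holds only classes of sums
  supported in \<open>A\<close>. Since the relations are supported in \<open>A\<close> as well,
  passing to another representative does not leave \<open>A\<close>
  (\<open>keys_mem_cls\<close>).\<close>

locale quotient_space =
  fixes A :: "'a set" and S :: "('a \<Rightarrow>\<^sub>0 complex) set"
    and T :: "(complex, ('a \<Rightarrow>\<^sub>0 complex) set) module"
  assumes T_def: "T = quot_mod (free_mod A) (fvs.span S)"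
    and keys_S: "\<And>s. s \<in> S \<Longrightarrow> Poly_Mapping.keys s \<subseteq> A"
begin

lemma zero_T: "\<zero>\<^bsub>T\<^esub> = fvs.span S"
  by (simp add: T_def quot_mod_def)

lemma zero_T_cls: "\<zero>\<^bsub>T\<^esub> = cls T 0"
  by (simp add: cls_conv)

lemmas cls_eq_iff_span = cls_span_eq_iff[OF zero_T]
lemmas mem_cls_iff_span = mem_cls_span_iff[OF zero_T]

lemma cls_eq_iff:
  "cls T p = cls T p' \<longleftrightarrow> (\<forall>b. (\<forall>s\<in>S. ev b s = 0) \<longrightarrow> ev b p = ev b p')"
  by (simp add: cls_eq_iff_span span_iff_ev)

lemma mem_cls_self: "p \<in> cls T p"
  by (simp add: mem_cls_iff_span fvs.span_zero)

lemma mem_cls_iff: "r \<in> cls T p \<longleftrightarrow> cls T r = cls T p"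
  by (simp add: cls_eq_iff_span mem_cls_iff_span)

lemma keys_mem_cls:
  assumes "Poly_Mapping.keys p \<subseteq> A" "r \<in> cls T p"
  shows "Poly_Mapping.keys r \<subseteq> A"
proof -
  have "Poly_Mapping.keys (r - p) \<subseteq> A"
    using assms(2) keys_subset_span[OF keys_S] by (auto simp: mem_cls_iff_span)
  from keys_subset_add[OF this assms(1)] show ?thesis by simp
qed

lemma carrier_T: "carrier T = cls T ` {p. Poly_Mapping.keys p \<subseteq> A}"
  by (auto simp: T_def quot_mod_def A_RCOSETS_def RCOSETS_def free_mod_def cls_conv
      r_coset_def)

lemma cls_in_carrier: "Poly_Mapping.keys p \<subseteq> A \<Longrightarrow> cls T p \<in> carrier T"
  by (auto simp: carrier_T)

lemma add_cls: "cls T p \<oplus>\<^bsub>T\<^esub> cls T p' = cls T (p + p')"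
proof -
  have "cls T p \<oplus>\<^bsub>T\<^esub> cls T p' = (\<Union>x\<in>cls T p. \<Union>y\<in>cls T p'. {x + y})"
    by (simp add: T_def quot_mod_def set_add_def set_mult_def free_mod_def)
  also have "\<dots> = cls T (p + p')"
  proof (intro equalityI subsetI)
    fix r assume "r \<in> (\<Union>x\<in>cls T p. \<Union>y\<in>cls T p'. {x + y})"
    then obtain x y where "x - p \<in> fvs.span S" "y - p' \<in> fvs.span S" "r = x + y"
      by (auto simp: mem_cls_iff_span)
    then show "r \<in> cls T (p + p')"
      using fvs.span_add[of "x - p" S "y - p'"] by (simp add: mem_cls_iff_span algebra_simps)
  next
    fix r assume "r \<in> cls T (p + p')"
    then have "r - p' \<in> cls T p" by (simp add: mem_cls_iff_span algebra_simps)
    moreover have "r = (r - p') + p'" by simp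
    ultimately show "r \<in> (\<Union>x\<in>cls T p. \<Union>y\<in>cls T p'. {x + y})"
      using mem_cls_self by blast
  qed
  finally show ?thesis .
qed

lemma smult_cls: "z \<odot>\<^bsub>T\<^esub> cls T p = cls T (scale z p)"
proof -
  have "z \<odot>\<^bsub>T\<^esub> cls T p = (\<Union>x\<in>cls T p. cls T (scale z x))"
    by (simp add: T_def quot_mod_def free_mod_def cls_def a_r_coset_def')
  moreover have "cls T (scale z x) = cls T (scale z p)" if "x \<in> cls T p" for x
    using that fvs.span_scale[of "x - p" S z]
    by (simp add: mem_cls_iff_span cls_eq_iff_span fvs.scale_right_diff_distrib)
  ultimately show ?thesis using mem_cls_self by blast
qed

text \<open>The group structure makes the finite sums in \<open>lin_ext\<close> and the difference
  in \<open>metric\<close> computable on representatives.\<close>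

sublocale abelian_group T
proof (rule abelian_groupI)
  fix x y z assume xyz: "x \<in> carrier T" "y \<in> carrier T" "z \<in> carrier T"
  then obtain p p' p'' where p: "x = cls T p" "y = cls T p'" "z = cls T p''"
    "Poly_Mapping.keys p \<subseteq> A" "Poly_Mapping.keys p' \<subseteq> A"
    by (auto simp: carrier_T)
  show "x \<oplus>\<^bsub>T\<^esub> y \<in> carrier T" "x \<oplus>\<^bsub>T\<^esub> y \<oplus>\<^bsub>T\<^esub> z = x \<oplus>\<^bsub>T\<^esub> (y \<oplus>\<^bsub>T\<^esub> z)" "x \<oplus>\<^bsub>T\<^esub> y = y \<oplus>\<^bsub>T\<^esub> x"
    using p by (simp_all add: add_cls cls_in_carrier keys_subset_add add.assoc add.commute[of p])
next
  fix x assume "x \<in> carrier T"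
  then obtain p where p: "x = cls T p" "Poly_Mapping.keys p \<subseteq> A"
    by (auto simp: carrier_T)
  then have "cls T (- p) \<oplus>\<^bsub>T\<^esub> x = \<zero>\<^bsub>T\<^esub>" "cls T (- p) \<in> carrier T"
    by (simp_all add: add_cls zero_T_cls cls_in_carrier)
  then show "\<exists>y\<in>carrier T. y \<oplus>\<^bsub>T\<^esub> x = \<zero>\<^bsub>T\<^esub>" by blast
  show "\<zero>\<^bsub>T\<^esub> \<oplus>\<^bsub>T\<^esub> x = x"
    using p by (simp add: add_cls zero_T_cls)
next
  show "\<zero>\<^bsub>T\<^esub> \<in> carrier T"
    by (simp add: zero_T_cls cls_in_carrier)
qed

lemma minus_cls:
  assumes "Poly_Mapping.keys p \<subseteq> A" "Poly_Mapping.keys p' \<subseteq> A"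
  shows "cls T p \<ominus>\<^bsub>T\<^esub> cls T p' = cls T (p - p')"
proof -
  have "cls T (- p') \<oplus>\<^bsub>T\<^esub> cls T p' = \<zero>\<^bsub>T\<^esub>"
    by (simp add: add_cls zero_T_cls)
  then have "\<ominus>\<^bsub>T\<^esub> cls T p' = cls T (- p')"
    using assms by (intro minus_equality) (simp_all add: cls_in_carrier)
  then show ?thesis by (simp add: a_minus_def add_cls)
qed

lemma lin_ext_cls:
  assumes f: "\<And>k. k \<in> Poly_Mapping.keys p \<Longrightarrow> f k = cls T (F k)"
    and F: "\<And>k. k \<in> Poly_Mapping.keys p \<Longrightarrow> Poly_Mapping.keys (F k) \<subseteq> A"
  shows "lin_ext T f p = cls T (lext F p)"
proof -
  let ?c = "Poly_Mapping.lookup p"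
  have "(\<Oplus>\<^bsub>T\<^esub>k\<in>I. ?c k \<odot>\<^bsub>T\<^esub> f k) = cls T (\<Sum>k\<in>I. scale (?c k) (F k))"
    if "I \<subseteq> Poly_Mapping.keys p" for I
    using finite_subset[OF that finite_keys] that
  proof (induction I rule: finite_induct)
    case empty
    show ?case by (simp add: zero_T_cls)
  next
    case (insert k I)
    have c: "?c j \<odot>\<^bsub>T\<^esub> f j \<in> carrier T" if "j \<in> Poly_Mapping.keys p" for j
      using f[OF that] F[OF that] by (simp add: smult_cls cls_in_carrier keys_subset_scale)
    have "(\<Oplus>\<^bsub>T\<^esub>j\<in>insert k I. ?c j \<odot>\<^bsub>T\<^esub> f j)
        = ?c k \<odot>\<^bsub>T\<^esub> f k \<oplus>\<^bsub>T\<^esub> (\<Oplus>\<^bsub>T\<^esub>j\<in>I. ?c j \<odot>\<^bsub>T\<^esub> f j)"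
      using insert.hyps insert.prems c by (intro finsum_insert) auto
    then show ?case
      using insert f by (simp add: smult_cls add_cls)
  qed
  then show ?thesis by (simp add: lin_ext_def lext_def)
qed

end

section \<open>Functionals on tensor products\<close>

text \<open>All conditions are restricted to the carriers; elsewhere such a functional is arbitrary.
  This is why supports of representatives are tracked throughout.\<close>

definition balanced :: "(complex, 'm) module \<Rightarrow> (complex, 'n) module \<Rightarrow> 'r set
    \<Rightarrow> ('m \<Rightarrow> 'r \<Rightarrow> 'm) \<Rightarrow> ('r \<Rightarrow> 'n \<Rightarrow> 'n) \<Rightarrow> ('m \<times> 'n \<Rightarrow> complex) \<Rightarrow> bool" where
  "balanced M N R ra la b \<longleftrightarrow>
     (\<forall>m\<in>carrier M. \<forall>m'\<in>carrier M. \<forall>n\<in>carrier N. b (m \<oplus>\<^bsub>M\<^esub> m', n) = b (m, n) + b (m', n)) \<and>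
     (\<forall>m\<in>carrier M. \<forall>n\<in>carrier N. \<forall>n'\<in>carrier N. b (m, n \<oplus>\<^bsub>N\<^esub> n') = b (m, n) + b (m, n')) \<and>
     (\<forall>z. \<forall>m\<in>carrier M. \<forall>n\<in>carrier N. b (z \<odot>\<^bsub>M\<^esub> m, n) = z * b (m, n)) \<and>
     (\<forall>z. \<forall>m\<in>carrier M. \<forall>n\<in>carrier N. b (m, z \<odot>\<^bsub>N\<^esub> n) = z * b (m, n)) \<and>
     (\<forall>m\<in>carrier M. \<forall>r\<in>R. \<forall>n\<in>carrier N. b (ra m r, n) = b (m, la r n))"

lemma balancedD:
  assumes "balanced M N R ra la b"
  shows "m \<in> carrier M \<Longrightarrow> m' \<in> carrier M \<Longrightarrow> n \<in> carrier N \<Longrightarrow> b (m \<oplus>\<^bsub>M\<^esub> m', n) = b (m, n) + b (m', n)"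
    and "m \<in> carrier M \<Longrightarrow> n \<in> carrier N \<Longrightarrow> n' \<in> carrier N \<Longrightarrow> b (m, n \<oplus>\<^bsub>N\<^esub> n') = b (m, n) + b (m, n')"
    and "m \<in> carrier M \<Longrightarrow> n \<in> carrier N \<Longrightarrow> b (z \<odot>\<^bsub>M\<^esub> m, n) = z * b (m, n)"
    and "m \<in> carrier M \<Longrightarrow> n \<in> carrier N \<Longrightarrow> b (m, z \<odot>\<^bsub>N\<^esub> n) = z * b (m, n)"
    and "m \<in> carrier M \<Longrightarrow> r \<in> R \<Longrightarrow> n \<in> carrier N \<Longrightarrow> b (ra m r, n) = b (m, la r n)"
  using assms unfolding balanced_def by blast+

lemma ev_tensor_rels_iff:
  "(\<forall>s\<in>tensor_rels M N R ra la. ev b s = 0) \<longleftrightarrow> balanced M N R ra la b"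
proof
  assume L: "\<forall>s\<in>tensor_rels M N R ra la. ev b s = 0"
  have D: "b x = b y + b w" if "pt x - pt y - pt w \<in> tensor_rels M N R ra la" for x y w
    using bspec[OF L that] by (simp add: algebra_simps)
  have S: "b x = z * b y" if "pt x - scale z (pt y) \<in> tensor_rels M N R ra la" for x y z
    using bspec[OF L that] by simp
  have E: "b x = b y" if "pt x - pt y \<in> tensor_rels M N R ra la" for x y
    using bspec[OF L that] by simp
  show "balanced M N R ra la b"
    unfolding balanced_def
    by (intro conjI ballI allI; (rule D | rule S | rule E)) (unfold tensor_rels_def, blast+)
next
  assume "balanced M N R ra la b"
  note b = balancedD[OF this]
  show "\<forall>s\<in>tensor_rels M N R ra la. ev b s = 0"
    unfolding tensor_rels_def by (auto simp: b)
qed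

lemma quotient_space_tensor:
  assumes "\<And>m m'. m \<in> carrier M \<Longrightarrow> m' \<in> carrier M \<Longrightarrow> m \<oplus>\<^bsub>M\<^esub> m' \<in> carrier M"
    and "\<And>z m. m \<in> carrier M \<Longrightarrow> z \<odot>\<^bsub>M\<^esub> m \<in> carrier M"
    and "\<And>n n'. n \<in> carrier N \<Longrightarrow> n' \<in> carrier N \<Longrightarrow> n \<oplus>\<^bsub>N\<^esub> n' \<in> carrier N"
    and "\<And>z n. n \<in> carrier N \<Longrightarrow> z \<odot>\<^bsub>N\<^esub> n \<in> carrier N"
    and "\<And>m r. m \<in> carrier M \<Longrightarrow> r \<in> R \<Longrightarrow> ra m r \<in> carrier M"
    and "\<And>n r. n \<in> carrier N \<Longrightarrow> r \<in> R \<Longrightarrow> la r n \<in> carrier N"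
  shows "quotient_space (carrier M \<times> carrier N) (tensor_rels M N R ra la) (tensor M N R ra la)"
proof
  fix s assume "s \<in> tensor_rels M N R ra la"
  then show "Poly_Mapping.keys s \<subseteq> carrier M \<times> carrier N"
    unfolding tensor_rels_def
    by (elim UnE CollectE exE conjE; hypsubst)
      (intro keys_subset_diff keys_subset_scale; simp add: assms)+
qed (simp add: tensor_def)

lemma cls_eq_balanced:
  assumes "quotient_space A (tensor_rels M N R ra la) T"
  shows "cls T p = cls T p' \<longleftrightarrow> (\<forall>b. balanced M N R ra la b \<longrightarrow> ev b p = ev b p')"
  by (simp add: quotient_space.cls_eq_iff[OF assms] ev_tensor_rels_iff)

section \<open>Functionals on $\mathbb{C}_q[SL_2]$\<close>

lemma free_induct [case_names zero step]:
  fixes p :: "'a \<Rightarrow>\<^sub>0 complex"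
  assumes "P 0" and "\<And>z k p. P p \<Longrightarrow> P (scale z (pt k) + p)"
  shows "P p"
proof -
  have "p \<in> fvs.span (range pt)"
    by (auto simp: span_iff_ev ev_def)
  then show ?thesis
    by (induction rule: fvs.span_induct_alt) (auto intro: assms)
qed

lemma scale_conv_mult: "scale z (p :: nc) = Poly_Mapping.single 0 z * p"
  by (simp add: scale_def mult_map_scale_conv_mult)

lemma mult_scale_left: "scale z p * p' = scale z (p * p' :: nc)"
  by (simp add: scale_conv_mult mult.assoc)

lemma mult_scale_right: "p * scale z p' = scale z (p * p' :: nc)"
proof (induction p rule: free_induct)
  case (step y k p)
  have "pt k * scale z p' = scale z (pt k * p')"
    by (simp add: scale_conv_mult mult.assoc[symmetric] mult_single)
  with step show ?case
    by (simp add: distrib_right mult_scale_left fvs.scale_right_distrib fvs.scale_left_commute)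
qed simp

lemma pt_mult_pt: "pt (Word u) * pt (Word v) = pt (Word (u @ v))"
  by (simp add: mult_single plus_word_def)

lemma one_conv_pt: "(1 :: nc) = pt (Word [])"
  by (simp add: zero_word_def[symmetric])

definition SL2_span :: "complex \<Rightarrow> nc set" where
  "SL2_span q = {pt u * r * pt v | u r v. r \<in> SL2_rels q}"

lemma ring_nc: "ring nc_ring"
proof (rule ringI)
  show "abelian_group nc_ring"
    by (rule abelian_groupI) (auto simp: nc_ring_def add.assoc add.commute intro: exI[of _ "- _"])
  show "monoid nc_ring"
    by (rule monoidI) (auto simp: nc_ring_def mult.assoc)
next
  fix x y z :: nc
  show "(x \<oplus>\<^bsub>nc_ring\<^esub> y) \<otimes>\<^bsub>nc_ring\<^esub> z = x \<otimes>\<^bsub>nc_ring\<^esub> z \<oplus>\<^bsub>nc_ring\<^esub> y \<otimes>\<^bsub>nc_ring\<^esub> z"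
    and "z \<otimes>\<^bsub>nc_ring\<^esub> (x \<oplus>\<^bsub>nc_ring\<^esub> y) = z \<otimes>\<^bsub>nc_ring\<^esub> x \<oplus>\<^bsub>nc_ring\<^esub> z \<otimes>\<^bsub>nc_ring\<^esub> y"
    by (simp_all add: nc_ring_def algebra_simps)
qed

lemma span_SL2_mult_left: "x \<in> fvs.span (SL2_span q) \<Longrightarrow> y * x \<in> fvs.span (SL2_span q)"
proof (induction y rule: free_induct)
  case (step z k p)
  have "pt k * x \<in> fvs.span (SL2_span q)"
    using step.prems
  proof (induction rule: fvs.span_induct_alt)
    case (step c x y)
    then obtain u r v where x: "x = pt u * r * pt v" "r \<in> SL2_rels q"
      by (auto simp: SL2_span_def)
    have "pt k * x = pt (k + u) * r * pt v"
      by (simp add: x mult.assoc[symmetric] mult_single)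
    then have "pt k * x \<in> SL2_span q"
      unfolding SL2_span_def using x by blast
    with step show ?case
      by (simp add: distrib_left mult_scale_right fvs.span_add fvs.span_scale fvs.span_base)
  qed (simp add: fvs.span_zero)
  with step show ?case
    by (simp add: distrib_right mult_scale_left fvs.span_add fvs.span_scale)
qed (simp add: fvs.span_zero)

lemma span_SL2_mult_right: "x \<in> fvs.span (SL2_span q) \<Longrightarrow> x * y \<in> fvs.span (SL2_span q)"
proof (induction y rule: free_induct)
  case (step z k p)
  have "x * pt k \<in> fvs.span (SL2_span q)"
    using step.prems
  proof (induction rule: fvs.span_induct_alt)
    case (step c x y)
    then obtain u r v where x: "x = pt u * r * pt v" "r \<in> SL2_rels q"
      by (auto simp: SL2_span_def)
    have "x * pt k = pt u * r * pt (v + k)"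
      by (simp add: x mult.assoc mult_single)
    then have "x * pt k \<in> SL2_span q"
      unfolding SL2_span_def using x by blast
    with step show ?case
      by (simp add: distrib_right mult_scale_left fvs.span_add fvs.span_scale fvs.span_base)
  qed (simp add: fvs.span_zero)
  with step show ?case
    by (simp add: distrib_left mult_scale_right fvs.span_add fvs.span_scale)
qed (simp add: fvs.span_zero)

text \<open>Words span the free algebra, so multiplying the relations by words on both sides and
  taking the span already gives a two-sided ideal. Once the ideal is a span of explicit elements,
  \<open>span_iff_ev\<close> applies to it.\<close>

lemma Idl_eq_span: "Idl\<^bsub>nc_ring\<^esub> (SL2_rels q) = fvs.span (SL2_span q)"
proof
  interpret ring nc_ring by (rule ring_nc)
  have "ideal (fvs.span (SL2_span q)) nc_ring"
  proof (rule idealI[OF ring_nc])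
    show "subgroup (fvs.span (SL2_span q)) (add_monoid nc_ring)"
    proof (rule add.subgroupI)
      show "\<ominus>\<^bsub>nc_ring\<^esub> a \<in> fvs.span (SL2_span q)" if "a \<in> fvs.span (SL2_span q)" for a
      proof -
        have "\<ominus>\<^bsub>nc_ring\<^esub> a = - a"
          by (rule minus_equality) (simp_all add: nc_ring_def)
        then show ?thesis using that by (simp add: fvs.span_neg)
      qed
    qed (auto simp: nc_ring_def fvs.span_add intro: fvs.span_zero)
  qed (auto simp: nc_ring_def span_SL2_mult_left span_SL2_mult_right)
  moreover have "r \<in> SL2_span q" if "r \<in> SL2_rels q" for r
    using that unfolding SL2_span_def by (auto intro!: exI[of _ 0] exI[of _ r])
  ultimately show "Idl\<^bsub>nc_ring\<^esub> (SL2_rels q) \<subseteq> fvs.span (SL2_span q)"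
    by (intro genideal_minimal) (auto intro: fvs.span_base)
next
  interpret ring nc_ring by (rule ring_nc)
  interpret I: ideal "Idl\<^bsub>nc_ring\<^esub> (SL2_rels q)" nc_ring
    by (rule genideal_ideal) (simp add: nc_ring_def)
  have l: "y * x \<in> Idl\<^bsub>nc_ring\<^esub> (SL2_rels q)" and r: "x * y \<in> Idl\<^bsub>nc_ring\<^esub> (SL2_rels q)"
    if "x \<in> Idl\<^bsub>nc_ring\<^esub> (SL2_rels q)" for x y
    using I.I_l_closed[OF that, of y] I.I_r_closed[OF that, of y] by (simp_all add: nc_ring_def)
  have a: "x + y \<in> Idl\<^bsub>nc_ring\<^esub> (SL2_rels q)"
    if "x \<in> Idl\<^bsub>nc_ring\<^esub> (SL2_rels q)" "y \<in> Idl\<^bsub>nc_ring\<^esub> (SL2_rels q)" for x y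
    using I.a_closed[OF that] by (simp add: nc_ring_def)
  show "fvs.span (SL2_span q) \<subseteq> Idl\<^bsub>nc_ring\<^esub> (SL2_rels q)"
  proof
    fix x assume "x \<in> fvs.span (SL2_span q)"
    then show "x \<in> Idl\<^bsub>nc_ring\<^esub> (SL2_rels q)"
    proof (induction rule: fvs.span_induct_alt)
      case base
      show ?case using I.zero_closed by (simp add: nc_ring_def)
    next
      case (step c x y)
      then obtain u r' v where x: "x = pt u * r' * pt v" "r' \<in> SL2_rels q"
        by (auto simp: SL2_span_def)
      have "r' \<in> Idl\<^bsub>nc_ring\<^esub> (SL2_rels q)"
        using genideal_self[of "SL2_rels q"] x(2) by (auto simp: nc_ring_def)
      with step show ?case
        by (simp add: x(1) scale_conv_mult a l r)
    qed
  qed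
qed

section \<open>Functionals on the algebra as functions of words\<close>

definition qfun :: "complex \<Rightarrow> (gen list \<Rightarrow> complex) \<Rightarrow> bool" where
  "qfun q F \<longleftrightarrow> (\<forall>u v.
     F (u @ Gb # Ga # v) = q * F (u @ Ga # Gb # v) \<and>
     F (u @ Gc # Ga # v) = q * F (u @ Ga # Gc # v) \<and>
     F (u @ Gd # Gb # v) = q * F (u @ Gb # Gd # v) \<and>
     F (u @ Gd # Gc # v) = q * F (u @ Gc # Gd # v) \<and>
     F (u @ Gc # Gb # v) = F (u @ Gb # Gc # v) \<and>
     F (u @ Ga # Gd # v) = F (u @ v) + inverse q * F (u @ Gb # Gc # v) \<and>
     F (u @ Gd # Ga # v) = F (u @ v) + q * F (u @ Gb # Gc # v))"

lemma qfunD: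
  assumes "qfun q F"
  shows "F (u @ Gb # Ga # v) = q * F (u @ Ga # Gb # v)"
    "F (u @ Gc # Ga # v) = q * F (u @ Ga # Gc # v)"
    "F (u @ Gd # Gb # v) = q * F (u @ Gb # Gd # v)"
    "F (u @ Gd # Gc # v) = q * F (u @ Gc # Gd # v)"
    "F (u @ Gc # Gb # v) = F (u @ Gb # Gc # v)"
    "F (u @ Ga # Gd # v) = F (u @ v) + inverse q * F (u @ Gb # Gc # v)"
    "F (u @ Gd # Ga # v) = F (u @ v) + q * F (u @ Gb # Gc # v)"
  using assms unfolding qfun_def by blast+

text \<open>Oriented so that \<open>a\<close> and \<open>d\<close> move to the left of \<open>b\<close> and \<open>c\<close>, where \<open>ad\<close> and \<open>da\<close> are
  eliminated; with \<open>bd\<close> and \<open>cd\<close> left unchanged the system would not be confluent.\<close>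

lemma qfun_normalize:
  assumes "qfun q F" "q \<noteq> 0"
  shows "F (u @ Gb # Ga # v) = q * F (u @ Ga # Gb # v)"
    "F (u @ Gc # Ga # v) = q * F (u @ Ga # Gc # v)"
    "F (u @ Gb # Gd # v) = inverse q * F (u @ Gd # Gb # v)"
    "F (u @ Gc # Gd # v) = inverse q * F (u @ Gd # Gc # v)"
    "F (u @ Gc # Gb # v) = F (u @ Gb # Gc # v)"
    "F (u @ Ga # Gd # v) = F (u @ v) + inverse q * F (u @ Gb # Gc # v)"
    "F (u @ Gd # Ga # v) = F (u @ v) + q * F (u @ Gb # Gc # v)"
  using qfunD[OF assms(1), of u v] assms(2) by simp_all

text \<open>A rewrite rule does not find the splitting \<open>u @ ...\<close> in a concrete list, so
  the prefix is spelled out for each length from 0 to 4; the suffix \<open>v\<close> stays a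
  variable.\<close>

lemmas qfun_rewrite =
  qfun_normalize[where u = "[]", simplified]
  qfun_normalize[where u = "[x1]" for x1, simplified]
  qfun_normalize[where u = "[x1, x2]" for x1 x2, simplified]
  qfun_normalize[where u = "[x1, x2, x3]" for x1 x2 x3, simplified]
  qfun_normalize[where u = "[x1, x2, x3, x4]" for x1 x2 x3 x4, simplified]

abbreviation evw :: "(gen list \<Rightarrow> complex) \<Rightarrow> nc \<Rightarrow> complex" where
  "evw F \<equiv> ev (\<lambda>w. F (letters w))"

lemma ev_SL2_span_iff: "(\<forall>s\<in>SL2_span q. evw F s = 0) \<longleftrightarrow> qfun q F"
proof -
  have "(\<forall>s\<in>SL2_span q. evw F s = 0) \<longleftrightarrow>
    (\<forall>u v. \<forall>r\<in>SL2_rels q. evw F (pt (Word u) * r * pt (Word v)) = 0)"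
    unfolding SL2_span_def by (auto, metis word.collapse)
  also have "\<dots> \<longleftrightarrow> qfun q F"
    unfolding qfun_def
    by (simp add: SL2_rels_def ncX_def one_conv_pt pt_mult_pt right_diff_distrib left_diff_distrib
        distrib_left distrib_right mult_scale_left mult_scale_right diff_eq_eq ball_simps
        eq_commute[of "F (_ @ Gb # Gc # _)" "F (_ @ Gc # Gb # _)"])
  finally show ?thesis .
qed

text \<open>\<open>SL2\<close> is built as a ring quotient and not by \<open>quot_mod\<close>. With
  its zero identified as a span, the facts on cosets of spans become available for it.\<close>

lemma zero_SL2: "\<zero>\<^bsub>SL2 q\<^esub> = fvs.span (SL2_span q)"
  by (simp add: SL2_def Let_def FactRing_def Idl_eq_span)

lemma zero_SL2_cls: "\<zero>\<^bsub>SL2 q\<^esub> = cls (SL2 q) 0"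
  by (simp add: cls_conv)

lemma cls_SL2_eq_iff: "cls (SL2 q) x = cls (SL2 q) y \<longleftrightarrow> (\<forall>F. qfun q F \<longrightarrow> evw F x = evw F y)"
proof -
  have "cls (SL2 q) x = cls (SL2 q) y \<longleftrightarrow> (\<forall>b. (\<forall>s\<in>SL2_span q. ev b s = 0) \<longrightarrow> ev b (x - y) = 0)"
    by (simp only: cls_span_eq_iff[OF zero_SL2] span_iff_ev)
  also have "\<dots> \<longleftrightarrow> (\<forall>F. (\<forall>s\<in>SL2_span q. evw F s = 0) \<longrightarrow> evw F (x - y) = 0)"
  proof (intro iffI allI impI)
    fix b :: "word \<Rightarrow> complex"
    assume "\<forall>F. (\<forall>s\<in>SL2_span q. evw F s = 0) \<longrightarrow> evw F (x - y) = 0" "\<forall>s\<in>SL2_span q. ev b s = 0"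
    from this(1)[rule_format, of "\<lambda>l. b (Word l)"] this(2) show "ev b (x - y) = 0"
      by simp
  qed blast
  finally show ?thesis by (simp add: ev_SL2_span_iff)
qed

lemma cls_SL2_eqI: "(\<And>F. qfun q F \<Longrightarrow> evw F x = evw F y) \<Longrightarrow> cls (SL2 q) x = cls (SL2 q) y"
  by (simp add: cls_SL2_eq_iff)

lemma ev_eq_of_cls_SL2_eq: "cls (SL2 q) x = cls (SL2 q) y \<Longrightarrow> qfun q F \<Longrightarrow> evw F x = evw F y"
  by (simp add: cls_SL2_eq_iff)

lemma cls_SL2_conv: "cls (SL2 q) x = Idl\<^bsub>nc_ring\<^esub> (SL2_rels q) +>\<^bsub>nc_ring\<^esub> x"
  by (simp add: cls_def a_r_coset_def' free_mod_def nc_ring_def SL2_def Let_def FactRing_def)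

lemma
  shows carrier_SL2: "carrier (SL2 q) = range (cls (SL2 q))"
    and mult_SL2: "cls (SL2 q) x \<otimes>\<^bsub>SL2 q\<^esub> cls (SL2 q) y = cls (SL2 q) (x * y)"
    and add_SL2: "cls (SL2 q) x \<oplus>\<^bsub>SL2 q\<^esub> cls (SL2 q) y = cls (SL2 q) (x + y)"
    and smult_SL2: "z \<odot>\<^bsub>SL2 q\<^esub> cls (SL2 q) y = cls (SL2 q) (scale z y)"
    and one_SL2: "\<one>\<^bsub>SL2 q\<^esub> = cls (SL2 q) 1"
proof -
  interpret ring nc_ring by (rule ring_nc)
  interpret I: ideal "Idl\<^bsub>nc_ring\<^esub> (SL2_rels q)" nc_ring
    by (rule genideal_ideal) (simp add: nc_ring_def)
  have m: "rcoset_mult nc_ring (Idl\<^bsub>nc_ring\<^esub> (SL2_rels q)) (cls (SL2 q) x) (cls (SL2 q) y) = cls (SL2 q) (x * y)" for x y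
    unfolding cls_SL2_conv using I.rcoset_mult_add[of x y] by (simp add: nc_ring_def)
  have "carrier (SL2 q) = a_rcosets\<^bsub>nc_ring\<^esub> (Idl\<^bsub>nc_ring\<^esub> (SL2_rels q))"
    by (simp add: SL2_def Let_def FactRing_def)
  then show "carrier (SL2 q) = range (cls (SL2 q))"
    by (auto simp: A_RCOSETS_def' cls_SL2_conv nc_ring_def)
  show mult: "cls (SL2 q) x \<otimes>\<^bsub>SL2 q\<^esub> cls (SL2 q) y = cls (SL2 q) (x * y)" for x y
    using m[of x y] by (simp add: SL2_def Let_def FactRing_def)
  show "cls (SL2 q) x \<oplus>\<^bsub>SL2 q\<^esub> cls (SL2 q) y = cls (SL2 q) (x + y)"
    using I.a_rcos_sum[of x y] unfolding cls_SL2_conv by (simp add: SL2_def Let_def FactRing_def nc_ring_def)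
  show "z \<odot>\<^bsub>SL2 q\<^esub> cls (SL2 q) y = cls (SL2 q) (scale z y)"
    using m[of "scale z 1" y] unfolding cls_SL2_conv
    by (simp add: SL2_def Let_def FactRing_def mult_scale_left)
  show "\<one>\<^bsub>SL2 q\<^esub> = cls (SL2 q) 1"
    unfolding cls_SL2_conv by (simp add: SL2_def Let_def FactRing_def nc_ring_def)
qed

lemma cls_SL2_in_carrier [simp]: "cls (SL2 q) x \<in> carrier (SL2 q)"
  by (simp add: carrier_SL2)

lemma qfunI:
  assumes "\<And>u v. F (u @ Gb # Ga # v) = q * F (u @ Ga # Gb # v)"
    "\<And>u v. F (u @ Gc # Ga # v) = q * F (u @ Ga # Gc # v)"
    "\<And>u v. F (u @ Gd # Gb # v) = q * F (u @ Gb # Gd # v)"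
    "\<And>u v. F (u @ Gd # Gc # v) = q * F (u @ Gc # Gd # v)"
    "\<And>u v. F (u @ Gc # Gb # v) = F (u @ Gb # Gc # v)"
    "\<And>u v. F (u @ Ga # Gd # v) = F (u @ v) + inverse q * F (u @ Gb # Gc # v)"
    "\<And>u v. F (u @ Gd # Ga # v) = F (u @ v) + q * F (u @ Gb # Gc # v)"
  shows "qfun q F"
  unfolding qfun_def by (intro allI conjI assms)

lemma deg_Word [simp]:
  "deg (Word []) = 0" "deg (Word (g # w)) = deg_gen g + deg (Word w)"
  "deg (Word (u @ v)) = deg (Word u) + deg (Word v)"
  by (simp_all add: deg_def)

lemma deg_plus: "deg (u + v) = deg u + deg v"
  by (simp add: deg_def plus_word_def)

lemma qfun_context:
  assumes "qfun q F"
  shows "qfun q (\<lambda>w. F (u @ w @ v))"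
  by (rule qfunI) (simp_all add: qfunD[OF assms, of "u @ _" "_ @ v", simplified])

lemma qfun_suffix: "qfun q F \<Longrightarrow> qfun q (\<lambda>w. F (w @ v))"
  using qfun_context[of q F "[]" v] by simp

text \<open>Every relation is homogeneous; in those for ad and da the empty word has degree 0 like
  the others. A weight that depends on the degree alone therefore respects all relations, which
  makes \<open>twist\<close> and \<open>prj_deg\<close> well defined.\<close>

lemma qfun_deg:
  assumes "qfun q F"
  shows "qfun q (\<lambda>w. h (deg (Word w)) * F w)"
  by (rule qfunI) (simp_all add: qfunD[OF assms] algebra_simps)

lemma qfun_if_deg:
  assumes "qfun q F"
  shows "qfun q (\<lambda>w. if deg (Word w) = n then F w else 0)"
  using qfun_deg[OF assms, of "\<lambda>m. if m = n then 1 else 0"] by (simp add: if_distrib[of "\<lambda>x. x * _"] cong: if_cong)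

lemma qfun_ev:
  assumes "\<And>k. qfun q (B k)"
  shows "qfun q (\<lambda>w. ev (\<lambda>k. B k w) p)"
  by (rule qfunI) (simp_all only: qfunD[OF assms] ev_add_fun ev_mult_fun)

lemma qfun_add:
  assumes "qfun q F" "qfun q G"
  shows "qfun q (\<lambda>w. F w + G w)"
  by (rule qfunI) (simp_all add: qfunD[OF assms(1)] qfunD[OF assms(2)] algebra_simps)

lemma qfun_mult:
  assumes "qfun q F"
  shows "qfun q (\<lambda>w. z * F w)"
  by (rule qfunI) (simp_all add: qfunD[OF assms] algebra_simps)

lemma descend_SL2:
  assumes "\<And>r. cls (SL2 q) r = cls (SL2 q) x \<Longrightarrow> f r = f x"
  shows "descend f (cls (SL2 q) x) = f x"
  by (rule descend_cls[OF zero_SL2], rule assms) (simp only: cls_span_eq_iff[OF zero_SL2])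

lemma ev_mult_pt: "ev b (x * pt (Word w)) = ev (\<lambda>l. b (Word (letters l @ w))) x"
  by (induction x rule: free_induct)
    (simp_all add: distrib_right mult_scale_left mult_single plus_word_def)

lemma ev_pt_mult: "ev b (pt (Word u) * x) = ev (\<lambda>l. b (Word (u @ letters l))) x"
  by (induction x rule: free_induct)
    (simp_all add: distrib_left mult_scale_right mult_single plus_word_def)

subsection \<open>Grading\<close>

definition homog :: "int \<Rightarrow> nc \<Rightarrow> bool" where
  "homog n x \<longleftrightarrow> (\<forall>w\<in>Poly_Mapping.keys x. deg w = n)"

lemma homog_iff_keys: "homog n x \<longleftrightarrow> Poly_Mapping.keys x \<subseteq> {w. deg w = n}"
  by (auto simp: homog_def)

lemma homog_zero [simp]: "homog n 0"
  by (simp add: homog_def)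

lemma homog_pt [simp]: "homog n (pt w) \<longleftrightarrow> deg w = n"
  by (simp add: homog_def)

lemma homog_add: "homog n x \<Longrightarrow> homog n y \<Longrightarrow> homog n (x + y)"
  unfolding homog_iff_keys by (rule keys_subset_add)

lemma homog_scale: "homog n x \<Longrightarrow> homog n (scale z x)"
  unfolding homog_iff_keys by (rule keys_subset_scale)

lemma homog_uminus: "homog n (- x) \<longleftrightarrow> homog n x"
  by (simp add: homog_def)

lemma homog_lext: "(\<And>k. k \<in> Poly_Mapping.keys p \<Longrightarrow> homog n (F k)) \<Longrightarrow> homog n (lext F p)"
  unfolding homog_iff_keys by (rule keys_subset_lext)

lemma homog_mult: "homog n x \<Longrightarrow> homog m y \<Longrightarrow> homog (n + m) (x * y)"
  unfolding homog_iff_keys by (rule order_trans[OF keys_mult]) (auto simp: deg_plus dest!: subsetD)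

lemma SL2_deg_def': "SL2_deg q n = cls (SL2 q) ` {x. homog n x}"
  by (simp add: SL2_deg_def homog_def)

lemma cls_in_SL2_deg: "homog n x \<Longrightarrow> cls (SL2 q) x \<in> SL2_deg q n"
  by (simp add: SL2_deg_def')

lemma SL2_degE:
  assumes "f \<in> SL2_deg q n"
  obtains x where "homog n x" "f = cls (SL2 q) x"
  using assms by (auto simp: SL2_deg_def')

lemma SL2_deg_subset_carrier: "SL2_deg q n \<subseteq> carrier (SL2 q)"
  by (auto simp: SL2_deg_def')

lemma SL2_deg_add: "f \<in> SL2_deg q n \<Longrightarrow> g \<in> SL2_deg q n \<Longrightarrow> f \<oplus>\<^bsub>SL2 q\<^esub> g \<in> SL2_deg q n"
  by (elim SL2_degE) (simp add: add_SL2 homog_add cls_in_SL2_deg)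

lemma SL2_deg_mult: "f \<in> SL2_deg q n \<Longrightarrow> g \<in> SL2_deg q m \<Longrightarrow> f \<otimes>\<^bsub>SL2 q\<^esub> g \<in> SL2_deg q (n + m)"
  by (elim SL2_degE) (simp add: mult_SL2 homog_mult cls_in_SL2_deg)

text \<open>Lets a map given on one homogeneous component be extended by zero to a linear map on the
  whole algebra.\<close>

definition prj_deg :: "complex \<Rightarrow> int \<Rightarrow> nc set \<Rightarrow> nc set" where
  "prj_deg q n = descend (\<lambda>x. cls (SL2 q) (lext (\<lambda>w. if deg w = n then pt w else 0) x))"

lemma prj_deg_cls: "prj_deg q n (cls (SL2 q) x) = cls (SL2 q) (lext (\<lambda>w. if deg w = n then pt w else 0) x)"
  unfolding prj_deg_def
proof (rule descend_SL2)
  fix r assume r: "cls (SL2 q) r = cls (SL2 q) x"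
  show "cls (SL2 q) (lext (\<lambda>w. if deg w = n then pt w else 0) r) = cls (SL2 q) (lext (\<lambda>w. if deg w = n then pt w else 0) x)"
  proof (rule cls_SL2_eqI)
    fix F assume "qfun q F"
    from ev_eq_of_cls_SL2_eq[OF r qfun_if_deg[OF this, of n]]
    show "evw F (lext (\<lambda>w. if deg w = n then pt w else 0) r) = evw F (lext (\<lambda>w. if deg w = n then pt w else 0) x)"
      by (simp add: if_distrib[of "ev _"] cong: if_cong)
  qed
qed

lemma prj_deg_in_SL2_deg: "f \<in> carrier (SL2 q) \<Longrightarrow> prj_deg q n f \<in> SL2_deg q n"
  by (auto simp: carrier_SL2 prj_deg_cls intro!: cls_in_SL2_deg homog_lext)

lemma prj_deg_id: "f \<in> SL2_deg q n \<Longrightarrow> prj_deg q n f = f"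
proof (elim SL2_degE)
  fix x assume x: "homog n x" "f = cls (SL2 q) x"
  have "lext (\<lambda>w. if deg w = n then pt w else 0) x = x"
    by (rule ev_ext, simp, rule ev_cong) (use x(1) in \<open>auto simp: homog_def\<close>)
  then show ?thesis by (simp add: x(2) prj_deg_cls)
qed

lemma twist_cls:
  "twist q k (cls (SL2 q) x) = cls (SL2 q) (lext (\<lambda>w. scale (q powi (k * deg w)) (pt w)) x)"
proof -
  have eq: "(\<Sum>w\<in>Poly_Mapping.keys x. scale (q powi (k * deg w) * Poly_Mapping.lookup x w) (pt w))
      = lext (\<lambda>w. scale (q powi (k * deg w)) (pt w)) x" for x :: nc
    by (simp add: lext_def mult.commute)
  show ?thesis
    unfolding twist_def eq
  proof (rule descend_SL2)
    fix r assume r: "cls (SL2 q) r = cls (SL2 q) x"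
    show "cls (SL2 q) (lext (\<lambda>w. scale (q powi (k * deg w)) (pt w)) r)
        = cls (SL2 q) (lext (\<lambda>w. scale (q powi (k * deg w)) (pt w)) x)"
    proof (rule cls_SL2_eqI)
      fix F assume "qfun q F"
      from ev_eq_of_cls_SL2_eq[OF r qfun_deg[OF this, of "\<lambda>n. q powi (k * n)"]]
      show "evw F (lext (\<lambda>w. scale (q powi (k * deg w)) (pt w)) r)
          = evw F (lext (\<lambda>w. scale (q powi (k * deg w)) (pt w)) x)"
        by simp
    qed
  qed
qed

lemma twist_homog:
  assumes "homog n x"
  shows "twist q k (cls (SL2 q) x) = cls (SL2 q) (scale (q powi (k * n)) x)"
proof -
  have "lext (\<lambda>w. scale (q powi (k * deg w)) (pt w)) x = scale (q powi (k * n)) x"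
    unfolding lext_def using assms
    by (intro ev_ext, simp) (simp add: homog_def ev_def sum_distrib_left mult_ac)
  then show ?thesis by (simp add: twist_cls)
qed

lemma twist_deg_0: "r \<in> S2 q \<Longrightarrow> twist q k r = r"
  by (elim SL2_degE) (simp add: twist_homog)

subsection \<open>One-forms\<close>

definition fm :: "complex \<Rightarrow> (form \<Rightarrow> nc) \<Rightarrow> (form \<Rightarrow> nc set)" where
  "fm q w = (\<lambda>i. cls (SL2 q) (w i))"

lemma fm_apply: "fm q w i = cls (SL2 q) (w i)"
  by (simp add: fm_def)

lemma carrier_Om_SL2: "carrier (Om_SL2 q) = range (fm q)"
proof
  show "carrier (Om_SL2 q) \<subseteq> range (fm q)"
  proof
    fix \<omega> assume "\<omega> \<in> carrier (Om_SL2 q)"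
    then have "\<forall>i. \<exists>x. \<omega> i = cls (SL2 q) x"
      by (auto simp: Om_SL2_def carrier_SL2)
    then obtain w where "\<forall>i. \<omega> i = cls (SL2 q) (w i)"
      by metis
    then show "\<omega> \<in> range (fm q)"
      by (auto simp: fm_def intro!: image_eqI[of _ _ w])
  qed
qed (auto simp: Om_SL2_def fm_def)

lemma fm_in_carrier [simp]: "fm q w \<in> carrier (Om_SL2 q)"
  by (simp add: carrier_Om_SL2)

lemma
  shows zero_Om_SL2: "\<zero>\<^bsub>Om_SL2 q\<^esub> = fm q (\<lambda>i. 0)"
    and add_Om_SL2: "fm q w \<oplus>\<^bsub>Om_SL2 q\<^esub> fm q w' = fm q (\<lambda>i. w i + w' i)"
    and smult_Om_SL2: "z \<odot>\<^bsub>Om_SL2 q\<^esub> fm q w = fm q (\<lambda>i. scale z (w i))"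
    and lact_fm: "lact q (cls (SL2 q) x) (fm q w) = fm q (\<lambda>i. x * w i)"
    and bas_fm: "bas q s = fm q (\<lambda>i. if i = s then 1 else 0)"
  by (auto simp: Om_SL2_def fm_def add_SL2 smult_SL2 lact_def mult_SL2 bas_def one_SL2 zero_SL2_cls fun_eq_iff)

lemma lact_bas: "lact q (cls (SL2 q) x) (bas q s) = fm q (\<lambda>i. if i = s then x else 0)"
  by (auto simp: bas_fm lact_fm intro!: arg_cong[of _ _ "fm q"])

lemma ract_homog:
  "homog n x \<Longrightarrow> ract q (fm q w) (cls (SL2 q) x) = fm q (\<lambda>i. scale (q powi (wt i * n)) (w i * x))"
  by (simp add: ract_def fm_def twist_homog mult_SL2 mult_scale_right)

lemma abelian_monoid_Om_SL2: "abelian_monoid (Om_SL2 q)"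
  by (rule abelian_monoidI) (auto simp: carrier_Om_SL2 zero_Om_SL2 add_Om_SL2 add_ac)

section \<open>The differential on words\<close>

fun dg :: "complex \<Rightarrow> gen \<Rightarrow> form \<Rightarrow> nc" where
  "dg q Ga E0 = pt (Word [Ga])" | "dg q Ga Ep = scale q (pt (Word [Gb]))" | "dg q Ga Em = 0"
| "dg q Gb E0 = scale (- (q powi -2)) (pt (Word [Gb]))" | "dg q Gb Ep = 0" | "dg q Gb Em = pt (Word [Ga])"
| "dg q Gc E0 = pt (Word [Gc])" | "dg q Gc Ep = scale q (pt (Word [Gd]))" | "dg q Gc Em = 0"
| "dg q Gd E0 = scale (- (q powi -2)) (pt (Word [Gd]))" | "dg q Gd Ep = 0" | "dg q Gd Em = pt (Word [Gc])"

text \<open>Together with \<open>dg\<close> this lifts \<open>d_word\<close> to the free algebra,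
  where functionals can be applied. The power of q comes from moving e^i to the right past
  \<open>w\<close>.\<close>

fun dw :: "complex \<Rightarrow> gen list \<Rightarrow> form \<Rightarrow> nc" where
  "dw q [] i = 0"
| "dw q (g # w) i = scale (q powi (wt i * deg (Word w))) (dg q g i * pt (Word w)) + pt (Word [g]) * dw q w i"

lemma d_gen_fm: "d_gen q g = fm q (dg q g)"
proof -
  have "d_gen q g i = fm q (dg q g) i" for i
    by (cases g; cases i)
      (simp_all only: d_gen.simps mat_def lact_bas add_Om_SL2 smult_Om_SL2 fm_apply dg.simps,
       simp_all add: ncX_def)
  then show ?thesis by blast
qed

lemma d_word_fm: "d_word q w = fm q (dw q w)"
proof (induction w)
  case (Cons g w)
  have "homog (deg (Word w)) (pt (Word w))" by simp
  then show ?case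
    unfolding d_word.simps d_gen_fm Cons mat_def ncX_def
    by (simp only: ract_homog lact_fm add_Om_SL2 dw.simps)
qed (simp add: zero_Om_SL2 fm_def)

text \<open>The Leibniz rule for the lift, before any relation is imposed. That q is nonzero allows
  integer exponents to be added.\<close>

lemma dw_append:
  assumes "q \<noteq> 0"
  shows "dw q (u @ w) i = scale (q powi (wt i * deg (Word w))) (dw q u i * pt (Word w)) + pt (Word u) * dw q w i"
proof (induction u)
  case (Cons g u)
  have 1: "pt (Word (g # u)) = pt (Word [g]) * pt (Word u)"
    and 2: "pt (Word (u @ w)) = pt (Word u) * pt (Word w)"
    by (simp_all add: pt_mult_pt)
  show ?case
    using assms
    by (simp add: Cons 1 2 distrib_left distrib_right mult_scale_left mult_scale_right
        fvs.scale_right_distrib mult.assoc power_int_add add.assoc)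
qed (simp flip: one_conv_pt)

lemma evw_dw_context:
  assumes "q \<noteq> 0"
  shows "evw F (dw q (u @ m @ v) i) =
    q powi (wt i * (deg (Word m) + deg (Word v))) * ev (\<lambda>l. F (letters l @ m @ v)) (dw q u i)
    + q powi (wt i * deg (Word v)) * evw (\<lambda>x. F (u @ x @ v)) (dw q m i)
    + evw (\<lambda>x. F (u @ m @ x)) (dw q v i)"
  using assms by (simp add: dw_append ev_mult_pt ev_pt_mult pt_mult_pt distrib_left mult_scale_right
      flip: mult.assoc)

text \<open>The differential of the seven relations. Those for ad and da lose their constant term,
  since d1 = 0.\<close>

lemma evw_dw_rels:
  assumes "qfun q F" "q \<noteq> 0"
  shows "evw F (dw q [Gb, Ga] i) = q * evw F (dw q [Ga, Gb] i)"
    and "evw F (dw q [Gc, Ga] i) = q * evw F (dw q [Ga, Gc] i)"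
    and "evw F (dw q [Gd, Gb] i) = q * evw F (dw q [Gb, Gd] i)"
    and "evw F (dw q [Gd, Gc] i) = q * evw F (dw q [Gc, Gd] i)"
    and "evw F (dw q [Gc, Gb] i) = evw F (dw q [Gb, Gc] i)"
    and "evw F (dw q [Ga, Gd] i) = inverse q * evw F (dw q [Gb, Gc] i)"
    and "evw F (dw q [Gd, Ga] i) = q * evw F (dw q [Gb, Gc] i)"
  by (cases i; simp add: pt_mult_pt mult_scale_left mult_scale_right qfun_rewrite[OF assms]
      assms(2) power_int_minus; simp add: assms(2) field_simps power2_eq_square)+

text \<open>This is what makes d well defined. By the Leibniz rule a relation in the context
  \<open>u\<close>, \<open>v\<close> gives three terms. Where d acts on \<open>u\<close> or
  \<open>v\<close>, the relation survives inside a \<open>qfun\<close>; where it acts on the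
  relation, \<open>evw_dw_rels\<close> applies. The powers of q agree because the relations are
  homogeneous.\<close>

lemma qfun_dw:
  assumes "qfun q F" "q \<noteq> 0"
  shows "qfun q (\<lambda>w. evw F (dw q w i))"
proof -
  have 1: "qfun q (\<lambda>m. ev (\<lambda>l. F (letters l @ m @ t)) (dw q s i))" for s t
    by (rule qfun_ev) (rule qfun_context[OF assms(1)])
  have 2: "qfun q (\<lambda>x. F (s @ x @ t))" for s t
    by (rule qfun_context[OF assms(1)])
  have 3: "qfun q (\<lambda>m. evw (\<lambda>x. F (s @ m @ x)) (dw q t i))" for s t
    by (rule qfun_ev) (rule qfun_context[OF assms(1)])
  \<comment> \<open>The two-letter words of a relation and the empty word of its constant term need
    separate instances of the Leibniz rule.\<close>
  note ctx2 = evw_dw_context[OF assms(2), of F _ "[_, _]", unfolded append.simps deg_Word deg_gen.simps]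
  note ctx0 = evw_dw_context[OF assms(2), of F _ "[]", unfolded append.simps deg_Word]
  note rels = qfunD[OF 1, where u = "[]" and v = "[]", simplified]
    qfunD[OF 3, where u = "[]" and v = "[]", simplified] evw_dw_rels[OF 2 assms(2)]
  show ?thesis
    by (rule qfunI; simp only: ctx2 deg_gen.simps; (simp only: ctx0)?; simp add: rels distrib_left del: dw.simps(2))
qed

lemma dif_cls:
  assumes "q \<noteq> 0"
  shows "dif q (cls (SL2 q) x) = fm q (\<lambda>i. lext (\<lambda>w. dw q (letters w) i) x)"
proof -
  interpret abelian_monoid "Om_SL2 q" by (rule abelian_monoid_Om_SL2)
  have 1: "lin_ext (Om_SL2 q) (\<lambda>w. d_word q (letters w)) x = fm q (\<lambda>i. lext (\<lambda>w. dw q (letters w) i) x)" for x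
  proof -
    let ?c = "Poly_Mapping.lookup x"
    have "(\<Oplus>\<^bsub>Om_SL2 q\<^esub>w\<in>I. ?c w \<odot>\<^bsub>Om_SL2 q\<^esub> d_word q (letters w))
        = fm q (\<lambda>i. \<Sum>w\<in>I. scale (?c w) (dw q (letters w) i))" if "finite I" for I
      using that
    proof (induction I rule: finite_induct)
      case (insert w I)
      have "(\<Oplus>\<^bsub>Om_SL2 q\<^esub>w\<in>insert w I. ?c w \<odot>\<^bsub>Om_SL2 q\<^esub> d_word q (letters w))
          = ?c w \<odot>\<^bsub>Om_SL2 q\<^esub> d_word q (letters w) \<oplus>\<^bsub>Om_SL2 q\<^esub>
            (\<Oplus>\<^bsub>Om_SL2 q\<^esub>w\<in>I. ?c w \<odot>\<^bsub>Om_SL2 q\<^esub> d_word q (letters w))"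
        using insert.hyps by (intro finsum_insert) (auto simp: d_word_fm smult_Om_SL2)
      then show ?case
        using insert by (simp add: d_word_fm smult_Om_SL2 add_Om_SL2)
    qed (simp add: zero_Om_SL2)
    then show ?thesis by (simp add: lin_ext_def lext_def)
  qed
  show ?thesis
    unfolding dif_def 1
  proof (rule descend_SL2)
    fix r assume r: "cls (SL2 q) r = cls (SL2 q) x"
    show "fm q (\<lambda>i. lext (\<lambda>w. dw q (letters w) i) r) = fm q (\<lambda>i. lext (\<lambda>w. dw q (letters w) i) x)"
      unfolding fm_def
    proof (rule ext, rule cls_SL2_eqI)
      fix F i assume "qfun q F"
      from ev_eq_of_cls_SL2_eq[OF r qfun_dw[OF this assms, of i]]
      show "evw F (lext (\<lambda>w. dw q (letters w) i) r) = evw F (lext (\<lambda>w. dw q (letters w) i) x)"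
        by simp
    qed
  qed
qed

section \<open>One-forms on the sphere\<close>

definition form2 :: "complex \<Rightarrow> nc \<Rightarrow> nc \<Rightarrow> (form \<Rightarrow> nc set)" where
  "form2 q x y = fm q (\<lambda>i. case i of Ep \<Rightarrow> x | Em \<Rightarrow> y | E0 \<Rightarrow> 0)"

abbreviation monom :: "gen list \<Rightarrow> nc" where "monom w \<equiv> pt (Word w)"

lemma b_cls:
  "b0 q = cls (SL2 q) (monom [Gb, Gc])"
  "bp q = cls (SL2 q) (monom [Gc, Gd])"
  "bm q = cls (SL2 q) (monom [Ga, Gb])"
  by (simp_all add: b0_def bp_def bm_def mat_def ncX_def mult_SL2 pt_mult_pt)

lemma b_in_S2: "b0 q \<in> S2 q" "bp q \<in> S2 q" "bm q \<in> S2 q"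
  by (simp_all add: b_cls cls_in_SL2_deg)

text \<open>The e^0 terms cancel: in d(ab), for instance, moving e^0 past b gives q^(-2) ab, against
  -q^(-2) ab from db.\<close>

lemma dif_b:
  assumes "q \<noteq> 0"
  shows "dif q (bm q) = form2 q (monom [Gb, Gb]) (monom [Ga, Ga])"
    and "dif q (bp q) = form2 q (monom [Gd, Gd]) (monom [Gc, Gc])"
    and "dif q (b0 q) = form2 q (scale q (monom [Gb, Gd])) (scale q (monom [Ga, Gc]))"
  unfolding b_cls dif_cls[OF assms] form2_def fm_def
  by (rule ext, rule cls_SL2_eqI, rename_tac i F, case_tac i;
      simp add: pt_mult_pt mult_scale_left mult_scale_right qfun_rewrite power_int_minus assms;
      (simp add: assms field_simps power2_eq_square)?)+

text \<open>With e^+, e^-, e^0 counted in degrees 2, -2, 0 the differential preserves degree, so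
  these are the degrees of the coefficients of a one-form of total degree 0.\<close>

fun form_deg :: "form \<Rightarrow> int" where
  "form_deg Ep = -2" | "form_deg Em = 2" | "form_deg E0 = 0"

lemma homog_dw: "homog (deg (Word w) + form_deg i) (dw q w i)"
proof (induction w)
  case (Cons g w)
  have "homog (deg_gen g + form_deg i) (dg q g i)"
    by (cases g; cases i) (simp_all add: homog_scale homog_uminus)
  from homog_scale[OF homog_mult[OF this, of "deg (Word w)" "pt (Word w)"]]
  have "homog (deg (Word (g # w)) + form_deg i) (scale (q powi (wt i * deg (Word w))) (dg q g i * pt (Word w)))"
    by (simp add: add_ac)
  moreover have "homog (deg_gen g) (pt (Word [g]))" by simp
  from homog_mult[OF this Cons] have "homog (deg (Word (g # w)) + form_deg i) (pt (Word [g]) * dw q w i)"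
    by (simp add: add_ac)
  ultimately show ?case
    by (simp add: homog_add)
qed simp

text \<open>The differential preserves total degree and the module actions are by elements of degree
  0. The converse, that all coefficients of these degrees occur with e^+ and e^-, is
  \<open>ef_in_Om_S2\<close>.\<close>

lemma Om_S2_set_deg:
  assumes "q \<noteq> 0" "\<omega> \<in> Om_S2_set q"
  shows "\<omega> i \<in> SL2_deg q (form_deg i)"
  using assms(2)
proof (induction rule: Om_S2_set.induct)
  case (exact x)
  then obtain y where y: "homog 0 y" "x = cls (SL2 q) y" by (rule SL2_degE)
  have "homog (form_deg i) (lext (\<lambda>w. dw q (letters w) i) y)"
  proof (rule homog_lext)
    fix k assume "k \<in> Poly_Mapping.keys y"
    then have "deg (Word (letters k)) = 0" using y(1) by (simp add: homog_def)
    with homog_dw[of "letters k" i q] show "homog (form_deg i) (dw q (letters k) i)" by simp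
  qed
  then show ?case
    by (simp add: y(2) dif_cls[OF assms(1)] fm_apply cls_in_SL2_deg)
next
  case (add \<omega> \<eta>)
  then show ?case by (simp add: Om_SL2_def SL2_deg_add)
next
  case (left x \<omega>)
  then show ?case using SL2_deg_mult[of x q 0 "\<omega> i" "form_deg i"] by (simp add: lact_def)
next
  case (right x \<omega>)
  then show ?case using SL2_deg_mult[of "\<omega> i" q "form_deg i" x 0] by (simp add: ract_def twist_deg_0)
qed

lemma Om_S2_set_subset: "q \<noteq> 0 \<Longrightarrow> Om_S2_set q \<subseteq> carrier (Om_SL2 q)"
  using Om_S2_set_deg SL2_deg_subset_carrier by (fastforce simp: Om_SL2_def)

definition ef :: "complex \<Rightarrow> form \<Rightarrow> nc set \<Rightarrow> (form \<Rightarrow> nc set)" where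
  "ef q s f = lact q f (bas q s)"

lemma ef_cls: "ef q s (cls (SL2 q) x) = fm q (\<lambda>i. if i = s then x else 0)"
  by (simp add: ef_def lact_bas)

lemma lact_ef_cls: "lact q (cls (SL2 q) y) (ef q s (cls (SL2 q) x)) = ef q s (cls (SL2 q) (y * x))"
  unfolding ef_cls lact_fm by (intro arg_cong[of _ _ "fm q"] ext) simp

lemma ef_add:
  "ef q s (cls (SL2 q) x) \<oplus>\<^bsub>Om_SL2 q\<^esub> ef q s (cls (SL2 q) y) = ef q s (cls (SL2 q) (x + y))"
  unfolding ef_cls add_Om_SL2 by (intro arg_cong[of _ _ "fm q"] ext) simp

lemma ef_smult: "z \<odot>\<^bsub>Om_SL2 q\<^esub> ef q s (cls (SL2 q) x) = ef q s (cls (SL2 q) (scale z x))"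
  unfolding ef_cls smult_Om_SL2 by (intro arg_cong[of _ _ "fm q"] ext) simp

lemma form2_split: "form2 q x y = ef q Ep (cls (SL2 q) x) \<oplus>\<^bsub>Om_SL2 q\<^esub> ef q Em (cls (SL2 q) y)"
  unfolding ef_cls add_Om_SL2 form2_def by (intro arg_cong[of _ _ "fm q"] ext) (simp split: form.split)

lemma lact_form2: "lact q (cls (SL2 q) z) (form2 q x y) = form2 q (z * x) (z * y)"
  unfolding form2_def lact_fm by (intro arg_cong[of _ _ "fm q"] ext) (simp split: form.split)

lemma add_form2: "form2 q x y \<oplus>\<^bsub>Om_SL2 q\<^esub> form2 q x' y' = form2 q (x + x') (y + y')"
  unfolding form2_def add_Om_SL2 by (intro arg_cong[of _ _ "fm q"] ext) (simp split: form.split)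

lemma form2_eq_ef:
  "cls (SL2 q) y = cls (SL2 q) 0 \<Longrightarrow> form2 q x y = ef q Ep (cls (SL2 q) x)"
  "cls (SL2 q) x = cls (SL2 q) 0 \<Longrightarrow> form2 q x y = ef q Em (cls (SL2 q) y)"
  by (auto simp: form2_def ef_cls fm_def fun_eq_iff split: form.split)

text \<open>The inductive set has no rule for scalars; z acts as left multiplication by z 1, an
  element of the sphere algebra.\<close>

lemma Om_S2_smult:
  assumes "\<omega> \<in> Om_S2_set q" "q \<noteq> 0"
  shows "z \<odot>\<^bsub>Om_SL2 q\<^esub> \<omega> \<in> Om_S2_set q"
proof -
  obtain w where w: "\<omega> = fm q w"
    using Om_S2_set_subset assms by (fastforce simp: carrier_Om_SL2)
  have "homog 0 (scale z 1)"
    unfolding one_conv_pt by (intro homog_scale) simp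
  then have "lact q (cls (SL2 q) (scale z 1)) \<omega> \<in> Om_S2_set q"
    using assms by (intro Om_S2_set.left cls_in_SL2_deg)
  then show ?thesis
    by (simp add: w lact_fm smult_Om_SL2 mult_scale_left)
qed

text \<open>With \<open>u\<close> of degree -1 the combinations $(uc)\,\mathrm{d}b_- - q(ua)\,\mathrm{d}b_0 = -q\,ub\,e^+$ and
  $(uc)\,\mathrm{d}b_0 - q^2(ua)\,\mathrm{d}b_+ = -q^2\,ud\,e^+$ have no $e^-$ component; similarly
  $(ud)\,\mathrm{d}b_- - q(ub)\,\mathrm{d}b_0 = ua\,e^-$ and $(ud)\,\mathrm{d}b_0 - q^2(ub)\,\mathrm{d}b_+ = q\,uc\,e^-$
  for \<open>u\<close> of degree 1.\<close>

lemma ef_monom_in_Om_S2: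
  assumes q: "q \<noteq> 0"
  shows "g \<in> {Gb, Gd} \<Longrightarrow> h \<in> {Gb, Gd} \<Longrightarrow> ef q Ep (cls (SL2 q) (monom [g, h])) \<in> Om_S2_set q"
    and "g \<in> {Ga, Gc} \<Longrightarrow> h \<in> {Ga, Gc} \<Longrightarrow> ef q Em (cls (SL2 q) (monom [g, h])) \<in> Om_S2_set q"
proof -
  have comb: "form2 q (x * x1 + y * y1) (x * x2 + y * y2) \<in> Om_S2_set q"
    if "homog 0 x" "homog 0 y" "form2 q x1 x2 \<in> Om_S2_set q" "form2 q y1 y2 \<in> Om_S2_set q" for x y x1 x2 y1 y2
    using Om_S2_set.add[OF Om_S2_set.left[OF cls_in_SL2_deg[OF that(1)] that(3)]
      Om_S2_set.left[OF cls_in_SL2_deg[OF that(2)] that(4)]]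
    by (simp add: lact_form2 add_form2)
  note d = b_in_S2[THEN Om_S2_set.exact, of q, unfolded dif_b[OF q]]
  have unscale: "ef q s (cls (SL2 q) x) \<in> Om_S2_set q"
    if "ef q s (cls (SL2 q) y) \<in> Om_S2_set q" "cls (SL2 q) x = cls (SL2 q) (scale z y)" for s x y z
    using Om_S2_smult[OF that(1) q, of z] by (simp add: ef_smult that(2))
  {
    fix u assume u: "deg_gen u = -1"
    let ?x = "monom [u, Gc]" and ?y = "scale (- q) (monom [u, Ga])"
    have "ef q Ep (cls (SL2 q) (?x * monom [Gb, Gb] + ?y * scale q (monom [Gb, Gd]))) \<in> Om_S2_set q"
      by (subst form2_eq_ef(1)[symmetric, where y = "?x * monom [Ga, Ga] + ?y * scale q (monom [Ga, Gc])"],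
          rule cls_SL2_eqI, simp add: mult_scale_left mult_scale_right pt_mult_pt qfun_rewrite q field_simps,
          rule comb; simp add: d u homog_scale homog_uminus)
    then have "ef q Ep (cls (SL2 q) (monom [u, Gb])) \<in> Om_S2_set q"
      by (rule unscale[where z = "- inverse q"])
        (rule cls_SL2_eqI, simp add: mult_scale_left mult_scale_right pt_mult_pt qfun_rewrite q field_simps)
    moreover
    let ?x = "monom [u, Gc]" and ?y = "scale (- (q\<^sup>2)) (monom [u, Ga])"
    have "ef q Ep (cls (SL2 q) (?x * scale q (monom [Gb, Gd]) + ?y * monom [Gd, Gd])) \<in> Om_S2_set q"
      by (subst form2_eq_ef(1)[symmetric, where y = "?x * scale q (monom [Ga, Gc]) + ?y * monom [Gc, Gc]"],
          rule cls_SL2_eqI, simp add: mult_scale_left mult_scale_right pt_mult_pt qfun_rewrite q power2_eq_square field_simps,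
          rule comb; simp add: d u homog_scale homog_uminus)
    then have "ef q Ep (cls (SL2 q) (monom [u, Gd])) \<in> Om_S2_set q"
      by (rule unscale[where z = "- inverse (q\<^sup>2)"])
        (rule cls_SL2_eqI, simp add: mult_scale_left mult_scale_right pt_mult_pt qfun_rewrite q field_simps power2_eq_square)
    ultimately have "\<forall>h\<in>{Gb, Gd}. ef q Ep (cls (SL2 q) (monom [u, h])) \<in> Om_S2_set q"
      by simp
  }
  then show "ef q Ep (cls (SL2 q) (monom [g, h])) \<in> Om_S2_set q" if "g \<in> {Gb, Gd}" "h \<in> {Gb, Gd}"
    using that by (elim insertE) auto
  {
    fix u assume u: "deg_gen u = 1"
    let ?x = "monom [u, Gd]" and ?y = "scale (- q) (monom [u, Gb])"
    have "ef q Em (cls (SL2 q) (?x * monom [Ga, Ga] + ?y * scale q (monom [Ga, Gc]))) \<in> Om_S2_set q"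
      by (subst form2_eq_ef(2)[symmetric, where x = "?x * monom [Gb, Gb] + ?y * scale q (monom [Gb, Gd])"],
          rule cls_SL2_eqI, simp add: mult_scale_left mult_scale_right pt_mult_pt qfun_rewrite q field_simps,
          rule comb; simp add: d u homog_scale homog_uminus)
    then have "ef q Em (cls (SL2 q) (monom [u, Ga])) \<in> Om_S2_set q"
      by (rule unscale[where z = 1])
        (rule cls_SL2_eqI, simp add: mult_scale_left mult_scale_right pt_mult_pt qfun_rewrite q field_simps)
    moreover
    let ?x = "monom [u, Gd]" and ?y = "scale (- (q\<^sup>2)) (monom [u, Gb])"
    have "ef q Em (cls (SL2 q) (?x * scale q (monom [Ga, Gc]) + ?y * monom [Gc, Gc])) \<in> Om_S2_set q"
      by (subst form2_eq_ef(2)[symmetric, where x = "?x * scale q (monom [Gb, Gd]) + ?y * monom [Gd, Gd]"],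
          rule cls_SL2_eqI, simp add: mult_scale_left mult_scale_right pt_mult_pt qfun_rewrite q power2_eq_square field_simps,
          rule comb; simp add: d u homog_scale homog_uminus)
    then have "ef q Em (cls (SL2 q) (monom [u, Gc])) \<in> Om_S2_set q"
      by (rule unscale[where z = "inverse q"])
        (rule cls_SL2_eqI, simp add: mult_scale_left mult_scale_right pt_mult_pt qfun_rewrite q field_simps power2_eq_square)
    ultimately have "\<forall>h\<in>{Ga, Gc}. ef q Em (cls (SL2 q) (monom [u, h])) \<in> Om_S2_set q"
      by simp
  }
  then show "ef q Em (cls (SL2 q) (monom [g, h])) \<in> Om_S2_set q" if "g \<in> {Ga, Gc}" "h \<in> {Ga, Gc}"
    using that by (elim insertE) auto
qed

text \<open>Both follow by inserting $1 = ad - q^{-1}cb$ and $1 = da - q\,bc$ twice.\<close>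

lemma qfun_insert_Ep:
  assumes "qfun q F"
  shows "F w = F (w @ [Ga, Ga] @ [Gd, Gd]) - inverse q * F (w @ [Ga, Gc] @ [Gb, Gd])
     - inverse q * F (w @ [Gc, Ga] @ [Gd, Gb]) + (inverse q)\<^sup>2 * F (w @ [Gc, Gc] @ [Gb, Gb])"
proof -
  have 1: "F (w @ v) = F (w @ Ga # Gd # v) - inverse q * F (w @ Gc # Gb # v)" for w v
    by (simp add: qfunD[OF assms])
  have "F w = F (w @ [Ga, Gd]) - inverse q * F (w @ [Gc, Gb])"
    using 1[of w "[]"] by simp
  also have "F (w @ [Ga, Gd]) = F (w @ [Ga, Ga, Gd, Gd]) - inverse q * F (w @ [Ga, Gc, Gb, Gd])"
    using 1[of "w @ [Ga]" "[Gd]"] by simp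
  also have "F (w @ [Gc, Gb]) = F (w @ [Gc, Ga, Gd, Gb]) - inverse q * F (w @ [Gc, Gc, Gb, Gb])"
    using 1[of "w @ [Gc]" "[Gb]"] by simp
  finally show ?thesis by (simp add: power2_eq_square right_diff_distrib)
qed

lemma qfun_insert_Em:
  assumes "qfun q F"
  shows "F w = F (w @ [Gd, Gd] @ [Ga, Ga]) - q * F (w @ [Gd, Gb] @ [Gc, Ga])
     - q * F (w @ [Gb, Gd] @ [Ga, Gc]) + q\<^sup>2 * F (w @ [Gb, Gb] @ [Gc, Gc])"
proof -
  have 1: "F (w @ v) = F (w @ Gd # Ga # v) - q * F (w @ Gb # Gc # v)" for w v
    by (simp add: qfunD[OF assms])
  have "F w = F (w @ [Gd, Ga]) - q * F (w @ [Gb, Gc])"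
    using 1[of w "[]"] by simp
  also have "F (w @ [Gd, Ga]) = F (w @ [Gd, Gd, Ga, Ga]) - q * F (w @ [Gd, Gb, Gc, Ga])"
    using 1[of "w @ [Gd]" "[Ga]"] by simp
  also have "F (w @ [Gb, Gc]) = F (w @ [Gb, Gd, Ga, Gc]) - q * F (w @ [Gb, Gb, Gc, Gc])"
    using 1[of "w @ [Gb]" "[Gc]"] by simp
  finally show ?thesis by (simp add: power2_eq_square right_diff_distrib)
qed

text \<open>By \<open>qfun_insert_Ep\<close> an x of degree -2 is a combination of products (x u) v,
  where u has degree 2 and v is a two-letter word in b, d. Then x u has degree 0 and v e^+ is a form
  on the sphere by \<open>ef_monom_in_Om_S2\<close>, so x e^+ is a left combination of such forms.
  The case of e^- is analogous.\<close>

lemma ef_in_Om_S2: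
  assumes q: "q \<noteq> 0"
  shows "f \<in> SL2_deg q (-2) \<Longrightarrow> ef q Ep f \<in> Om_S2_set q"
    and "f \<in> SL2_deg q 2 \<Longrightarrow> ef q Em f \<in> Om_S2_set q"
proof -
  have mem: "ef q s (cls (SL2 q) (x * monom u * monom v)) \<in> Om_S2_set q"
    if "homog n x" "deg (Word u) = - n" "ef q s (cls (SL2 q) (monom v)) \<in> Om_S2_set q" for x u v s n
  proof -
    have "homog 0 (x * monom u)"
      using homog_mult[OF that(1), of "- n" "monom u"] that(2) by simp
    then have "lact q (cls (SL2 q) (x * monom u)) (ef q s (cls (SL2 q) (monom v))) \<in> Om_S2_set q"
      using that(3) by (intro Om_S2_set.left cls_in_SL2_deg)
    then show ?thesis by (simp add: lact_ef_cls)
  qed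
  have comb: "ef q s (cls (SL2 q) (x1 + scale z2 x2 + scale z3 x3 + scale z4 x4)) \<in> Om_S2_set q"
    if "ef q s (cls (SL2 q) x1) \<in> Om_S2_set q" "ef q s (cls (SL2 q) x2) \<in> Om_S2_set q"
      "ef q s (cls (SL2 q) x3) \<in> Om_S2_set q" "ef q s (cls (SL2 q) x4) \<in> Om_S2_set q"
    for s x1 x2 x3 x4 z2 z3 z4
    unfolding ef_add[symmetric] ef_smult[symmetric]
    by (intro Om_S2_set.add Om_S2_smult[OF _ q] that)
  show "ef q Ep f \<in> Om_S2_set q" if "f \<in> SL2_deg q (-2)"
  proof -
    obtain x where x: "homog (-2) x" "f = cls (SL2 q) x" using \<open>f \<in> SL2_deg q (-2)\<close> by (rule SL2_degE)
    have "f = cls (SL2 q) (x * monom [Ga, Ga] * monom [Gd, Gd] + scale (- inverse q) (x * monom [Ga, Gc] * monom [Gb, Gd])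
       + scale (- inverse q) (x * monom [Gc, Ga] * monom [Gd, Gb]) + scale ((inverse q)\<^sup>2) (x * monom [Gc, Gc] * monom [Gb, Gb]))"
      unfolding x(2)
    proof (rule cls_SL2_eqI)
      fix F assume "qfun q F"
      then have "evw F x = ev (\<lambda>w. F (letters w @ [Ga, Ga] @ [Gd, Gd]) - inverse q * F (letters w @ [Ga, Gc] @ [Gb, Gd])
         - inverse q * F (letters w @ [Gc, Ga] @ [Gd, Gb]) + (inverse q)\<^sup>2 * F (letters w @ [Gc, Gc] @ [Gb, Gb])) x"
        by (intro ev_cong qfun_insert_Ep)
      then show "evw F x = evw F (x * monom [Ga, Ga] * monom [Gd, Gd] + scale (- inverse q) (x * monom [Ga, Gc] * monom [Gb, Gd])
       + scale (- inverse q) (x * monom [Gc, Ga] * monom [Gd, Gb]) + scale ((inverse q)\<^sup>2) (x * monom [Gc, Gc] * monom [Gb, Gb]))"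
        by (simp add: ev_mult_pt ev_add_fun ev_diff_fun ev_mult_fun)
    qed
    also have "ef q Ep \<dots> \<in> Om_S2_set q"
      by (intro comb mem[OF x(1)] ef_monom_in_Om_S2(1)[OF q]) simp_all
    finally show ?thesis .
  qed
  show "ef q Em f \<in> Om_S2_set q" if "f \<in> SL2_deg q 2"
  proof -
    obtain x where x: "homog 2 x" "f = cls (SL2 q) x" using \<open>f \<in> SL2_deg q 2\<close> by (rule SL2_degE)
    have "f = cls (SL2 q) (x * monom [Gd, Gd] * monom [Ga, Ga] + scale (- q) (x * monom [Gd, Gb] * monom [Gc, Ga])
       + scale (- q) (x * monom [Gb, Gd] * monom [Ga, Gc]) + scale (q\<^sup>2) (x * monom [Gb, Gb] * monom [Gc, Gc]))"
      unfolding x(2)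
    proof (rule cls_SL2_eqI)
      fix F assume "qfun q F"
      then have "evw F x = ev (\<lambda>w. F (letters w @ [Gd, Gd] @ [Ga, Ga]) - q * F (letters w @ [Gd, Gb] @ [Gc, Ga])
         - q * F (letters w @ [Gb, Gd] @ [Ga, Gc]) + q\<^sup>2 * F (letters w @ [Gb, Gb] @ [Gc, Gc])) x"
        by (intro ev_cong qfun_insert_Em)
      then show "evw F x = evw F (x * monom [Gd, Gd] * monom [Ga, Ga] + scale (- q) (x * monom [Gd, Gb] * monom [Gc, Ga])
       + scale (- q) (x * monom [Gb, Gd] * monom [Ga, Gc]) + scale (q\<^sup>2) (x * monom [Gb, Gb] * monom [Gc, Gc]))"
        by (simp add: ev_mult_pt ev_add_fun ev_diff_fun ev_mult_fun)
    qed
    also have "ef q Em \<dots> \<in> Om_S2_set q"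
      by (intro comb mem[OF x(1)] ef_monom_in_Om_S2(2)[OF q]) simp_all
    finally show ?thesis .
  qed
qed

lemma evw_mult: "evw F (x * y) = evw (\<lambda>u. evw (\<lambda>v. F (u @ v)) y) x"
proof (induction x rule: free_induct)
  case (step z k p)
  have "evw F (pt k * y) = evw (\<lambda>v. F (letters k @ v)) y"
    using ev_pt_mult[of "\<lambda>w. F (letters w)" "letters k" y] by simp
  with step show ?case by (simp add: distrib_right mult_scale_left)
qed simp

subsection \<open>Coproduct\<close>

text \<open>In Sweedler notation, B(w_(1), w_(2)).\<close>

definition copsum :: "(gen list \<Rightarrow> gen list \<Rightarrow> complex) \<Rightarrow> gen list \<Rightarrow> complex" where
  "copsum B w = (\<Sum>(u, v)\<leftarrow>coprod_word w. B u v)"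

lemma copsum_Nil [simp]: "copsum B [] = B [] []"
  by (simp add: copsum_def)

lemma copsum_Cons [simp]:
  "copsum B (g # w) = (\<Sum>(g1, g2)\<leftarrow>coprod_gen g. copsum (\<lambda>u v. B (g1 # u) (g2 # v)) w)"
  by (cases g) (simp_all add: copsum_def comp_def case_prod_unfold)

lemma copsum_append: "copsum B (u @ w) = copsum (\<lambda>u1 u2. copsum (\<lambda>w1 w2. B (u1 @ w1) (u2 @ w2)) w) u"
  by (induction u arbitrary: B) (simp_all add: case_prod_unfold)

lemma copsum_add: "copsum (\<lambda>u v. B u v + C u v) w = copsum B w + copsum C w"
  by (simp add: copsum_def case_prod_unfold sum_list_addf)

lemma copsum_mult: "copsum (\<lambda>u v. z * B u v) w = z * copsum B w"
  by (simp add: copsum_def case_prod_unfold sum_list_const_mult)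

lemma copsum_swap: "copsum (\<lambda>u v. copsum (\<lambda>s t. B u v s t) x) w = copsum (\<lambda>s t. copsum (\<lambda>u v. B u v s t) w) x"
proof (induction w arbitrary: B)
  case (Cons g w)
  then show ?case by (cases g) (simp_all add: copsum_add)
qed simp

lemma copsum_ev: "copsum (\<lambda>u v. ev (\<lambda>k. B u v k) p) w = ev (\<lambda>k. copsum (\<lambda>u v. B u v k) w) p"
  by (simp add: copsum_def case_prod_unfold ev_sum_list_fun)

text \<open>In both terms of the coproduct of a generator the second leg has the degree of that
  generator: it is a or c for a and c, and b or d for b and d.\<close>

lemma copsum_cong:
  assumes "\<And>u v. deg (Word v) = deg (Word w) \<Longrightarrow> B u v = C u v"
  shows "copsum B w = copsum C w"
  using assms
proof (induction w arbitrary: B C)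
  case (Cons g w)
  show ?case
    by (cases g) (auto intro!: arg_cong2[of _ _ _ _ "(+)"] Cons)
qed simp

text \<open>The functionals on the tensor square of C_q[SL_2], seen on pairs of words.\<close>

definition biqfun :: "complex \<Rightarrow> (gen list \<Rightarrow> gen list \<Rightarrow> complex) \<Rightarrow> bool" where
  "biqfun q B \<longleftrightarrow> (\<forall>v. qfun q (\<lambda>u. B u v)) \<and> (\<forall>u. qfun q (\<lambda>v. B u v))"

lemma biqfunD: "biqfun q B \<Longrightarrow> qfun q (\<lambda>u. B u v)" "biqfun q B \<Longrightarrow> qfun q (\<lambda>v. B u v)"
  by (simp_all add: biqfun_def)

lemma qfun_copsum_param:
  assumes "\<And>s t. qfun q (\<lambda>m. B s t m)"
  shows "qfun q (\<lambda>m. copsum (\<lambda>s t. B s t m) w)"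
  by (rule qfunI) (simp_all only: qfunD[OF assms] copsum_add copsum_mult)

lemma copsum_rels:
  assumes "biqfun q B" and q: "q \<noteq> 0"
  shows "copsum B [Gb, Ga] = q * copsum B [Ga, Gb]"
    and "copsum B [Gc, Ga] = q * copsum B [Ga, Gc]"
    and "copsum B [Gd, Gb] = q * copsum B [Gb, Gd]"
    and "copsum B [Gd, Gc] = q * copsum B [Gc, Gd]"
    and "copsum B [Gc, Gb] = copsum B [Gb, Gc]"
    and "copsum B [Ga, Gd] = copsum B [] + inverse q * copsum B [Gb, Gc]"
    and "copsum B [Gd, Ga] = copsum B [] + q * copsum B [Gb, Gc]"
  by (simp_all add: qfun_rewrite[OF biqfunD(1)[OF assms(1)] q] qfun_rewrite[OF biqfunD(2)[OF assms(1)] q];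
      simp add: q field_simps)+

text \<open>This is what makes the coproduct well defined; multiplicativity on words reduces a
  relation in context to the relation itself.\<close>

lemma qfun_copsum:
  assumes B: "biqfun q B" and q: "q \<noteq> 0"
  shows "qfun q (copsum B)"
proof -
  \<comment> \<open>The context is summed out, leaving a function of the two legs of the middle
    word, which is again a \<open>biqfun\<close>.\<close>
  define C where "C u v = (\<lambda>m1 m2. copsum (\<lambda>u1 u2. copsum (\<lambda>v1 v2. B (u1 @ m1 @ v1) (u2 @ m2 @ v2)) v) u)" for u v
  have "biqfun q (C u v)" for u v
    unfolding biqfun_def C_def
    by (intro conjI allI qfun_copsum_param qfun_context[of q "\<lambda>u. B u v" for v] qfun_context[of q "\<lambda>v. B u v" for u]
        biqfunD[OF B])
  note rels = copsum_rels[OF this q]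
  have C: "copsum B (u @ m @ v) = copsum (C u v) m" for u m v
  proof -
    have "copsum B (u @ m @ v)
        = copsum (\<lambda>u1 u2. copsum (\<lambda>m1 m2. copsum (\<lambda>v1 v2. B (u1 @ m1 @ v1) (u2 @ m2 @ v2)) v) m) u"
      by (simp only: copsum_append)
    also have "\<dots> = copsum (C u v) m"
      unfolding C_def by (rule copsum_swap)
    finally show ?thesis .
  qed
  note C2 = C[of _ "[_, _]", unfolded append.simps] and C0 = C[of _ "[]", unfolded append.simps]
  show ?thesis
    by (rule qfunI; simp only: C2; (simp only: C0)?; rule rels)
qed

abbreviation slw :: "complex \<Rightarrow> gen list \<Rightarrow> nc set" where
  "slw q w \<equiv> cls (SL2 q) (monom w)"

text \<open>A linear functional on C_q[SL_2] is determined by its values on words, and these satisfy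
  the relations because relations have class zero. This is the passage from abstract balanced
  functionals to word rewriting.\<close>

lemma
  assumes add: "\<And>x y. h (cls (SL2 q) (x + y)) = h (cls (SL2 q) x) + h (cls (SL2 q) y)"
    and smult: "\<And>z x. h (cls (SL2 q) (scale z x)) = z * h (cls (SL2 q) x)"
  shows functional_SL2_eq: "h (cls (SL2 q) x) = evw (\<lambda>u. h (slw q u)) x"
    and functional_SL2_qfun: "qfun q (\<lambda>u. h (slw q u))"
proof -
  have zero: "h (cls (SL2 q) 0) = 0"
    using smult[of 0 0] by simp
  show eq: "h (cls (SL2 q) x) = evw (\<lambda>u. h (slw q u)) x" for x
    by (induction x rule: free_induct) (simp_all add: zero add smult)
  show "qfun q (\<lambda>u. h (slw q u))"
    unfolding ev_SL2_span_iff[symmetric]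
  proof
    fix s assume "s \<in> SL2_span q"
    then have "cls (SL2 q) s = cls (SL2 q) 0"
      by (simp add: cls_span_eq_iff[OF zero_SL2] fvs.span_base)
    then show "evw (\<lambda>u. h (slw q u)) s = 0"
      using eq[of s] zero by simp
  qed
qed

abbreviation balancedC :: "(complex, 'm) module \<Rightarrow> (complex, 'n) module \<Rightarrow> ('m \<times> 'n \<Rightarrow> complex) \<Rightarrow> bool" where
  "balancedC M N \<equiv> balanced M N UNIV (\<lambda>m z. z \<odot>\<^bsub>M\<^esub> m) (\<lambda>z n. z \<odot>\<^bsub>N\<^esub> n)"

abbreviation relsC :: "(complex, 'm) module \<Rightarrow> (complex, 'n) module \<Rightarrow> ('m \<times> 'n \<Rightarrow>\<^sub>0 complex) set" where
  "relsC M N \<equiv> tensor_rels M N UNIV (\<lambda>m z. z \<odot>\<^bsub>M\<^esub> m) (\<lambda>z n. z \<odot>\<^bsub>N\<^esub> n)"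

lemma balancedCI:
  assumes "\<And>m m' n. m \<in> carrier M \<Longrightarrow> m' \<in> carrier M \<Longrightarrow> n \<in> carrier N \<Longrightarrow> b (m \<oplus>\<^bsub>M\<^esub> m', n) = b (m, n) + b (m', n)"
    and "\<And>m n n'. m \<in> carrier M \<Longrightarrow> n \<in> carrier N \<Longrightarrow> n' \<in> carrier N \<Longrightarrow> b (m, n \<oplus>\<^bsub>N\<^esub> n') = b (m, n) + b (m, n')"
    and "\<And>z m n. m \<in> carrier M \<Longrightarrow> n \<in> carrier N \<Longrightarrow> b (z \<odot>\<^bsub>M\<^esub> m, n) = z * b (m, n)"
    and "\<And>z m n. m \<in> carrier M \<Longrightarrow> n \<in> carrier N \<Longrightarrow> b (m, z \<odot>\<^bsub>N\<^esub> n) = z * b (m, n)"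
  shows "balancedC M N b"
  unfolding balanced_def using assms by simp

lemma SL2_closed:
  "m \<in> carrier (SL2 q) \<Longrightarrow> m' \<in> carrier (SL2 q) \<Longrightarrow> m \<oplus>\<^bsub>SL2 q\<^esub> m' \<in> carrier (SL2 q)"
  "m \<in> carrier (SL2 q) \<Longrightarrow> z \<odot>\<^bsub>SL2 q\<^esub> m \<in> carrier (SL2 q)"
  "m \<in> carrier (SL2 q) \<Longrightarrow> m' \<in> carrier (SL2 q) \<Longrightarrow> m \<otimes>\<^bsub>SL2 q\<^esub> m' \<in> carrier (SL2 q)"
  by (auto simp: carrier_SL2 add_SL2 smult_SL2 mult_SL2)

lemma quotient_space_SL2_SL2:
  "quotient_space (carrier (SL2 q) \<times> carrier (SL2 q)) (relsC (SL2 q) (SL2 q)) (tensorC (SL2 q) (SL2 q))"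
  unfolding tensorC_def by (rule quotient_space_tensor) (simp_all add: SL2_closed)

lemma balancedC_SL2_qfun:
  assumes b: "balancedC (SL2 q) N b" and n: "n \<in> carrier N"
  shows "b (cls (SL2 q) x, n) = evw (\<lambda>u. b (slw q u, n)) x" and "qfun q (\<lambda>u. b (slw q u, n))"
  by (rule functional_SL2_eq[of "\<lambda>X. b (X, n)"] functional_SL2_qfun[of "\<lambda>X. b (X, n)"];
      use n in \<open>simp add: balancedD[OF b] flip: add_SL2 smult_SL2\<close>)+

lemma biqfun_balancedC_SL2:
  assumes b: "balancedC (SL2 q) (SL2 q) b"
  shows "biqfun q (\<lambda>u v. b (slw q u, slw q v))"
proof -
  have "qfun q (\<lambda>v. b (slw q u, slw q v))" for u
    by (rule functional_SL2_qfun[of "\<lambda>X. b (slw q u, X)"]; simp add: balancedD[OF b] flip: add_SL2 smult_SL2)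
  then show ?thesis
    using balancedC_SL2_qfun(2)[OF b] by (simp add: biqfun_def)
qed

definition coprod_terms :: "(gen list \<Rightarrow> gen list \<Rightarrow> 'a) \<Rightarrow> gen list \<Rightarrow> ('a \<Rightarrow>\<^sub>0 complex)" where
  "coprod_terms f w = (\<Sum>(u, v)\<leftarrow>coprod_word w. pt (f u v))"

lemma ev_coprod_terms [simp]: "ev b (coprod_terms f w) = copsum (\<lambda>u v. b (f u v)) w"
  by (simp add: coprod_terms_def copsum_def comp_def case_prod_unfold)

lemma keys_coprod_terms:
  assumes "\<And>u v. deg (Word v) = deg (Word w) \<Longrightarrow> f u v \<in> A"
  shows "Poly_Mapping.keys (coprod_terms f w) \<subseteq> A"
proof -
  have "deg (Word (snd p)) = deg (Word w)" if "p \<in> set (coprod_word w)" for p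
    using that
  proof (induction w arbitrary: p)
    case (Cons g w)
    then show ?case by (cases g) auto
  qed simp
  then show ?thesis
    unfolding coprod_terms_def by (intro keys_subset_sum_list) (auto intro!: assms)
qed

lemma coprod_cls:
  assumes q: "q \<noteq> 0"
  shows "coprod q (cls (SL2 q) x)
    = cls (tensorC (SL2 q) (SL2 q)) (lext (\<lambda>w. coprod_terms (\<lambda>u v. (slw q u, slw q v)) (letters w)) x)"
    (is "_ = cls ?T (lext ?D x)")
proof -
  interpret T: quotient_space "carrier (SL2 q) \<times> carrier (SL2 q)" "relsC (SL2 q) (SL2 q)" ?T
    by (rule quotient_space_SL2_SL2)
  have k: "Poly_Mapping.keys (?D w) \<subseteq> carrier (SL2 q) \<times> carrier (SL2 q)" for w
    by (rule keys_coprod_terms) simp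
  have 1: "coprod q = descend (\<lambda>x. cls ?T (lext ?D x))"
    unfolding coprod_def coprod_terms_def[symmetric]
    by (intro arg_cong[of _ _ descend] ext T.lin_ext_cls refl) (rule k)
  show ?thesis
    unfolding 1
  proof (rule descend_SL2)
    fix r assume r: "cls (SL2 q) r = cls (SL2 q) x"
    show "cls ?T (lext ?D r) = cls ?T (lext ?D x)"
      unfolding cls_eq_balanced[OF T.quotient_space_axioms]
    proof (intro allI impI)
      fix b assume "balancedC (SL2 q) (SL2 q) b"
      from ev_eq_of_cls_SL2_eq[OF r qfun_copsum[OF biqfun_balancedC_SL2[OF this] q]]
      show "ev b (lext ?D r) = ev b (lext ?D x)" by simp
    qed
  qed
qed

subsection \<open>Coaction on one-forms\<close>

lemma
  shows carrier_Om_S2: "carrier (Om_S2 q) = Om_S2_set q"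
    and add_Om_S2: "\<omega> \<oplus>\<^bsub>Om_S2 q\<^esub> \<eta> = \<omega> \<oplus>\<^bsub>Om_SL2 q\<^esub> \<eta>"
    and smult_Om_S2: "z \<odot>\<^bsub>Om_S2 q\<^esub> \<omega> = z \<odot>\<^bsub>Om_SL2 q\<^esub> \<omega>"
  by (simp_all add: Om_S2_def)

lemma Om_S2_closed:
  assumes "q \<noteq> 0"
  shows "\<omega> \<in> carrier (Om_S2 q) \<Longrightarrow> \<eta> \<in> carrier (Om_S2 q) \<Longrightarrow> \<omega> \<oplus>\<^bsub>Om_S2 q\<^esub> \<eta> \<in> carrier (Om_S2 q)"
    and "\<omega> \<in> carrier (Om_S2 q) \<Longrightarrow> z \<odot>\<^bsub>Om_S2 q\<^esub> \<omega> \<in> carrier (Om_S2 q)"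
    and "\<omega> \<in> carrier (Om_S2 q) \<Longrightarrow> r \<in> S2 q \<Longrightarrow> lact q r \<omega> \<in> carrier (Om_S2 q)"
    and "\<omega> \<in> carrier (Om_S2 q) \<Longrightarrow> r \<in> S2 q \<Longrightarrow> ract q \<omega> r \<in> carrier (Om_S2 q)"
  by (simp_all add: carrier_Om_S2 add_Om_S2 smult_Om_S2 Om_S2_set.add Om_S2_smult assms
      Om_S2_set.left Om_S2_set.right)

lemma quotient_space_SL2_Om_S2:
  assumes "q \<noteq> 0"
  shows "quotient_space (carrier (SL2 q) \<times> carrier (Om_S2 q)) (relsC (SL2 q) (Om_S2 q)) (tensorC (SL2 q) (Om_S2 q))"
  unfolding tensorC_def by (rule quotient_space_tensor) (simp_all add: SL2_closed Om_S2_closed assms)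

lemma quotient_space_Om_Om:
  assumes "q \<noteq> 0"
  shows "quotient_space (carrier (Om_S2 q) \<times> carrier (Om_S2 q))
    (tensor_rels (Om_S2 q) (Om_S2 q) (S2 q) (ract q) (lact q)) (Om_Om q)"
  unfolding Om_Om_def by (rule quotient_space_tensor) (simp_all add: Om_S2_closed assms)

lemma quotient_space_SL2_Om_Om:
  assumes "q \<noteq> 0"
  shows "quotient_space (carrier (SL2 q) \<times> carrier (Om_Om q)) (relsC (SL2 q) (Om_Om q)) (tensorC (SL2 q) (Om_Om q))"
proof -
  interpret T: quotient_space "carrier (Om_S2 q) \<times> carrier (Om_S2 q)"
    "tensor_rels (Om_S2 q) (Om_S2 q) (S2 q) (ract q) (lact q)" "Om_Om q"
    by (rule quotient_space_Om_Om[OF assms])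
  have "z \<odot>\<^bsub>Om_Om q\<^esub> n \<in> carrier (Om_Om q)" if "n \<in> carrier (Om_Om q)" for z n
  proof -
    obtain p where "Poly_Mapping.keys p \<subseteq> carrier (Om_S2 q) \<times> carrier (Om_S2 q)" "n = cls (Om_Om q) p"
      using \<open>n \<in> carrier (Om_Om q)\<close> unfolding T.carrier_T by blast
    then show ?thesis
      by (simp add: T.smult_cls T.cls_in_carrier keys_subset_scale)
  qed
  then show ?thesis
    unfolding tensorC_def by (intro quotient_space_tensor) (simp_all add: SL2_closed T.a_closed)
qed

text \<open>For \<open>s\<close> one of \<open>Ep\<close>, \<open>Em\<close>, the functional \<open>b (x, -)\<close> on \<open>Om_S2 q\<close> is pulled back to all of
  \<open>SL2 q\<close> along the degree projection.  This makes the coaction independent of the representative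
  of the coproduct, and turns \<open>b\<close> into a functional of two words.\<close>

definition ep :: "complex \<Rightarrow> form \<Rightarrow> nc set \<Rightarrow> (form \<Rightarrow> nc set)" where
  "ep q s f = ef q s (prj_deg q (form_deg s) f)"

lemma ep_eq_ef: "f \<in> SL2_deg q (form_deg s) \<Longrightarrow> ep q s f = ef q s f"
  by (simp add: ep_def prj_deg_id)

lemma ep_slw: "deg (Word w) = form_deg s \<Longrightarrow> ep q s (slw q w) = ef q s (slw q w)"
  by (simp add: ep_eq_ef cls_in_SL2_deg)

lemma ef_in_Om_S2':
  "q \<noteq> 0 \<Longrightarrow> s \<noteq> E0 \<Longrightarrow> f \<in> SL2_deg q (form_deg s) \<Longrightarrow> ef q s f \<in> carrier (Om_S2 q)"
  unfolding carrier_Om_S2 using ef_in_Om_S2 by (cases s) auto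

lemma ep_in_Om_S2: "q \<noteq> 0 \<Longrightarrow> s \<noteq> E0 \<Longrightarrow> f \<in> carrier (SL2 q) \<Longrightarrow> ep q s f \<in> carrier (Om_S2 q)"
  unfolding ep_def by (intro ef_in_Om_S2' prj_deg_in_SL2_deg)

lemma ep_add:
  assumes "f \<in> carrier (SL2 q)" "g \<in> carrier (SL2 q)"
  shows "ep q s (f \<oplus>\<^bsub>SL2 q\<^esub> g) = ep q s f \<oplus>\<^bsub>Om_S2 q\<^esub> ep q s g"
  using assms by (auto simp: ep_def add_Om_S2 carrier_SL2 add_SL2 prj_deg_cls lext_add ef_add)

lemma ep_smult: "f \<in> carrier (SL2 q) \<Longrightarrow> ep q s (z \<odot>\<^bsub>SL2 q\<^esub> f) = z \<odot>\<^bsub>Om_S2 q\<^esub> ep q s f"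
  by (auto simp: ep_def smult_Om_S2 carrier_SL2 smult_SL2 prj_deg_cls lext_scale ef_smult)

lemma balancedC_ep:
  assumes b: "balancedC (SL2 q) (Om_S2 q) b" and s: "q \<noteq> 0" "s \<noteq> E0"
  shows "balancedC (SL2 q) (SL2 q) (\<lambda>(x, f). b (x, ep q s f))"
  by (rule balancedCI; simp add: balancedD[OF b] ep_add ep_smult ep_in_Om_S2[OF s])

text \<open>An explicit representative of Delta_L(x e^s). For x homogeneous of degree
  \<open>form_deg s\<close> its terms lie in the carriers (\<open>keys_coact\<close>).\<close>

definition coact :: "complex \<Rightarrow> form \<Rightarrow> nc \<Rightarrow> (nc set \<times> (form \<Rightarrow> nc set) \<Rightarrow>\<^sub>0 complex)" where
  "coact q s = lext (\<lambda>w. coprod_terms (\<lambda>u v. (slw q u, ef q s (slw q v))) (letters w))"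

lemma keys_coact:
  assumes "q \<noteq> 0" "s \<noteq> E0" "homog (form_deg s) x"
  shows "Poly_Mapping.keys (coact q s x) \<subseteq> carrier (SL2 q) \<times> carrier (Om_S2 q)"
  unfolding coact_def
proof (intro keys_subset_lext keys_coprod_terms)
  fix w u v assume "w \<in> Poly_Mapping.keys x" "deg (Word v) = deg (Word (letters w))"
  with assms(3) have "deg (Word v) = form_deg s" by (simp add: homog_def)
  then show "(slw q u, ef q s (slw q v)) \<in> carrier (SL2 q) \<times> carrier (Om_S2 q)"
    using assms by (simp add: ef_in_Om_S2' cls_in_SL2_deg)
qed

text \<open>Second legs keep the degree of x, where \<open>ef\<close> and \<open>ep\<close> agree.
  With \<open>ep\<close> the summand makes sense for all pairs of words.\<close>

lemma ev_coact:
  assumes "homog (form_deg s) x"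
  shows "ev b (coact q s x) = evw (copsum (\<lambda>u v. b (slw q u, ep q s (slw q v)))) x"
  unfolding coact_def ev_lext ev_coprod_terms
  by (intro ev_cong copsum_cong) (use assms in \<open>simp add: homog_def ep_slw\<close>)

text \<open>The support condition allows \<open>ef\<close> to be replaced by \<open>ep\<close> on
  \<open>t\<close>. The resulting functional is balanced on the full tensor square of C_q[SL_2],
  hence takes the same value on every representative of the coproduct, in particular on the explicit
  one.\<close>

lemma free_map_coprod:
  assumes q: "q \<noteq> 0" and s: "s \<noteq> E0" and x: "homog (form_deg s) x"
    and t: "t \<in> coprod q (cls (SL2 q) x)" "Poly_Mapping.keys t \<subseteq> carrier (SL2 q) \<times> SL2_deg q (form_deg s)"
  shows "cls (tensorC (SL2 q) (Om_S2 q)) (free_map (\<lambda>(x, f). (x, ef q s f)) t)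
    = cls (tensorC (SL2 q) (Om_S2 q)) (coact q s x)"
  unfolding cls_eq_balanced[OF quotient_space_SL2_Om_S2[OF q]]
proof (intro allI impI)
  fix b assume b: "balancedC (SL2 q) (Om_S2 q) b"
  interpret T: quotient_space "carrier (SL2 q) \<times> carrier (SL2 q)" "relsC (SL2 q) (SL2 q)"
      "tensorC (SL2 q) (SL2 q)"
    by (rule quotient_space_SL2_SL2)
  have "ev b (free_map (\<lambda>(x, f). (x, ef q s f)) t) = ev (\<lambda>(x, f). b (x, ep q s f)) t"
    unfolding free_map_lext ev_lext
    by (rule ev_cong) (use t(2) in \<open>auto simp: ep_eq_ef\<close>)
  also have "\<dots> = ev (\<lambda>(x, f). b (x, ep q s f))
      (lext (\<lambda>w. coprod_terms (\<lambda>u v. (slw q u, slw q v)) (letters w)) x)"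
    using t(1) balancedC_ep[OF b q s]
    unfolding coprod_cls[OF q] T.mem_cls_iff cls_eq_balanced[OF T.quotient_space_axioms] by blast
  also have "\<dots> = ev b (coact q s x)"
    by (simp add: ev_coact[OF x])
  finally show "ev b (free_map (\<lambda>(x, f). (x, ef q s f)) t) = ev b (coact q s x)" .
qed

lemma coprod_homog:
  assumes q: "q \<noteq> 0" and x: "homog n x"
  obtains t where "t \<in> coprod q (cls (SL2 q) x)" "Poly_Mapping.keys t \<subseteq> carrier (SL2 q) \<times> SL2_deg q n"
proof
  let ?t = "lext (\<lambda>w. coprod_terms (\<lambda>u v. (slw q u, slw q v)) (letters w)) x"
  show "?t \<in> coprod q (cls (SL2 q) x)"
    unfolding coprod_cls[OF q] by (rule quotient_space.mem_cls_self[OF quotient_space_SL2_SL2])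
  show "Poly_Mapping.keys ?t \<subseteq> carrier (SL2 q) \<times> SL2_deg q n"
    by (intro keys_subset_lext keys_coprod_terms) (use x in \<open>simp add: homog_def cls_in_SL2_deg\<close>)
qed

text \<open>The set under \<open>the_elem\<close> is nonempty by \<open>coprod_homog\<close> and has
  a single element by \<open>free_map_coprod\<close>.\<close>

lemma coaction_eq:
  assumes q: "q \<noteq> 0" and x: "homog (-2) x" "\<omega> Ep = cls (SL2 q) x" and y: "homog 2 y" "\<omega> Em = cls (SL2 q) y"
  shows "coaction q \<omega> = cls (tensorC (SL2 q) (Om_S2 q)) (coact q Ep x + coact q Em y)"
proof -
  interpret T: quotient_space "carrier (SL2 q) \<times> carrier (Om_S2 q)" "relsC (SL2 q) (Om_S2 q)"
      "tensorC (SL2 q) (Om_S2 q)"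
    by (rule quotient_space_SL2_Om_S2[OF q])
  let ?X = "{cls (tensorC (SL2 q) (Om_S2 q))
        (free_map (\<lambda>(x, f). (x, ef q Ep f)) s + free_map (\<lambda>(x, f). (x, ef q Em f)) t) | s t.
      s \<in> coprod q (\<omega> Ep) \<and> Poly_Mapping.keys s \<subseteq> carrier (SL2 q) \<times> SL2_deg q (-2) \<and>
      t \<in> coprod q (\<omega> Em) \<and> Poly_Mapping.keys t \<subseteq> carrier (SL2 q) \<times> SL2_deg q 2}"
  have "cls (tensorC (SL2 q) (Om_S2 q))
        (free_map (\<lambda>(x, f). (x, ef q Ep f)) s + free_map (\<lambda>(x, f). (x, ef q Em f)) t)
      = cls (tensorC (SL2 q) (Om_S2 q)) (coact q Ep x + coact q Em y)"
    if "s \<in> coprod q (\<omega> Ep)" "Poly_Mapping.keys s \<subseteq> carrier (SL2 q) \<times> SL2_deg q (-2)"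
      "t \<in> coprod q (\<omega> Em)" "Poly_Mapping.keys t \<subseteq> carrier (SL2 q) \<times> SL2_deg q 2" for s t
    using free_map_coprod[OF q, of Ep x s] free_map_coprod[OF q, of Em y t] that x y
    by (simp flip: T.add_cls)
  moreover obtain s where "s \<in> coprod q (\<omega> Ep)" "Poly_Mapping.keys s \<subseteq> carrier (SL2 q) \<times> SL2_deg q (-2)"
    using coprod_homog[OF q x(1)] x(2) by metis
  moreover obtain t where "t \<in> coprod q (\<omega> Em)" "Poly_Mapping.keys t \<subseteq> carrier (SL2 q) \<times> SL2_deg q 2"
    using coprod_homog[OF q y(1)] y(2) by metis
  ultimately have "?X = {cls (tensorC (SL2 q) (Om_S2 q)) (coact q Ep x + coact q Em y)}"
    by blast
  then show ?thesis
    unfolding coaction_def ef_def by simp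
qed

lemma Om_S2_components:
  assumes "q \<noteq> 0" "\<omega> \<in> carrier (Om_S2 q)"
  obtains x y where "homog (-2) x" "\<omega> Ep = cls (SL2 q) x" "homog 2 y" "\<omega> Em = cls (SL2 q) y"
proof -
  have "\<omega> Ep \<in> SL2_deg q (-2)" "\<omega> Em \<in> SL2_deg q 2"
    using Om_S2_set_deg[OF assms(1), of \<omega> Ep] Om_S2_set_deg[OF assms(1), of \<omega> Em] assms(2)
    by (simp_all add: carrier_Om_S2)
  then show ?thesis using that by (elim SL2_degE)
qed

subsection \<open>Coaction on the tensor square\<close>

definition pair_prod :: "complex \<Rightarrow> (nc set \<times> (form \<Rightarrow> nc set) \<Rightarrow>\<^sub>0 complex)
    \<Rightarrow> (nc set \<times> (form \<Rightarrow> nc set) \<Rightarrow>\<^sub>0 complex) \<Rightarrow> (nc set \<times> ten \<Rightarrow>\<^sub>0 complex)" where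
  "pair_prod q s t = (\<Sum>(x, \<mu>)\<in>Poly_Mapping.keys s. \<Sum>(y, \<nu>)\<in>Poly_Mapping.keys t.
     scale (Poly_Mapping.lookup s (x, \<mu>) * Poly_Mapping.lookup t (y, \<nu>))
       (pt (x \<otimes>\<^bsub>SL2 q\<^esub> y, ot q \<mu> \<nu>)))"

lemma ev_pair_prod:
  "ev b (pair_prod q s t) = ev (\<lambda>(x, \<mu>). ev (\<lambda>(y, \<nu>). b (x \<otimes>\<^bsub>SL2 q\<^esub> y, ot q \<mu> \<nu>)) t) s"
  by (simp add: pair_prod_def case_prod_unfold) (simp add: ev_def sum_distrib_left mult.assoc case_prod_unfold)

context
  fixes q :: complex
  assumes q: "q \<noteq> 0"
begin

interpretation OO: quotient_space "carrier (Om_S2 q) \<times> carrier (Om_S2 q)"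
    "tensor_rels (Om_S2 q) (Om_S2 q) (S2 q) (ract q) (lact q)" "Om_Om q"
  by (rule quotient_space_Om_Om[OF q])

interpretation SO: quotient_space "carrier (SL2 q) \<times> carrier (Om_S2 q)"
    "relsC (SL2 q) (Om_S2 q)" "tensorC (SL2 q) (Om_S2 q)"
  by (rule quotient_space_SL2_Om_S2[OF q])

interpretation SOO: quotient_space "carrier (SL2 q) \<times> carrier (Om_Om q)"
    "relsC (SL2 q) (Om_Om q)" "tensorC (SL2 q) (Om_Om q)"
  by (rule quotient_space_SL2_Om_Om[OF q])

lemma ot_in_carrier: "\<omega> \<in> carrier (Om_S2 q) \<Longrightarrow> \<eta> \<in> carrier (Om_S2 q) \<Longrightarrow> ot q \<omega> \<eta> \<in> carrier (Om_Om q)"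
  by (simp add: OO.cls_in_carrier)

lemma
  assumes "\<omega> \<in> carrier (Om_S2 q)" "\<eta> \<in> carrier (Om_S2 q)"
  shows ot_add_left: "\<omega>' \<in> carrier (Om_S2 q) \<Longrightarrow> ot q (\<omega> \<oplus>\<^bsub>Om_S2 q\<^esub> \<omega>') \<eta> = ot q \<omega> \<eta> \<oplus>\<^bsub>Om_Om q\<^esub> ot q \<omega>' \<eta>"
    and ot_add_right: "\<eta>' \<in> carrier (Om_S2 q) \<Longrightarrow> ot q \<omega> (\<eta> \<oplus>\<^bsub>Om_S2 q\<^esub> \<eta>') = ot q \<omega> \<eta> \<oplus>\<^bsub>Om_Om q\<^esub> ot q \<omega> \<eta>'"
    and ot_smult_left: "ot q (z \<odot>\<^bsub>Om_S2 q\<^esub> \<omega>) \<eta> = z \<odot>\<^bsub>Om_Om q\<^esub> ot q \<omega> \<eta>"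
    and ot_smult_right: "ot q \<omega> (z \<odot>\<^bsub>Om_S2 q\<^esub> \<eta>) = z \<odot>\<^bsub>Om_Om q\<^esub> ot q \<omega> \<eta>"
    and ot_balanced: "r \<in> S2 q \<Longrightarrow> ot q (ract q \<omega> r) \<eta> = ot q \<omega> (lact q r \<eta>)"
  using assms
  by (simp_all add: OO.add_cls OO.smult_cls cls_eq_balanced[OF OO.quotient_space_axioms] balancedD)

lemma mult_SL2_bilinear:
  assumes "x \<in> carrier (SL2 q)" "y \<in> carrier (SL2 q)"
  shows "x' \<in> carrier (SL2 q) \<Longrightarrow> (x \<oplus>\<^bsub>SL2 q\<^esub> x') \<otimes>\<^bsub>SL2 q\<^esub> y = x \<otimes>\<^bsub>SL2 q\<^esub> y \<oplus>\<^bsub>SL2 q\<^esub> x' \<otimes>\<^bsub>SL2 q\<^esub> y"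
    and "y' \<in> carrier (SL2 q) \<Longrightarrow> x \<otimes>\<^bsub>SL2 q\<^esub> (y \<oplus>\<^bsub>SL2 q\<^esub> y') = x \<otimes>\<^bsub>SL2 q\<^esub> y \<oplus>\<^bsub>SL2 q\<^esub> x \<otimes>\<^bsub>SL2 q\<^esub> y'"
    and "(z \<odot>\<^bsub>SL2 q\<^esub> x) \<otimes>\<^bsub>SL2 q\<^esub> y = z \<odot>\<^bsub>SL2 q\<^esub> (x \<otimes>\<^bsub>SL2 q\<^esub> y)"
    and "x \<otimes>\<^bsub>SL2 q\<^esub> (z \<odot>\<^bsub>SL2 q\<^esub> y) = z \<odot>\<^bsub>SL2 q\<^esub> (x \<otimes>\<^bsub>SL2 q\<^esub> y)"
  using assms
  by (auto simp: carrier_SL2 mult_SL2 add_SL2 smult_SL2 distrib_left distrib_right mult_scale_left mult_scale_right)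

lemma balancedC_pair:
  assumes b: "balancedC (SL2 q) (Om_Om q) b" and k: "x \<in> carrier (SL2 q)" "\<mu> \<in> carrier (Om_S2 q)"
  shows "balancedC (SL2 q) (Om_S2 q) (\<lambda>(y, \<nu>). b (x \<otimes>\<^bsub>SL2 q\<^esub> y, ot q \<mu> \<nu>))"
    and "balancedC (SL2 q) (Om_S2 q) (\<lambda>(y, \<nu>). b (y \<otimes>\<^bsub>SL2 q\<^esub> x, ot q \<nu> \<mu>))"
  using k by (auto intro!: balancedCI simp: mult_SL2_bilinear SL2_closed ot_add_left ot_add_right ot_smult_left
      ot_smult_right ot_in_carrier balancedD[OF b])

lemma keys_pair_prod:
  assumes "Poly_Mapping.keys s \<subseteq> carrier (SL2 q) \<times> carrier (Om_S2 q)"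
    "Poly_Mapping.keys t \<subseteq> carrier (SL2 q) \<times> carrier (Om_S2 q)"
  shows "Poly_Mapping.keys (pair_prod q s t) \<subseteq> carrier (SL2 q) \<times> carrier (Om_Om q)"
  unfolding pair_prod_def case_prod_unfold
proof (intro keys_subset_sum keys_subset_scale)
  fix i j assume "i \<in> Poly_Mapping.keys s" "j \<in> Poly_Mapping.keys t"
  then have "i \<in> carrier (SL2 q) \<times> carrier (Om_S2 q)" "j \<in> carrier (SL2 q) \<times> carrier (Om_S2 q)"
    using assms by blast+
  then show "Poly_Mapping.keys (pt (fst i \<otimes>\<^bsub>SL2 q\<^esub> fst j, ot q (snd i) (snd j)))
      \<subseteq> carrier (SL2 q) \<times> carrier (Om_Om q)"
    by (auto simp: SL2_closed ot_in_carrier)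
qed

text \<open>One factor is replaced at a time: with a term of \<open>s\<close> fixed the functional
  is balanced in \<open>t\<close>; after exchanging the sums it is balanced in \<open>s\<close> with
  a term of \<open>t'\<close> fixed. Hence the support conditions on \<open>s\<close> and
  \<open>t'\<close>, the factors held fixed.\<close>

lemma ev_pair_prod_cong:
  assumes b: "balancedC (SL2 q) (Om_Om q) b"
    and s: "cls (tensorC (SL2 q) (Om_S2 q)) s = cls (tensorC (SL2 q) (Om_S2 q)) s'"
      "Poly_Mapping.keys s \<subseteq> carrier (SL2 q) \<times> carrier (Om_S2 q)"
    and t: "cls (tensorC (SL2 q) (Om_S2 q)) t = cls (tensorC (SL2 q) (Om_S2 q)) t'"
      "Poly_Mapping.keys t' \<subseteq> carrier (SL2 q) \<times> carrier (Om_S2 q)"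
  shows "ev b (pair_prod q s t) = ev b (pair_prod q s' t')"
proof -
  note eqD = cls_eq_balanced[OF SO.quotient_space_axioms, THEN iffD1, rule_format]
  have "ev b (pair_prod q s t) = ev b (pair_prod q s t')"
    unfolding ev_pair_prod
    by (rule ev_cong) (use s(2) in \<open>auto intro!: eqD[OF t(1)] balancedC_pair(1)[OF b]\<close>)
  also have "\<dots> = ev (\<lambda>l. ev (\<lambda>k. b (fst k \<otimes>\<^bsub>SL2 q\<^esub> fst l, ot q (snd k) (snd l))) s) t'"
    unfolding ev_pair_prod case_prod_unfold by (rule ev_swap)
  also have "\<dots> = ev (\<lambda>l. ev (\<lambda>k. b (fst k \<otimes>\<^bsub>SL2 q\<^esub> fst l, ot q (snd k) (snd l))) s') t'"
    by (rule ev_cong) (use t(2) in \<open>auto intro!: eqD[OF s(1)] balancedC_pair(2)[OF b, unfolded case_prod_unfold]\<close>)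
  also have "\<dots> = ev b (pair_prod q s' t')"
    unfolding ev_pair_prod case_prod_unfold by (rule ev_swap)
  finally show ?thesis .
qed

lemma coaction_pair_eq:
  assumes s: "coaction q \<omega> = cls (tensorC (SL2 q) (Om_S2 q)) s"
      "Poly_Mapping.keys s \<subseteq> carrier (SL2 q) \<times> carrier (Om_S2 q)"
    and t: "coaction q \<eta> = cls (tensorC (SL2 q) (Om_S2 q)) t"
      "Poly_Mapping.keys t \<subseteq> carrier (SL2 q) \<times> carrier (Om_S2 q)"
  shows "coaction_pair q (\<omega>, \<eta>) = cls (tensorC (SL2 q) (Om_Om q)) (pair_prod q s t)"
proof -
  have "cls (tensorC (SL2 q) (Om_Om q)) (pair_prod q s' t') = cls (tensorC (SL2 q) (Om_Om q)) (pair_prod q s t)"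
    if "s' \<in> coaction q \<omega>" "t' \<in> coaction q \<eta>" for s' t'
    unfolding cls_eq_balanced[OF SOO.quotient_space_axioms]
    using that s t SO.keys_mem_cls[OF s(2)]
    by (intro allI impI ev_pair_prod_cong) (simp_all add: SO.mem_cls_iff)
  moreover have "s \<in> coaction q \<omega>" "t \<in> coaction q \<eta>"
    by (simp_all add: s(1) t(1) SO.mem_cls_self)
  ultimately have "{cls (tensorC (SL2 q) (Om_Om q)) (pair_prod q s t) | s t. s \<in> coaction q \<omega> \<and> t \<in> coaction q \<eta>}
      = {cls (tensorC (SL2 q) (Om_Om q)) (pair_prod q s t)}"
    by blast
  then show ?thesis
    by (simp add: coaction_pair_def pair_prod_def)
qed

end

lemma pair_prod_add_left: "pair_prod q (s + s') t = pair_prod q s t + pair_prod q s' t"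
  by (rule ev_ext) (simp add: ev_pair_prod)

lemma pair_prod_add_right: "pair_prod q s (t + t') = pair_prod q s t + pair_prod q s t'"
  by (rule ev_ext) (simp add: ev_pair_prod case_prod_unfold ev_add_fun)

lemma pair_prod_scale_left: "pair_prod q (scale z s) t = scale z (pair_prod q s t)"
  by (rule ev_ext) (simp add: ev_pair_prod)

lemma pair_prod_scale_right: "pair_prod q s (scale z t) = scale z (pair_prod q s t)"
  by (rule ev_ext) (simp add: ev_pair_prod case_prod_unfold ev_mult_fun)

lemma coact_add: "coact q s (x + y) = coact q s x + coact q s y"
  by (simp add: coact_def lext_add)

lemma coact_scale: "coact q s (scale z x) = scale z (coact q s x)"
  by (simp add: coact_def lext_scale)

lemma ract_ef_0: "homog 0 z \<Longrightarrow> ract q (ef q s (cls (SL2 q) x)) (cls (SL2 q) z) = ef q s (cls (SL2 q) (x * z))"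
  by (simp add: ef_cls ract_homog) (intro arg_cong[of _ _ "fm q"] ext, simp)

text \<open>The coaction of a form is only a class, whereas linear extension over pairs of forms by
  \<open>lext\<close> needs one formal sum per form; hence the choice.\<close>

definition coact_rep :: "complex \<Rightarrow> (form \<Rightarrow> nc set) \<Rightarrow> (nc set \<times> (form \<Rightarrow> nc set) \<Rightarrow>\<^sub>0 complex)" where
  "coact_rep q \<omega> = (SOME r. \<exists>x y. homog (-2) x \<and> \<omega> Ep = cls (SL2 q) x \<and> homog 2 y \<and> \<omega> Em = cls (SL2 q) y \<and>
     r = coact q Ep x + coact q Em y)"

text \<open>The pullback of \<open>b\<close> along the coaction on simple tensors. Once it is known
  to be balanced, the coaction descends to the tensor product over the sphere algebra.\<close>

definition pairing :: "complex \<Rightarrow> (nc set \<times> ten \<Rightarrow> complex) \<Rightarrow> (form \<Rightarrow> nc set) \<times> (form \<Rightarrow> nc set) \<Rightarrow> complex" where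
  "pairing q b = (\<lambda>(\<omega>, \<eta>). ev b (pair_prod q (coact_rep q \<omega>) (coact_rep q \<eta>)))"

context
  fixes q :: complex
  assumes q: "q \<noteq> 0"
begin

interpretation OO: quotient_space "carrier (Om_S2 q) \<times> carrier (Om_S2 q)"
    "tensor_rels (Om_S2 q) (Om_S2 q) (S2 q) (ract q) (lact q)" "Om_Om q"
  by (rule quotient_space_Om_Om[OF q])

interpretation SO: quotient_space "carrier (SL2 q) \<times> carrier (Om_S2 q)"
    "relsC (SL2 q) (Om_S2 q)" "tensorC (SL2 q) (Om_S2 q)"
  by (rule quotient_space_SL2_Om_S2[OF q])

interpretation SOO: quotient_space "carrier (SL2 q) \<times> carrier (Om_Om q)"
    "relsC (SL2 q) (Om_Om q)" "tensorC (SL2 q) (Om_Om q)"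
  by (rule quotient_space_SL2_Om_Om[OF q])

lemma coaction_coact_rep:
  assumes "\<omega> \<in> carrier (Om_S2 q)"
  shows "coaction q \<omega> = cls (tensorC (SL2 q) (Om_S2 q)) (coact_rep q \<omega>)"
    and "Poly_Mapping.keys (coact_rep q \<omega>) \<subseteq> carrier (SL2 q) \<times> carrier (Om_S2 q)"
proof -
  have "\<exists>r x y. homog (-2) x \<and> \<omega> Ep = cls (SL2 q) x \<and> homog 2 y \<and> \<omega> Em = cls (SL2 q) y \<and>
     r = coact q Ep x + coact q Em y"
    using Om_S2_components[OF q assms] by metis
  from someI_ex[OF this, folded coact_rep_def] obtain x y where
    xy: "homog (-2) x" "\<omega> Ep = cls (SL2 q) x" "homog 2 y" "\<omega> Em = cls (SL2 q) y"
      "coact_rep q \<omega> = coact q Ep x + coact q Em y"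
    by blast
  then show "coaction q \<omega> = cls (tensorC (SL2 q) (Om_S2 q)) (coact_rep q \<omega>)"
    using coaction_eq[OF q] by simp
  show "Poly_Mapping.keys (coact_rep q \<omega>) \<subseteq> carrier (SL2 q) \<times> carrier (Om_S2 q)"
    unfolding xy(5) by (intro keys_subset_add keys_coact) (simp_all add: q xy)
qed

lemma pairing_eq:
  assumes b: "balancedC (SL2 q) (Om_Om q) b" and "\<omega> \<in> carrier (Om_S2 q)" "\<eta> \<in> carrier (Om_S2 q)"
    and s: "coaction q \<omega> = cls (tensorC (SL2 q) (Om_S2 q)) s"
    and t: "coaction q \<eta> = cls (tensorC (SL2 q) (Om_S2 q)) t"
      "Poly_Mapping.keys t \<subseteq> carrier (SL2 q) \<times> carrier (Om_S2 q)"
  shows "pairing q b (\<omega>, \<eta>) = ev b (pair_prod q s t)"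
  unfolding pairing_def prod.case
proof (rule ev_pair_prod_cong[OF q b])
  show "cls (tensorC (SL2 q) (Om_S2 q)) (coact_rep q \<omega>) = cls (tensorC (SL2 q) (Om_S2 q)) s"
    using coaction_coact_rep(1)[OF assms(2)] s by simp
  show "cls (tensorC (SL2 q) (Om_S2 q)) (coact_rep q \<eta>) = cls (tensorC (SL2 q) (Om_S2 q)) t"
    using coaction_coact_rep(1)[OF assms(3)] t(1) by simp
qed (rule coaction_coact_rep(2)[OF assms(2)], rule t(2))

lemma pairing_components:
  assumes b: "balancedC (SL2 q) (Om_Om q) b" and "\<omega> \<in> carrier (Om_S2 q)" "\<eta> \<in> carrier (Om_S2 q)"
    and "homog (-2) x" "\<omega> Ep = cls (SL2 q) x" "homog 2 y" "\<omega> Em = cls (SL2 q) y"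
    and "homog (-2) x'" "\<eta> Ep = cls (SL2 q) x'" "homog 2 y'" "\<eta> Em = cls (SL2 q) y'"
  shows "pairing q b (\<omega>, \<eta>) = ev b (pair_prod q (coact q Ep x + coact q Em y) (coact q Ep x' + coact q Em y'))"
proof (rule pairing_eq[OF b assms(2,3) coaction_eq[OF q assms(4-7)] coaction_eq[OF q assms(8-11)]])
  show "Poly_Mapping.keys (coact q Ep x' + coact q Em y') \<subseteq> carrier (SL2 q) \<times> carrier (Om_S2 q)"
    by (intro keys_subset_add keys_coact) (simp_all add: q assms)
qed

text \<open>As the coproduct is multiplicative, both sides have first leg x_(1) z_(1) x'_(1), and
  differ only in whether z_(2) stands to the left or to the right of the tensor sign. Since z_(2)
  has degree 0, it commutes with e^s and may cross.\<close>

lemma ev_pair_prod_balanced: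
  assumes s: "s \<noteq> E0" "s' \<noteq> E0" and x: "homog (form_deg s) x" and z: "homog 0 z" and x': "homog (form_deg s') x'"
  shows "ev b (pair_prod q (coact q s (x * z)) (coact q s' x')) = ev b (pair_prod q (coact q s x) (coact q s' (z * x')))"
proof -
  define K where "K = (\<lambda>u v u' v'. b (slw q u \<otimes>\<^bsub>SL2 q\<^esub> slw q u', ot q (ep q s (slw q v)) (ep q s' (slw q v'))))"
  have xz: "homog (form_deg s) (x * z)" "homog (form_deg s') (z * x')"
    using homog_mult[OF x z] homog_mult[OF z x'] by simp_all
  have K: "K (u1 @ u2) (v1 @ v2) u' v' = K u1 v1 (u2 @ u') (v2 @ v')"
    if "deg (Word v1) = form_deg s" "deg (Word v2) = 0" "deg (Word v') = form_deg s'" for u1 u2 v1 v2 u' v'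
  proof -
    have "ep q s (slw q (v1 @ v2)) = ract q (ef q s (slw q v1)) (slw q v2)"
      using that by (simp add: ep_slw ract_ef_0 pt_mult_pt)
    moreover have "ep q s' (slw q (v2 @ v')) = lact q (slw q v2) (ef q s' (slw q v'))"
      using that by (simp add: ep_slw lact_ef_cls pt_mult_pt)
    moreover have "ef q s (slw q v1) \<in> carrier (Om_S2 q)" "ef q s' (slw q v') \<in> carrier (Om_S2 q)" "slw q v2 \<in> S2 q"
      using that s by (simp_all add: ef_in_Om_S2' q cls_in_SL2_deg)
    ultimately have "ot q (ep q s (slw q (v1 @ v2))) (ep q s' (slw q v')) = ot q (ep q s (slw q v1)) (ep q s' (slw q (v2 @ v')))"
      using that by (simp add: ep_slw ot_balanced[OF q])
    then show ?thesis
      by (simp add: K_def mult_SL2 pt_mult_pt)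
  qed
  have "ev b (pair_prod q (coact q s (x * z)) (coact q s' x'))
      = evw (\<lambda>w. evw (\<lambda>k. copsum (\<lambda>u1 v1. copsum (\<lambda>u2 v2. evw (copsum (K (u1 @ u2) (v1 @ v2))) x') k) w) z) x"
    by (simp add: ev_pair_prod ev_coact xz x' K_def evw_mult copsum_append)
  \<comment> \<open>The exchange holds only for second legs of the right degrees;
    \<open>copsum_cong\<close> supplies these from the homogeneity of x, z and x'.\<close>
  also have "\<dots> = evw (\<lambda>w. evw (\<lambda>k. copsum (\<lambda>u1 v1. copsum (\<lambda>u2 v2. evw (copsum (\<lambda>u' v'. K u1 v1 (u2 @ u') (v2 @ v'))) x') k) w) z) x"
    by (intro ev_cong copsum_cong K) (use x z x' in \<open>auto simp: homog_def\<close>)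
  also have "\<dots> = ev b (pair_prod q (coact q s x) (coact q s' (z * x')))"
    by (simp add: ev_pair_prod ev_coact xz x K_def evw_mult copsum_append copsum_ev)
  finally show ?thesis .
qed

lemma balanced_pairing:
  assumes b: "balancedC (SL2 q) (Om_Om q) b"
  shows "balanced (Om_S2 q) (Om_S2 q) (S2 q) (ract q) (lact q) (pairing q b)"
  unfolding balanced_def
proof (intro conjI ballI allI)
  fix \<omega> \<omega>' \<eta> assume mem: "\<omega> \<in> carrier (Om_S2 q)" "\<omega>' \<in> carrier (Om_S2 q)" "\<eta> \<in> carrier (Om_S2 q)"
  obtain x y where w: "homog (-2) x" "\<omega> Ep = cls (SL2 q) x" "homog 2 y" "\<omega> Em = cls (SL2 q) y"
    using Om_S2_components[OF q mem(1)] by metis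
  obtain x1 y1 where w': "homog (-2) x1" "\<omega>' Ep = cls (SL2 q) x1" "homog 2 y1" "\<omega>' Em = cls (SL2 q) y1"
    using Om_S2_components[OF q mem(2)] by metis
  obtain x2 y2 where n: "homog (-2) x2" "\<eta> Ep = cls (SL2 q) x2" "homog 2 y2" "\<eta> Em = cls (SL2 q) y2"
    using Om_S2_components[OF q mem(3)] by metis
  have sum: "homog (-2) (x + x1)" "(\<omega> \<oplus>\<^bsub>Om_S2 q\<^esub> \<omega>') Ep = cls (SL2 q) (x + x1)"
    "homog 2 (y + y1)" "(\<omega> \<oplus>\<^bsub>Om_S2 q\<^esub> \<omega>') Em = cls (SL2 q) (y + y1)"
    using w w' by (simp_all add: homog_add Om_S2_def Om_SL2_def add_SL2)
  show "pairing q b (\<omega> \<oplus>\<^bsub>Om_S2 q\<^esub> \<omega>', \<eta>) = pairing q b (\<omega>, \<eta>) + pairing q b (\<omega>', \<eta>)"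
    unfolding pairing_components[OF b Om_S2_closed(1)[OF q mem(1,2)] mem(3) sum n]
      pairing_components[OF b mem(1,3) w n] pairing_components[OF b mem(2,3) w' n]
    by (simp add: coact_add pair_prod_add_left pair_prod_add_right)
  show "pairing q b (\<eta>, \<omega> \<oplus>\<^bsub>Om_S2 q\<^esub> \<omega>') = pairing q b (\<eta>, \<omega>) + pairing q b (\<eta>, \<omega>')"
    unfolding pairing_components[OF b mem(3) Om_S2_closed(1)[OF q mem(1,2)] n sum]
      pairing_components[OF b mem(3,1) n w] pairing_components[OF b mem(3,2) n w']
    by (simp add: coact_add pair_prod_add_left pair_prod_add_right)
next
  fix z \<omega> \<eta> assume mem: "\<omega> \<in> carrier (Om_S2 q)" "\<eta> \<in> carrier (Om_S2 q)"
  obtain x y where w: "homog (-2) x" "\<omega> Ep = cls (SL2 q) x" "homog 2 y" "\<omega> Em = cls (SL2 q) y"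
    using Om_S2_components[OF q mem(1)] by metis
  obtain x2 y2 where n: "homog (-2) x2" "\<eta> Ep = cls (SL2 q) x2" "homog 2 y2" "\<eta> Em = cls (SL2 q) y2"
    using Om_S2_components[OF q mem(2)] by metis
  have sm: "homog (-2) (scale z x)" "(z \<odot>\<^bsub>Om_S2 q\<^esub> \<omega>) Ep = cls (SL2 q) (scale z x)"
    "homog 2 (scale z y)" "(z \<odot>\<^bsub>Om_S2 q\<^esub> \<omega>) Em = cls (SL2 q) (scale z y)"
    using w by (simp_all add: homog_scale Om_S2_def Om_SL2_def smult_SL2)
  show "pairing q b (z \<odot>\<^bsub>Om_S2 q\<^esub> \<omega>, \<eta>) = z * pairing q b (\<omega>, \<eta>)"
    unfolding pairing_components[OF b Om_S2_closed(2)[OF q mem(1)] mem(2) sm n] pairing_components[OF b mem w n]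
    by (simp add: coact_scale pair_prod_add_left pair_prod_add_right pair_prod_scale_left distrib_left)
  show "pairing q b (\<eta>, z \<odot>\<^bsub>Om_S2 q\<^esub> \<omega>) = z * pairing q b (\<eta>, \<omega>)"
    unfolding pairing_components[OF b mem(2) Om_S2_closed(2)[OF q mem(1)] n sm] pairing_components[OF b mem(2,1) n w]
    by (simp add: coact_scale pair_prod_add_left pair_prod_add_right pair_prod_scale_right distrib_left)
next
  fix \<omega> r \<eta> assume mem: "\<omega> \<in> carrier (Om_S2 q)" "\<eta> \<in> carrier (Om_S2 q)" and r: "r \<in> S2 q"
  obtain z where z: "homog 0 z" "r = cls (SL2 q) z"
    using r by (rule SL2_degE)
  obtain x y where w: "homog (-2) x" "\<omega> Ep = cls (SL2 q) x" "homog 2 y" "\<omega> Em = cls (SL2 q) y"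
    using Om_S2_components[OF q mem(1)] by metis
  obtain x2 y2 where n: "homog (-2) x2" "\<eta> Ep = cls (SL2 q) x2" "homog 2 y2" "\<eta> Em = cls (SL2 q) y2"
    using Om_S2_components[OF q mem(2)] by metis
  have wr: "homog (-2) (x * z)" "ract q \<omega> r Ep = cls (SL2 q) (x * z)"
    "homog 2 (y * z)" "ract q \<omega> r Em = cls (SL2 q) (y * z)"
    using w r homog_mult[OF w(1) z(1)] homog_mult[OF w(3) z(1)]
    by (simp_all add: ract_def twist_deg_0) (simp_all add: z mult_SL2)
  have rn: "homog (-2) (z * x2)" "lact q r \<eta> Ep = cls (SL2 q) (z * x2)"
    "homog 2 (z * y2)" "lact q r \<eta> Em = cls (SL2 q) (z * y2)"
    using n homog_mult[OF z(1) n(1)] homog_mult[OF z(1) n(3)]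
    by (simp_all add: lact_def z mult_SL2)
  show "pairing q b (ract q \<omega> r, \<eta>) = pairing q b (\<omega>, lact q r \<eta>)"
    unfolding pairing_components[OF b Om_S2_closed(4)[OF q mem(1) r] mem(2) wr n]
      pairing_components[OF b mem(1) Om_S2_closed(3)[OF q mem(2) r] w rn]
    by (simp add: pair_prod_add_left pair_prod_add_right ev_pair_prod_balanced w z(1) n)
qed

text \<open>All representatives of the class are supported in the carrier, so \<open>lin_ext\<close>
  can be computed on each of them, and \<open>balanced_pairing\<close> shows that the results
  agree.\<close>

lemma coaction_ten_cls:
  assumes "Poly_Mapping.keys p \<subseteq> carrier (Om_S2 q) \<times> carrier (Om_S2 q)"
  shows "coaction_ten q (cls (Om_Om q) p) = cls (tensorC (SL2 q) (Om_Om q))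
    (lext (\<lambda>(\<omega>, \<eta>). pair_prod q (coact_rep q \<omega>) (coact_rep q \<eta>)) p)"
proof -
  have 1: "lin_ext (tensorC (SL2 q) (Om_Om q)) (coaction_pair q) r = cls (tensorC (SL2 q) (Om_Om q))
    (lext (\<lambda>(\<omega>, \<eta>). pair_prod q (coact_rep q \<omega>) (coact_rep q \<eta>)) r)"
    if "Poly_Mapping.keys r \<subseteq> carrier (Om_S2 q) \<times> carrier (Om_S2 q)" for r
  proof (rule SOO.lin_ext_cls)
    fix k assume "k \<in> Poly_Mapping.keys r"
    then obtain \<omega> \<eta> where k: "k = (\<omega>, \<eta>)" "\<omega> \<in> carrier (Om_S2 q)" "\<eta> \<in> carrier (Om_S2 q)"
      using \<open>Poly_Mapping.keys r \<subseteq> _\<close> by auto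
    show "coaction_pair q k = cls (tensorC (SL2 q) (Om_Om q))
        (case k of (\<omega>, \<eta>) \<Rightarrow> pair_prod q (coact_rep q \<omega>) (coact_rep q \<eta>))"
      using k by (simp add: coaction_pair_eq[OF q coaction_coact_rep coaction_coact_rep])
    show "Poly_Mapping.keys (case k of (\<omega>, \<eta>) \<Rightarrow> pair_prod q (coact_rep q \<omega>) (coact_rep q \<eta>))
        \<subseteq> carrier (SL2 q) \<times> carrier (Om_Om q)"
      using k by (simp add: keys_pair_prod[OF q] coaction_coact_rep)
  qed
  show ?thesis
    unfolding coaction_ten_def 1[OF assms, symmetric]
  proof (rule descend_cls[OF OO.zero_T])
    fix r assume "r - p \<in> fvs.span (tensor_rels (Om_S2 q) (Om_S2 q) (S2 q) (ract q) (lact q))"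
    then have r: "r \<in> cls (Om_Om q) p" by (simp add: OO.mem_cls_iff_span)
    have "ev (pairing q b) r = ev (pairing q b) p" if "balancedC (SL2 q) (Om_Om q) b" for b
      using r balanced_pairing[OF that]
      unfolding OO.mem_cls_iff cls_eq_balanced[OF OO.quotient_space_axioms] by blast
    then show "lin_ext (tensorC (SL2 q) (Om_Om q)) (coaction_pair q) r = lin_ext (tensorC (SL2 q) (Om_Om q)) (coaction_pair q) p"
      unfolding 1[OF assms] 1[OF OO.keys_mem_cls[OF assms r]] cls_eq_balanced[OF SOO.quotient_space_axioms]
      by (simp add: pairing_def case_prod_unfold)
  qed
qed

end

section \<open>The metric\<close>

definition metric_rep :: "complex \<Rightarrow> ((form \<Rightarrow> nc set) \<times> (form \<Rightarrow> nc set) \<Rightarrow>\<^sub>0 complex)" where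
  "metric_rep q = scale (q\<^sup>2) (pt (dif q (bm q), dif q (bp q))) + pt (dif q (bp q), dif q (bm q))
     - scale (qint2 q) (pt (dif q (b0 q), dif q (b0 q)))"

lemma lact_bas_ef: "lact q (cls (SL2 q) x) (bas q s) = ef q s (cls (SL2 q) x)"
  by (simp add: ef_def)

text \<open>In the two-forms over $\mathbb{C}_q[SL_2]$ one has $(x e^s) \otimes (y e^t) = q^{k_s \deg y} xy\,(e^s \otimes e^t)$,
  which reduces the computation to the coefficients of the $e^s \otimes e^t$.\<close>

lemma wedge_functional:
  assumes c: "\<forall>s\<in>tensor_rels (Om_SL2 q) (Om_SL2 q) (carrier (SL2 q)) (ract q) (lact q) \<union> ext_rels q. ev c s = 0"
  defines "C \<equiv> \<lambda>s t w. c (ef q s (slw q w), bas q t)"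
  shows "qfun q (C s t)"
    and "C Ep Ep w = 0" and "C Em Em w = 0" and "C Em Ep w = - (q\<^sup>2) * C Ep Em w"
    and "homog (-2) x' \<Longrightarrow> homog 2 y' \<Longrightarrow> c (form2 q x y, form2 q x' y') =
      q powi -2 * evw (C Ep Ep) (x * x') + q powi 2 * evw (C Ep Em) (x * y') +
      q powi -2 * evw (C Em Ep) (y * x') + q powi 2 * evw (C Em Em) (y * y')"
proof -
  have b: "balanced (Om_SL2 q) (Om_SL2 q) (carrier (SL2 q)) (ract q) (lact q) c"
    using c by (auto simp flip: ev_tensor_rels_iff)
  note bD = balancedD[OF b]
  have mem: "ef q s (cls (SL2 q) x) \<in> carrier (Om_SL2 q)" "bas q s \<in> carrier (Om_SL2 q)" for s x
    by (simp_all add: ef_cls bas_fm)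
  have a_mem: "ef q s (cls (SL2 q) x) \<oplus>\<^bsub>Om_SL2 q\<^esub> ef q t (cls (SL2 q) y) \<in> carrier (Om_SL2 q)" for s t x y
    by (simp add: ef_cls add_Om_SL2)
  have add: "c (ef q s (cls (SL2 q) (x + y)), bas q t) = c (ef q s (cls (SL2 q) x), bas q t) + c (ef q s (cls (SL2 q) y), bas q t)"
    and smult: "c (ef q s (cls (SL2 q) (scale z x)), bas q t) = z * c (ef q s (cls (SL2 q) x), bas q t)" for x y z s t
    by (simp_all add: bD mem flip: ef_add ef_smult)
  show "qfun q (C s t)"
    unfolding C_def by (rule functional_SL2_qfun[of "\<lambda>X. c (ef q s X, bas q t)"]) (simp_all add: add smult)
  have C: "c (ef q s (cls (SL2 q) x), bas q t) = evw (C s t) x" for s t x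
    unfolding C_def by (rule functional_SL2_eq[of "\<lambda>X. c (ef q s X, bas q t)"]) (simp_all add: add smult)
  have ract_one: "ract q (bas q t) (cls (SL2 q) 1) = bas q t" for t
  proof -
    have "homog 0 1" by (simp add: one_conv_pt)
    from ract_homog[OF this] show ?thesis by (simp add: bas_fm)
  qed
  \<comment> \<open>The exterior relations are used with right multiplier 1; coefficients on the
    right are moved to the left by balancedness in \<open>cef\<close>.\<close>
  let ?ee = "\<lambda>w i j. pt (lact q (slw q w) (bas q i), ract q (bas q j) (cls (SL2 q) 1))"
  have "{?ee w Ep Ep, ?ee w Em Em, scale (q\<^sup>2) (?ee w Ep Em) + ?ee w Em Ep} \<subseteq> ext_rels q" for w
    unfolding ext_rels_def Let_def
    by (rule subset_trans[OF _ UN_upper[OF cls_SL2_in_carrier]], rule subset_trans[OF _ UN_upper[OF cls_SL2_in_carrier]]) blast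
  then have "ev c (?ee w Ep Ep) = 0" "ev c (?ee w Em Em) = 0" "ev c (scale (q\<^sup>2) (?ee w Ep Em) + ?ee w Em Ep) = 0" for w
    using c by blast+
  then show "C Ep Ep w = 0" "C Em Em w = 0" "C Em Ep w = - (q\<^sup>2) * C Ep Em w"
    by (simp_all add: C_def ract_one lact_bas_ef add_eq_0_iff)
  have cef: "c (ef q s (cls (SL2 q) x), ef q t (cls (SL2 q) y)) = q powi (wt s * n) * evw (C s t) (x * y)"
    if "homog n y" for s t x y n
  proof -
    have "c (ef q s (cls (SL2 q) x), ef q t (cls (SL2 q) y)) = c (ract q (ef q s (cls (SL2 q) x)) (cls (SL2 q) y), bas q t)"
      using bD(5)[of "ef q s (cls (SL2 q) x)" "cls (SL2 q) y" "bas q t"] mem by (simp add: lact_bas_ef)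
    also have "ract q (ef q s (cls (SL2 q) x)) (cls (SL2 q) y) = ef q s (cls (SL2 q) (scale (q powi (wt s * n)) (x * y)))"
      unfolding ef_cls ract_homog[OF that] by (intro arg_cong[of _ _ "fm q"] ext) simp
    finally show ?thesis by (simp add: C)
  qed
  show "c (form2 q x y, form2 q x' y') =
      q powi -2 * evw (C Ep Ep) (x * x') + q powi 2 * evw (C Ep Em) (x * y') +
      q powi -2 * evw (C Em Ep) (y * x') + q powi 2 * evw (C Em Em) (y * y')"
    if "homog (-2) x'" "homog 2 y'"
    using that
    by (simp add: form2_split bD mem cef[OF that(1)] cef[OF that(2)] a_mem)
qed

context
  fixes q :: complex
  assumes q: "q \<noteq> 0"
begin

interpretation OO: quotient_space "carrier (Om_S2 q) \<times> carrier (Om_S2 q)"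
    "tensor_rels (Om_S2 q) (Om_S2 q) (S2 q) (ract q) (lact q)" "Om_Om q"
  by (rule quotient_space_Om_Om[OF q])

interpretation SO: quotient_space "carrier (SL2 q) \<times> carrier (Om_S2 q)"
    "relsC (SL2 q) (Om_S2 q)" "tensorC (SL2 q) (Om_S2 q)"
  by (rule quotient_space_SL2_Om_S2[OF q])

interpretation SOO: quotient_space "carrier (SL2 q) \<times> carrier (Om_Om q)"
    "relsC (SL2 q) (Om_Om q)" "tensorC (SL2 q) (Om_Om q)"
  by (rule quotient_space_SL2_Om_Om[OF q])

section \<open>The class of the metric and its q-symmetry\<close>

lemma dif_in_Om_S2: "dif q (bm q) \<in> carrier (Om_S2 q)" "dif q (bp q) \<in> carrier (Om_S2 q)"
    "dif q (b0 q) \<in> carrier (Om_S2 q)"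
  by (simp_all add: carrier_Om_S2 b_in_S2 Om_S2_set.exact)

lemma keys_metric_rep: "Poly_Mapping.keys (metric_rep q) \<subseteq> carrier (Om_S2 q) \<times> carrier (Om_S2 q)"
  unfolding metric_rep_def
  by (intro keys_subset_add keys_subset_diff keys_subset_scale) (simp_all add: dif_in_Om_S2)

lemma metric_cls: "metric q = cls (Om_Om q) (metric_rep q)"
  unfolding metric_def metric_rep_def OO.smult_cls OO.add_cls
  by (intro OO.minus_cls keys_subset_add keys_subset_scale) (simp_all add: dif_in_Om_S2)

lemma metric_in_carrier: "metric q \<in> carrier (Om_Om q)"
  by (simp add: metric_cls OO.cls_in_carrier keys_metric_rep)

lemma wedge_metric: "wedge q (metric q) = \<zero>\<^bsub>Om2_SL2 q\<^esub>"
proof -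
  let ?S = "tensor_rels (Om_SL2 q) (Om_SL2 q) (carrier (SL2 q)) (ract q) (lact q) \<union> ext_rels q"
  have zero: "\<zero>\<^bsub>Om2_SL2 q\<^esub> = fvs.span ?S"
    by (simp add: Om2_SL2_def quot_mod_def)
  \<comment> \<open>The relations on the sphere are among those of the larger calculus, so
    \<open>wedge\<close> sends the class of a formal sum to the class of the same sum.\<close>
  have "tensor_rels (Om_S2 q) (Om_S2 q) (S2 q) (ract q) (lact q)
      \<subseteq> tensor_rels (Om_SL2 q) (Om_SL2 q) (carrier (SL2 q)) (ract q) (lact q)"
    unfolding tensor_rels_def add_Om_S2 smult_Om_S2 carrier_Om_S2
    using Om_S2_set_subset[OF q] SL2_deg_subset_carrier[of q 0]
    by (intro Un_mono) blast+
  then have sub: "tensor_rels (Om_S2 q) (Om_S2 q) (S2 q) (ract q) (lact q) \<subseteq> ?S"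
    by blast
  have "wedge q (metric q) = cls (Om2_SL2 q) (metric_rep q)"
    unfolding wedge_def metric_cls
    by (rule descend_cls[OF OO.zero_T]) (use fvs.span_mono[OF sub] in \<open>auto simp: cls_span_eq_iff[OF zero]\<close>)
  also have "\<dots> = cls (Om2_SL2 q) 0"
    unfolding cls_span_eq_iff[OF zero] span_iff_ev
  proof (intro allI impI)
    fix c assume c: "\<forall>s\<in>?S. ev c s = 0"
    \<comment> \<open>The exterior relations remove the e^+ e^+ and e^- e^- terms and turn e^- e^+
      into e^+ e^-, which leaves an identity for a single \<open>qfun\<close>.\<close>
    note W = wedge_functional[OF c]
    show "ev c (metric_rep q - 0) = 0"
      by (simp add: metric_rep_def dif_b[OF q] W(5) homog_scale W(2-4) mult_scale_left mult_scale_right pt_mult_pt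
          qfun_rewrite[OF W(1) q] power_int_minus q qint2_def)
        (simp add: q field_simps power2_eq_square)
  qed
  finally show ?thesis by (simp add: cls_conv)
qed

section \<open>Components of the metric by type\<close>

lemma balanced_form2:
  assumes b: "balanced (Om_S2 q) (Om_S2 q) (S2 q) (ract q) (lact q) c"
    and x: "homog (-2) x" "homog 2 y" "homog (-2) x'" "homog 2 y'"
  shows "c (form2 q x y, form2 q x' y') =
    c (ef q Ep (cls (SL2 q) x), ef q Ep (cls (SL2 q) x')) + c (ef q Ep (cls (SL2 q) x), ef q Em (cls (SL2 q) y')) +
    c (ef q Em (cls (SL2 q) y), ef q Ep (cls (SL2 q) x')) + c (ef q Em (cls (SL2 q) y), ef q Em (cls (SL2 q) y'))"
proof -
  have mem: "ef q Ep (cls (SL2 q) x) \<in> carrier (Om_S2 q)" "ef q Ep (cls (SL2 q) x') \<in> carrier (Om_S2 q)"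
    "ef q Em (cls (SL2 q) y) \<in> carrier (Om_S2 q)" "ef q Em (cls (SL2 q) y') \<in> carrier (Om_S2 q)"
    by (rule ef_in_Om_S2'[OF q]; simp add: x cls_in_SL2_deg)+
  then show ?thesis
    unfolding form2_split add_Om_S2[symmetric] by (simp add: balancedD[OF b] Om_S2_closed[OF q])
qed

text \<open>Inserting $1$ as a sum of terms \<open>u v\<close> with \<open>w' u\<close> of degree 0 moves \<open>w' u\<close> to the left factor.\<close>

lemma balanced_same_type:
  assumes b: "balanced (Om_S2 q) (Om_S2 q) (S2 q) (ract q) (lact q) c" and s: "s \<noteq> E0"
  obtains M where "qfun q M"
    "\<And>w w'. deg (Word w) = form_deg s \<Longrightarrow> deg (Word w') = form_deg s \<Longrightarrow>
      c (ef q s (slw q w), ef q s (slw q w')) = M (w @ w')"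
proof -
  \<comment> \<open>\<open>ep\<close> instead of \<open>ef\<close> makes \<open>N u v\<close>
    meaningful on words of every degree, as is required of a \<open>qfun\<close>.\<close>
  define N where "N u v w = c (ep q s (slw q (w @ u)), ef q s (slw q v))" for u v w
  have move: "c (ef q s (slw q w), ef q s (slw q (w' @ u @ v))) = N u v (w @ w')"
    if "deg (Word w) = form_deg s" "deg (Word w') = form_deg s" "deg (Word v) = form_deg s" "deg (Word u) = - form_deg s"
    for w w' u v
  proof -
    have "slw q (w' @ u) \<in> S2 q" "ef q s (slw q w) \<in> carrier (Om_S2 q)" "ef q s (slw q v) \<in> carrier (Om_S2 q)"
      using that s by (simp_all add: cls_in_SL2_deg ef_in_Om_S2' q)
    from balancedD(5)[OF b this(2,1,3)] show ?thesis
      using that by (simp add: N_def ep_slw ract_ef_0 lact_ef_cls pt_mult_pt)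
  qed
  note move' = move[where u = "[x1, x2]" and v = "[x3, x4]" for x1 x2 x3 x4, unfolded append.simps]
  have N: "qfun q (N u v)" if "deg (Word v) = form_deg s" for u v
  proof -
    have v: "ef q s (slw q v) \<in> carrier (Om_S2 q)"
      using that s by (simp add: cls_in_SL2_deg ef_in_Om_S2' q)
    have "qfun q (\<lambda>w. c (ep q s (slw q w), ef q s (slw q v)))"
      by (rule functional_SL2_qfun[of "\<lambda>X. c (ep q s X, ef q s (slw q v))"];
          simp add: ep_add ep_smult balancedD[OF b] ep_in_Om_S2[OF q s] v flip: add_SL2 smult_SL2)
    from qfun_suffix[OF this] show ?thesis by (simp add: N_def[abs_def])
  qed
  \<comment> \<open>The insertion lemmas need a functional defined on all words \<open>w'\<close>;
    on those of degree \<open>form_deg s\<close> it agrees with the one given by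
    \<open>ef\<close>.\<close>
  have right: "qfun q (\<lambda>w'. c (ef q s (slw q w), ep q s (slw q w')))" if "deg (Word w) = form_deg s" for w
  proof -
    have w: "ef q s (slw q w) \<in> carrier (Om_S2 q)"
      using that s by (simp add: cls_in_SL2_deg ef_in_Om_S2' q)
    show ?thesis
      by (rule functional_SL2_qfun[of "\<lambda>X. c (ef q s (slw q w), ep q s X)"];
          simp add: ep_add ep_smult balancedD[OF b] ep_in_Om_S2[OF q s] w flip: add_SL2 smult_SL2)
  qed
  show ?thesis
  proof (cases s)
    case Ep
    show ?thesis
    proof (rule that)
      let ?M = "\<lambda>w. N [Ga, Ga] [Gd, Gd] w + (- inverse q) * N [Ga, Gc] [Gb, Gd] w
        + (- inverse q) * N [Gc, Ga] [Gd, Gb] w + (inverse q)\<^sup>2 * N [Gc, Gc] [Gb, Gb] w"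
      show "qfun q ?M"
        by (intro qfun_add qfun_mult N) (simp_all add: Ep)
      fix w w' assume w: "deg (Word w) = form_deg s" "deg (Word w') = form_deg s"
      show "c (ef q s (slw q w), ef q s (slw q w')) = ?M (w @ w')"
        using qfun_insert_Ep[OF right[OF w(1)], of w'] w by (simp add: ep_slw move'[unfolded Ep] Ep)
    qed
  next
    case Em
    show ?thesis
    proof (rule that)
      let ?M = "\<lambda>w. N [Gd, Gd] [Ga, Ga] w + (- q) * N [Gd, Gb] [Gc, Ga] w
        + (- q) * N [Gb, Gd] [Ga, Gc] w + q\<^sup>2 * N [Gb, Gb] [Gc, Gc] w"
      show "qfun q ?M"
        by (intro qfun_add qfun_mult N) (simp_all add: Em)
      fix w w' assume w: "deg (Word w) = form_deg s" "deg (Word w') = form_deg s"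
      show "c (ef q s (slw q w), ef q s (slw q w')) = ?M (w @ w')"
        using qfun_insert_Em[OF right[OF w(1)], of w'] w by (simp add: ep_slw move'[unfolded Em] Em)
    qed
  qed (use s in simp)
qed

lemma sub_tensor_cls:
  "sub_tensor q M N = cls (Om_Om q) ` {p. Poly_Mapping.keys p \<subseteq> M \<times> N}"
  by (simp add: sub_tensor_def free_mod_def)

lemma Om10_ef: "Om10 q = ef q Ep ` SL2_deg q (-2)"
  by (auto simp: Om10_def ef_def)

lemma Om01_ef: "Om01 q = ef q Em ` SL2_deg q 2"
  by (auto simp: Om01_def ef_def)

text \<open>The e^+ e^+ part is a functional of products only, and db = q bd turns q^2 bbdd + ddbb -
  [2]_q q^2 bdbd into (q^2 + q^4 - [2]_q q^3) bbdd = 0. The e^- e^- part is the same computation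
  with a, c in place of b, d. What remains are the mixed terms.\<close>

lemma metric_in_sum:
  "metric q \<in> sub_tensor q (Om10 q) (Om01 q) <+>\<^bsub>Om_Om q\<^esub> sub_tensor q (Om01 q) (Om10 q)"
proof -
  let ?e = "\<lambda>s w. ef q s (slw q w)"
  \<comment> \<open>The extra q^2 next to [2]_q collects the factor q from each of the two copies of
    db_0.\<close>
  let ?p1 = "scale (q\<^sup>2) (pt (?e Ep [Gb, Gb], ?e Em [Gc, Gc])) + pt (?e Ep [Gd, Gd], ?e Em [Ga, Ga])
    - scale (qint2 q * q\<^sup>2) (pt (?e Ep [Gb, Gd], ?e Em [Ga, Gc]))"
  let ?p2 = "scale (q\<^sup>2) (pt (?e Em [Ga, Ga], ?e Ep [Gd, Gd])) + pt (?e Em [Gc, Gc], ?e Ep [Gb, Gb])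
    - scale (qint2 q * q\<^sup>2) (pt (?e Em [Ga, Gc], ?e Ep [Gb, Gd]))"
  have "metric q = cls (Om_Om q) (?p1 + ?p2)"
    unfolding metric_cls cls_eq_balanced[OF OO.quotient_space_axioms]
  proof (intro allI impI)
    fix c assume b: "balanced (Om_S2 q) (Om_S2 q) (S2 q) (ract q) (lact q) c"
    obtain P where P: "qfun q P" "\<And>w w'. deg (Word w) = -2 \<Longrightarrow> deg (Word w') = -2 \<Longrightarrow> c (?e Ep w, ?e Ep w') = P (w @ w')"
      using balanced_same_type[OF b, of Ep] by auto
    obtain M where M: "qfun q M" "\<And>w w'. deg (Word w) = 2 \<Longrightarrow> deg (Word w') = 2 \<Longrightarrow> c (?e Em w, ?e Em w') = M (w @ w')"
      using balanced_same_type[OF b, of Em] by auto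
    have sc: "ef q s (cls (SL2 q) (scale z (monom w))) = z \<odot>\<^bsub>Om_S2 q\<^esub> ?e s w" for s z w
      by (simp add: smult_Om_S2 ef_smult)
    have mem: "?e Ep [Gb, Gd] \<in> carrier (Om_S2 q)" "?e Em [Ga, Gc] \<in> carrier (Om_S2 q)"
      by (simp_all add: ef_in_Om_S2' q cls_in_SL2_deg)
    show "ev c (metric_rep q) = ev c (?p1 + ?p2)"
      by (simp add: metric_rep_def dif_b[OF q] balanced_form2[OF b] homog_scale sc mem balancedD[OF b] Om_S2_closed[OF q]
          P(2) M(2) qfun_rewrite[OF P(1) q] qfun_rewrite[OF M(1) q])
        (simp add: qint2_def q field_simps power2_eq_square)
  qed
  also have "\<dots> = cls (Om_Om q) ?p1 \<oplus>\<^bsub>Om_Om q\<^esub> cls (Om_Om q) ?p2"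
    by (simp only: OO.add_cls)
  finally have sum: "metric q = cls (Om_Om q) ?p1 \<oplus>\<^bsub>Om_Om q\<^esub> cls (Om_Om q) ?p2" .
  have "?e Ep w \<in> Om10 q" if "deg (Word w) = -2" for w
    using that by (simp add: Om10_ef cls_in_SL2_deg)
  moreover have "?e Em w \<in> Om01 q" if "deg (Word w) = 2" for w
    using that by (simp add: Om01_ef cls_in_SL2_deg)
  ultimately have "Poly_Mapping.keys ?p1 \<subseteq> Om10 q \<times> Om01 q" "Poly_Mapping.keys ?p2 \<subseteq> Om01 q \<times> Om10 q"
    by (intro keys_subset_add keys_subset_diff keys_subset_scale; simp)+
  then have "cls (Om_Om q) ?p1 \<in> sub_tensor q (Om10 q) (Om01 q)" "cls (Om_Om q) ?p2 \<in> sub_tensor q (Om01 q) (Om10 q)"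
    unfolding sub_tensor_cls by blast+
  then show ?thesis
    unfolding sum set_add_def' by blast
qed

lemma ef_component: "f \<in> carrier (SL2 q) \<Longrightarrow> ef q s f t = (if t = s then f else \<zero>\<^bsub>SL2 q\<^esub>)"
  by (auto simp: carrier_SL2 ef_cls fm_def zero_SL2_cls)

text \<open>The composite of \<open>c\<close> with the projection onto \<open>Om10\<close> tensor \<open>Om01\<close>.\<close>

lemma balanced_projection:
  assumes b: "balanced (Om_S2 q) (Om_S2 q) (S2 q) (ract q) (lact q) c"
  shows "balanced (Om_S2 q) (Om_S2 q) (S2 q) (ract q) (lact q) (\<lambda>(\<omega>, \<eta>). c (ef q Ep (\<omega> Ep), ef q Em (\<eta> Em)))"
proof -
  have comp: "\<omega> Ep \<in> SL2_deg q (-2)" "\<omega> Em \<in> SL2_deg q 2" if "\<omega> \<in> carrier (Om_S2 q)" for \<omega>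
    using Om_S2_set_deg[OF q, of \<omega> Ep] Om_S2_set_deg[OF q, of \<omega> Em] that by (simp_all add: carrier_Om_S2)
  have mem: "ef q Ep (\<omega> Ep) \<in> carrier (Om_S2 q)" "ef q Em (\<omega> Em) \<in> carrier (Om_S2 q)"
    if "\<omega> \<in> carrier (Om_S2 q)" for \<omega>
    using comp[OF that] by (simp_all add: ef_in_Om_S2' q)
  have add: "ef q s ((\<omega> \<oplus>\<^bsub>Om_S2 q\<^esub> \<eta>) s) = ef q s (\<omega> s) \<oplus>\<^bsub>Om_S2 q\<^esub> ef q s (\<eta> s)"
    and smult: "ef q s ((z \<odot>\<^bsub>Om_S2 q\<^esub> \<omega>) s) = z \<odot>\<^bsub>Om_S2 q\<^esub> ef q s (\<omega> s)"
    and ract: "r \<in> S2 q \<Longrightarrow> ef q s (ract q \<omega> r s) = ract q (ef q s (\<omega> s)) r"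
    and lact: "r \<in> S2 q \<Longrightarrow> ef q s (lact q r \<eta> s) = lact q r (ef q s (\<eta> s))"
    if "\<omega> \<in> carrier (Om_S2 q)" "\<eta> \<in> carrier (Om_S2 q)" for \<omega> \<eta> s z r
  proof -
    have "\<omega> \<in> range (fm q)" "\<eta> \<in> range (fm q)"
      using that Om_S2_set_subset[OF q] unfolding carrier_Om_S2 carrier_Om_SL2 by blast+
    then obtain x y where w: "\<omega> = fm q x" "\<eta> = fm q y" by blast
    show "ef q s ((\<omega> \<oplus>\<^bsub>Om_S2 q\<^esub> \<eta>) s) = ef q s (\<omega> s) \<oplus>\<^bsub>Om_S2 q\<^esub> ef q s (\<eta> s)"
      and "ef q s ((z \<odot>\<^bsub>Om_S2 q\<^esub> \<omega>) s) = z \<odot>\<^bsub>Om_S2 q\<^esub> ef q s (\<omega> s)"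
      by (simp_all add: w add_Om_S2 smult_Om_S2 add_Om_SL2 smult_Om_SL2 fm_apply ef_add ef_smult)
    show "ef q s (ract q \<omega> r s) = ract q (ef q s (\<omega> s)) r" if r: "r \<in> S2 q"
    proof -
      obtain u where "homog 0 u" "r = cls (SL2 q) u" using r by (rule SL2_degE)
      then show ?thesis by (simp add: w ract_homog ract_ef_0 fm_apply)
    qed
    show "ef q s (lact q r \<eta> s) = lact q r (ef q s (\<eta> s))" if r: "r \<in> S2 q"
    proof -
      obtain u where "r = cls (SL2 q) u" using r by (rule SL2_degE)
      then show ?thesis by (simp add: w lact_fm lact_ef_cls fm_apply)
    qed
  qed
  show ?thesis
    unfolding balanced_def
    by (auto simp: add smult ract lact mem balancedD[OF b])
qed

text \<open>Let X be represented both by \<open>p\<close> and by \<open>p'\<close>, of the two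
  types. The projected functional agrees with \<open>c\<close> on \<open>p\<close> and vanishes on
  \<open>p'\<close>, so every balanced \<open>c\<close> vanishes on X.\<close>

lemma sub_tensor_Int:
  "sub_tensor q (Om10 q) (Om01 q) \<inter> sub_tensor q (Om01 q) (Om10 q) = {\<zero>\<^bsub>Om_Om q\<^esub>}"
proof
  show "{\<zero>\<^bsub>Om_Om q\<^esub>} \<subseteq> sub_tensor q (Om10 q) (Om01 q) \<inter> sub_tensor q (Om01 q) (Om10 q)"
    unfolding sub_tensor_cls OO.zero_T_cls by (auto intro!: image_eqI[of _ _ 0])
  show "sub_tensor q (Om10 q) (Om01 q) \<inter> sub_tensor q (Om01 q) (Om10 q) \<subseteq> {\<zero>\<^bsub>Om_Om q\<^esub>}"
  proof
    fix X assume "X \<in> sub_tensor q (Om10 q) (Om01 q) \<inter> sub_tensor q (Om01 q) (Om10 q)"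
    then obtain p p' where p: "X = cls (Om_Om q) p" "Poly_Mapping.keys p \<subseteq> Om10 q \<times> Om01 q"
      and p': "X = cls (Om_Om q) p'" "Poly_Mapping.keys p' \<subseteq> Om01 q \<times> Om10 q"
      unfolding sub_tensor_cls by blast
    have "cls (Om_Om q) p = cls (Om_Om q) 0"
      unfolding cls_eq_balanced[OF OO.quotient_space_axioms]
    proof (intro allI impI)
      fix c assume b: "balanced (Om_S2 q) (Om_S2 q) (S2 q) (ract q) (lact q) c"
      let ?c = "\<lambda>(\<omega>, \<eta>). c (ef q Ep (\<omega> Ep), ef q Em (\<eta> Em))"
      have c: "f \<in> SL2_deg q n \<Longrightarrow> f \<in> carrier (SL2 q)" for f n
        using SL2_deg_subset_carrier by blast
      \<comment> \<open>\<open>balanced\<close> has no clause for zero; vanishing at a pair of zeros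
        follows from homogeneity with the scalar 0.\<close>
      have e0: "ef q Ep (\<zero>\<^bsub>SL2 q\<^esub>) = 0 \<odot>\<^bsub>Om_S2 q\<^esub> ef q Ep (\<zero>\<^bsub>SL2 q\<^esub>)"
        by (simp add: zero_SL2_cls smult_Om_S2 ef_smult)
      have "\<zero>\<^bsub>SL2 q\<^esub> \<in> SL2_deg q n" for n
        unfolding zero_SL2_cls by (intro cls_in_SL2_deg homog_zero)
      then have z: "ef q Ep (\<zero>\<^bsub>SL2 q\<^esub>) \<in> carrier (Om_S2 q)" "ef q Em (\<zero>\<^bsub>SL2 q\<^esub>) \<in> carrier (Om_S2 q)"
        by (simp_all add: ef_in_Om_S2' q)
      have "c (ef q Ep (\<zero>\<^bsub>SL2 q\<^esub>), ef q Em (\<zero>\<^bsub>SL2 q\<^esub>)) = 0"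
        using balancedD(3)[OF b z, of 0] e0 by simp
      then have c0: "ev ?c p' = ev (\<lambda>_. 0) p'"
        by (intro ev_cong) (use p'(2) in \<open>auto simp: Om10_ef Om01_ef ef_component c dest!: subsetD\<close>)
      have "ev c p = ev ?c p"
        by (rule ev_cong) (use p(2) in \<open>auto simp: Om10_ef Om01_ef ef_component c dest!: subsetD\<close>)
      also have "\<dots> = ev ?c p'"
        using p(1) p'(1) balanced_projection[OF b] cls_eq_balanced[OF OO.quotient_space_axioms, of p p'] by blast
      finally show "ev c p = ev c 0" using c0 by simp
    qed
    then show "X \<in> {\<zero>\<^bsub>Om_Om q\<^esub>}" by (simp add: p(1) OO.zero_T_cls)
  qed
qed

section \<open>Invariance of the metric\<close>

text \<open>The coefficients of $\Delta_L g$ with respect to the nine tensors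
  $\mathrm{d}b_i \bar\otimes \mathrm{d}b_j$, each solved for one monomial.\<close>

lemma metric_coefficients:
  assumes "qfun q F"
  shows "F [Gc, Gc, Ga, Ga] = qint2 q * q\<^sup>2 * F [Ga, Gc, Ga, Gc] - q\<^sup>2 * F [Ga, Ga, Gc, Gc]"
    and "F [Gc, Gc, Ga, Gb] = q * F [Ga, Gc, Ga, Gd] + q\<^sup>2 * F [Ga, Gc, Gb, Gc] - q\<^sup>2 * F [Ga, Ga, Gc, Gd]"
    and "F [Gc, Gc, Gb, Gb] = q\<^sup>2 * F [] + qint2 q * q\<^sup>2 * F [Ga, Gc, Gb, Gd] - q\<^sup>2 * F [Ga, Ga, Gd, Gd]"
    and "F [Gc, Gd, Ga, Ga] = q * F [Ga, Gd, Ga, Gc] + q\<^sup>2 * F [Gb, Gc, Ga, Gc] - q\<^sup>2 * F [Ga, Gb, Gc, Gc]"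
    and "F [Ga, Gd, Ga, Gd] = F [] + qint2 q * (q\<^sup>2 * F [Ga, Gb, Gc, Gd] + F [Gc, Gd, Ga, Gb])
      - q * F [Ga, Gd, Gb, Gc] - q * F [Gb, Gc, Ga, Gd] - q\<^sup>2 * F [Gb, Gc, Gb, Gc]"
    and "F [Gc, Gd, Gb, Gb] = q * F [Ga, Gd, Gb, Gd] + q\<^sup>2 * F [Gb, Gc, Gb, Gd] - q\<^sup>2 * F [Ga, Gb, Gd, Gd]"
    and "F [Gd, Gd, Ga, Ga] = F [] + qint2 q * q\<^sup>2 * F [Gb, Gd, Ga, Gc] - q\<^sup>2 * F [Gb, Gb, Gc, Gc]"
    and "F [Gd, Gd, Ga, Gb] = q * F [Gb, Gd, Ga, Gd] + q\<^sup>2 * F [Gb, Gd, Gb, Gc] - q\<^sup>2 * F [Gb, Gb, Gc, Gd]"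
    and "F [Gd, Gd, Gb, Gb] = qint2 q * q\<^sup>2 * F [Gb, Gd, Gb, Gd] - q\<^sup>2 * F [Gb, Gb, Gd, Gd]"
  by (simp add: qfun_rewrite[OF assms q]; simp add: qint2_def q field_simps power2_eq_square)+

text \<open>For example Delta(a^2) = a^2 tensor a^2 + (1 + q^2) ab tensor ac + b^2 tensor c^2,
  because ba = q ab and ca = q ac; here 1 + q^2 = q [2]_q, and q ac is the e^- coefficient of db_0.
  The middle entry ad + q bc is written as two terms, one word each.\<close>

lemma coaction_dif_b:
  shows "coaction q (dif q (bm q)) = cls (tensorC (SL2 q) (Om_S2 q))
      (pt (slw q [Ga, Ga], dif q (bm q)) + scale (qint2 q) (pt (slw q [Ga, Gb], dif q (b0 q)))
        + pt (slw q [Gb, Gb], dif q (bp q)))"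
    and "coaction q (dif q (bp q)) = cls (tensorC (SL2 q) (Om_S2 q))
      (pt (slw q [Gc, Gc], dif q (bm q)) + scale (qint2 q) (pt (slw q [Gc, Gd], dif q (b0 q)))
        + pt (slw q [Gd, Gd], dif q (bp q)))"
    and "coaction q (dif q (b0 q)) = cls (tensorC (SL2 q) (Om_S2 q))
      (scale q (pt (slw q [Ga, Gc], dif q (bm q)))
        + (pt (slw q [Ga, Gd], dif q (b0 q)) + scale q (pt (slw q [Gb, Gc], dif q (b0 q))))
        + scale q (pt (slw q [Gb, Gd], dif q (bp q))))"
proof -
  have co: "coaction q (form2 q x y) = cls (tensorC (SL2 q) (Om_S2 q)) (coact q Ep x + coact q Em y)"
    if "homog (-2) x" "homog 2 y" for x y
    by (rule coaction_eq[OF q that(1) _ that(2)]) (simp_all add: form2_def fm_apply)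
  \<comment> \<open>Both sides of the claim thus become sums of values of the same two
    \<open>biqfun\<close>s, one for e^+ and one for e^-, and are compared by normalizing words in
    each leg.\<close>
  have b2: "b (slw q u, form2 q x y) = evw (\<lambda>v. b (slw q u, ep q Ep (slw q v))) x + evw (\<lambda>v. b (slw q u, ep q Em (slw q v))) y"
    if b: "balancedC (SL2 q) (Om_S2 q) b" and x: "homog (-2) x" "homog 2 y" for b u x y
  proof -
    have mem: "ef q Ep (cls (SL2 q) x) \<in> carrier (Om_S2 q)" "ef q Em (cls (SL2 q) y) \<in> carrier (Om_S2 q)"
      by (rule ef_in_Om_S2'[OF q]; simp add: x cls_in_SL2_deg)+
    have e: "ef q Ep (cls (SL2 q) x) = ep q Ep (cls (SL2 q) x)" "ef q Em (cls (SL2 q) y) = ep q Em (cls (SL2 q) y)"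
      by (simp_all add: ep_eq_ef x cls_in_SL2_deg)
    have f: "b (slw q u, ep q s (cls (SL2 q) x)) = evw (\<lambda>v. b (slw q u, ep q s (slw q v))) x" if "s \<noteq> E0" for s x
      by (rule functional_SL2_eq[of "\<lambda>X. b (slw q u, ep q s X)"];
          simp add: ep_add ep_smult balancedD[OF b] ep_in_Om_S2[OF q that] flip: add_SL2 smult_SL2)
    have "b (slw q u, form2 q x y) = b (slw q u, ef q Ep (cls (SL2 q) x)) + b (slw q u, ef q Em (cls (SL2 q) y))"
      unfolding form2_split add_Om_S2[symmetric] using mem by (simp add: balancedD[OF b])
    then show ?thesis by (simp add: e f[of Ep x] f[of Em y])
  qed
  have bi: "biqfun q (\<lambda>u v. b (slw q u, ep q s (slw q v)))" if "balancedC (SL2 q) (Om_S2 q) b" "s \<noteq> E0" for b s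
    using biqfun_balancedC_SL2[OF balancedC_ep[OF that(1) q that(2)]] by simp
  have co': "coaction q (dif q (bm q)) = cls (tensorC (SL2 q) (Om_S2 q)) (coact q Ep (monom [Gb, Gb]) + coact q Em (monom [Ga, Ga]))"
    "coaction q (dif q (bp q)) = cls (tensorC (SL2 q) (Om_S2 q)) (coact q Ep (monom [Gd, Gd]) + coact q Em (monom [Gc, Gc]))"
    "coaction q (dif q (b0 q)) = cls (tensorC (SL2 q) (Om_S2 q))
      (coact q Ep (scale q (monom [Gb, Gd])) + coact q Em (scale q (monom [Ga, Gc])))"
    unfolding dif_b[OF q] by (rule co; simp add: homog_scale)+
  have main: "ev b (coact q Ep (monom [Gb, Gb]) + coact q Em (monom [Ga, Ga])) = ev b
      (pt (slw q [Ga, Ga], dif q (bm q)) + scale (qint2 q) (pt (slw q [Ga, Gb], dif q (b0 q)))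
        + pt (slw q [Gb, Gb], dif q (bp q)))"
    "ev b (coact q Ep (monom [Gd, Gd]) + coact q Em (monom [Gc, Gc])) = ev b
      (pt (slw q [Gc, Gc], dif q (bm q)) + scale (qint2 q) (pt (slw q [Gc, Gd], dif q (b0 q)))
        + pt (slw q [Gd, Gd], dif q (bp q)))"
    "ev b (coact q Ep (scale q (monom [Gb, Gd])) + coact q Em (scale q (monom [Ga, Gc]))) = ev b
      (scale q (pt (slw q [Ga, Gc], dif q (bm q)))
        + (pt (slw q [Ga, Gd], dif q (b0 q)) + scale q (pt (slw q [Gb, Gc], dif q (b0 q))))
        + scale q (pt (slw q [Gb, Gd], dif q (bp q))))"
    if b: "balancedC (SL2 q) (Om_S2 q) b" for b
  proof -
    have B: "biqfun q (\<lambda>u v. b (slw q u, ep q Ep (slw q v)))" "biqfun q (\<lambda>u v. b (slw q u, ep q Em (slw q v)))"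
      by (simp_all add: bi[OF b])
    note R = qfun_rewrite[OF biqfunD(1)[OF B(1)] q] qfun_rewrite[OF biqfunD(2)[OF B(1)] q]
      qfun_rewrite[OF biqfunD(1)[OF B(2)] q] qfun_rewrite[OF biqfunD(2)[OF B(2)] q]
    show "ev b (coact q Ep (monom [Gb, Gb]) + coact q Em (monom [Ga, Ga])) = ev b
      (pt (slw q [Ga, Ga], dif q (bm q)) + scale (qint2 q) (pt (slw q [Ga, Gb], dif q (b0 q)))
        + pt (slw q [Gb, Gb], dif q (bp q)))"
      "ev b (coact q Ep (monom [Gd, Gd]) + coact q Em (monom [Gc, Gc])) = ev b
      (pt (slw q [Gc, Gc], dif q (bm q)) + scale (qint2 q) (pt (slw q [Gc, Gd], dif q (b0 q)))
        + pt (slw q [Gd, Gd], dif q (bp q)))"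
      "ev b (coact q Ep (scale q (monom [Gb, Gd])) + coact q Em (scale q (monom [Ga, Gc]))) = ev b
      (scale q (pt (slw q [Ga, Gc], dif q (bm q)))
        + (pt (slw q [Ga, Gd], dif q (b0 q)) + scale q (pt (slw q [Gb, Gc], dif q (b0 q))))
        + scale q (pt (slw q [Gb, Gd], dif q (bp q))))"
      by (simp add: ev_coact homog_scale dif_b[OF q] b2[OF b] R; simp add: q qint2_def field_simps)+
  qed
  show "coaction q (dif q (bm q)) = cls (tensorC (SL2 q) (Om_S2 q))
      (pt (slw q [Ga, Ga], dif q (bm q)) + scale (qint2 q) (pt (slw q [Ga, Gb], dif q (b0 q)))
        + pt (slw q [Gb, Gb], dif q (bp q)))"
    "coaction q (dif q (bp q)) = cls (tensorC (SL2 q) (Om_S2 q))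
      (pt (slw q [Gc, Gc], dif q (bm q)) + scale (qint2 q) (pt (slw q [Gc, Gd], dif q (b0 q)))
        + pt (slw q [Gd, Gd], dif q (bp q)))"
    "coaction q (dif q (b0 q)) = cls (tensorC (SL2 q) (Om_S2 q))
      (scale q (pt (slw q [Ga, Gc], dif q (bm q)))
        + (pt (slw q [Ga, Gd], dif q (b0 q)) + scale q (pt (slw q [Gb, Gc], dif q (b0 q))))
        + scale q (pt (slw q [Gb, Gd], dif q (bp q))))"
    unfolding co' cls_eq_balanced[OF SO.quotient_space_axioms]
    by (intro allI impI main; assumption)+
qed

lemma metric_invariant: "left_invariant q (metric q)"
  unfolding left_invariant_def metric_cls coaction_ten_cls[OF q keys_metric_rep]
    cls_eq_balanced[OF SOO.quotient_space_axioms]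
proof (intro allI impI)
  fix b assume b: "balancedC (SL2 q) (Om_Om q) b"
  let ?n = "dif q (bm q)" and ?p = "dif q (bp q)" and ?z = "dif q (b0 q)"
  have "b (\<one>\<^bsub>SL2 q\<^esub>, cls (Om_Om q) (metric_rep q))
      = q\<^sup>2 * b (slw q [], ot q ?n ?p) + b (slw q [], ot q ?p ?n) - qint2 q * b (slw q [], ot q ?z ?z)"
  proof -
    \<comment> \<open>The difference is rewritten with the scalar -[2]_q, since
      \<open>balancedD\<close> speaks only of sums and scalar multiples.\<close>
    have "metric_rep q = scale (q\<^sup>2) (pt (?n, ?p)) + pt (?p, ?n) + scale (- qint2 q) (pt (?z, ?z))"
      by (simp add: metric_rep_def)
    then have "cls (Om_Om q) (metric_rep q) = q\<^sup>2 \<odot>\<^bsub>Om_Om q\<^esub> ot q ?n ?p \<oplus>\<^bsub>Om_Om q\<^esub> ot q ?p ?n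
        \<oplus>\<^bsub>Om_Om q\<^esub> (- qint2 q) \<odot>\<^bsub>Om_Om q\<^esub> ot q ?z ?z"
      by (simp add: OO.add_cls OO.smult_cls)
    moreover have "z \<odot>\<^bsub>Om_Om q\<^esub> ot q \<omega> \<eta> \<in> carrier (Om_Om q)"
      if "\<omega> \<in> carrier (Om_S2 q)" "\<eta> \<in> carrier (Om_S2 q)" for z \<omega> \<eta>
      using that by (simp add: OO.smult_cls OO.cls_in_carrier keys_subset_scale)
    ultimately show ?thesis
      by (simp add: balancedD[OF b] OO.a_closed ot_in_carrier[OF q] dif_in_Om_S2 one_SL2 one_conv_pt)
  qed
  moreover have F: "qfun q (\<lambda>w. b (slw q w, ot q \<omega> \<eta>))"
    if "\<omega> \<in> carrier (Om_S2 q)" "\<eta> \<in> carrier (Om_S2 q)" for \<omega> \<eta>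
    by (rule balancedC_SL2_qfun(2)[OF b ot_in_carrier[OF q that]])
  \<comment> \<open>One identity per tensor db_i tensor db_j, in the order b_-, b_0, b_+ for each
    index, applied to the functional with that tensor held fixed. In the middle one a common factor
    [2]_q has been divided out, so that it also holds where [2]_q = 0.\<close>
  note r = metric_coefficients(1)[OF F[OF dif_in_Om_S2(1) dif_in_Om_S2(1)]]
    metric_coefficients(2)[OF F[OF dif_in_Om_S2(1) dif_in_Om_S2(3)]]
    metric_coefficients(3)[OF F[OF dif_in_Om_S2(1) dif_in_Om_S2(2)]]
    metric_coefficients(4)[OF F[OF dif_in_Om_S2(3) dif_in_Om_S2(1)]]
    metric_coefficients(5)[OF F[OF dif_in_Om_S2(3) dif_in_Om_S2(3)]]
    metric_coefficients(6)[OF F[OF dif_in_Om_S2(3) dif_in_Om_S2(2)]]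
    metric_coefficients(7)[OF F[OF dif_in_Om_S2(2) dif_in_Om_S2(1)]]
    metric_coefficients(8)[OF F[OF dif_in_Om_S2(2) dif_in_Om_S2(3)]]
    metric_coefficients(9)[OF F[OF dif_in_Om_S2(2) dif_in_Om_S2(2)]]
  have k: "Poly_Mapping.keys (pt (slw q w, \<omega>)) \<subseteq> carrier (SL2 q) \<times> carrier (Om_S2 q)"
    if "\<omega> \<in> carrier (Om_S2 q)" for w \<omega>
    using that by simp
  note K = k[OF dif_in_Om_S2(1)] k[OF dif_in_Om_S2(2)] k[OF dif_in_Om_S2(3)]
  have np: "pairing q b (?n, ?p) = ev b (pair_prod q
      (pt (slw q [Ga, Ga], ?n) + scale (qint2 q) (pt (slw q [Ga, Gb], ?z)) + pt (slw q [Gb, Gb], ?p))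
      (pt (slw q [Gc, Gc], ?n) + scale (qint2 q) (pt (slw q [Gc, Gd], ?z)) + pt (slw q [Gd, Gd], ?p)))"
    by (rule pairing_eq[OF q b _ _ coaction_dif_b(1) coaction_dif_b(2)])
      (intro dif_in_Om_S2 keys_subset_add keys_subset_scale K)+
  have pn: "pairing q b (?p, ?n) = ev b (pair_prod q
      (pt (slw q [Gc, Gc], ?n) + scale (qint2 q) (pt (slw q [Gc, Gd], ?z)) + pt (slw q [Gd, Gd], ?p))
      (pt (slw q [Ga, Ga], ?n) + scale (qint2 q) (pt (slw q [Ga, Gb], ?z)) + pt (slw q [Gb, Gb], ?p)))"
    by (rule pairing_eq[OF q b _ _ coaction_dif_b(2) coaction_dif_b(1)])
      (intro dif_in_Om_S2 keys_subset_add keys_subset_scale K)+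
  have zz: "pairing q b (?z, ?z) = ev b (pair_prod q
      (scale q (pt (slw q [Ga, Gc], ?n)) + (pt (slw q [Ga, Gd], ?z) + scale q (pt (slw q [Gb, Gc], ?z)))
        + scale q (pt (slw q [Gb, Gd], ?p)))
      (scale q (pt (slw q [Ga, Gc], ?n)) + (pt (slw q [Ga, Gd], ?z) + scale q (pt (slw q [Gb, Gc], ?z)))
        + scale q (pt (slw q [Gb, Gd], ?p))))"
    by (rule pairing_eq[OF q b _ _ coaction_dif_b(3) coaction_dif_b(3)])
      (intro dif_in_Om_S2 keys_subset_add keys_subset_scale K)+
  have "ev (pairing q b) (metric_rep q)
      = q\<^sup>2 * b (slw q [], ot q ?n ?p) + b (slw q [], ot q ?p ?n) - qint2 q * b (slw q [], ot q ?z ?z)"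
    unfolding metric_rep_def ev_add ev_diff ev_scale ev_single np pn zz
    by (simp add: ev_pair_prod mult_SL2 pt_mult_pt r) (simp add: algebra_simps power2_eq_square)
  moreover have "ev b (lext (\<lambda>(\<omega>, \<eta>). pair_prod q (coact_rep q \<omega>) (coact_rep q \<eta>)) (metric_rep q))
      = ev (pairing q b) (metric_rep q)"
    by (simp add: pairing_def case_prod_unfold)
  ultimately show "ev b (lext (\<lambda>(\<omega>, \<eta>). pair_prod q (coact_rep q \<omega>) (coact_rep q \<eta>)) (metric_rep q))
      = ev b (pt (\<one>\<^bsub>SL2 q\<^esub>, cls (Om_Om q) (metric_rep q)))"
    by simp
qed

end

text \<open>The trivial intersection expresses that the sum of the two images in
  \<open>Om_Om q\<close> is direct.\<close>

theorem proposition4p2: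
  fixes q :: complex
  assumes "q \<noteq> 0"
  shows "metric q \<in> carrier (Om_Om q)
    \<and> left_invariant q (metric q)
    \<and> wedge q (metric q) = \<zero>\<^bsub>Om2_SL2 q\<^esub>
    \<and> sub_tensor q (Om10 q) (Om01 q) \<inter> sub_tensor q (Om01 q) (Om10 q) = {\<zero>\<^bsub>Om_Om q\<^esub>}
    \<and> metric q \<in> sub_tensor q (Om10 q) (Om01 q) <+>\<^bsub>Om_Om q\<^esub> sub_tensor q (Om01 q) (Om10 q)"
  using metric_in_carrier[OF assms] metric_invariant[OF assms] wedge_metric[OF assms] sub_tensor_Int[OF assms]
    metric_in_sum[OF assms] by blast

end
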